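(* Let $d\ge1$ and $\mathbf n=(n_1,\dots,n_d)$ with integers $n_i\ge2$, $i=1,\dots,d$. Let $\mu_i,\nu_i$ be probability measures on $\mathbb R$ such that $\int_{-\infty}^\infty|x|^{n_i-1}\,\mu_i(dx)<\infty$ and $\int_{-\infty}^\infty|x|^{n_i-1}\,\nu_i(dx)<\infty$ for $i=1,\dots,d$. Then the following conditions are equivalent: (a) (the Raşa inequality for continuous box-$\mathbf n$-convex functions) $(\nu_1-\mu_1)^{*n_1}\otimes\dots\otimes(\nu_d-\mu_d)^{*n_d}\succ_{\mathrm{box}\text{-}\mathbf n\text{-}\mathrm{cx}}0$; (b) $(\overline F_{\nu_1}-\overline F_{\mu_1})^{*n_1}(A_1)\cdot\ldots\cdot(\overline F_{\nu_d}-\overline F_{\mu_d})^{*n_d}(A_d)\ge0$ for all $A_1,\dots,A_d\in\mathbb R$.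
   Context: For a finite signed Borel measure $\tau$ on $\mathbb R$, $\tau^{*q}$ is the $q$-fold convolution power, and $\overline F_\tau(x)=\tau([x,\infty))$. In (b), $g^{*q}$ denotes the $q$-fold convolution power of the function $g$ on $\mathbb R$ (with respect to Lebesgue measure). $\otimes$ denotes the product of signed measures. For a signed measure $\gamma$ on $\mathbb R^d$ of finite variation, $\gamma\succ_{\mathrm{box}\text{-}\mathbf n\text{-}\mathrm{cx}}0$ means that $\int_{\mathbb R^d}f\,d\gamma\ge0$ for all continuous box-$\mathbf n$-convex functions $f\colon\mathbb R^d\to\mathbb R$ for which the integral exists (i.e. $f$ is $|\gamma|$-integrable). Divided differences: for a real function $g$ of one variable and pairwise distinct points, $[x_0;g]=g(x_0)$ and $[x_0,\dots,x_n;g]=\dfrac{[x_1,\dots,x_n;g]-[x_0,\dots,x_{n-1};g]}{x_n-x_0}$ for $n\ge1$. Multiple divided differences: for $f\colon\mathbb R^d\to\mathbb R$ and vectors $\mathbf x_i=(x_{i0},\dots,x_{in_i})\in\mathbb R^{n_i+1}$ with pairwise distinct coordinates ($i=1,\dots,d$), $[\mathbf x_1;\dots;\mathbf x_d;f]$ is defined by induction on $d$: for $d=1$ it is $[x_{10},\dots,x_{1n_1};f]$; for $d>1$ it is $[x_{d0},\dots,x_{dn_d};g]$, where $g(x)=[\mathbf x_1;\dots;\mathbf x_{d-1};f(\cdot,\dots,\cdot,x)]$. The function $f$ is box-$\mathbf n$-convex if $[\mathbf x_1;\dots;\mathbf x_d;f]\ge0$ for all such $\mathbf x_1,\dots,\mathbf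 x_d$. *)

theory Defs
  imports "HOL-Probability.Probability"
begin

text \<open>
  A finite signed measure on a measurable space \<open>M\<close> is represented by its (real-valued, countably
  additive) set function \<open>\<tau> :: 'a set \<Rightarrow> real\<close>, of which only the values on \<open>sets M\<close> matter; of \<open>M\<close>
  itself only \<open>space M\<close> and \<open>sets M\<close> are used.  A finite measure \<open>\<mu>\<close> is identified with \<open>measure \<mu>\<close>.
  The next two measures are the parts of the Jordan decomposition \<open>\<tau> = \<tau>\<^sup>+ - \<tau>\<^sup>-\<close>, given by
  \<open>\<tau>\<^sup>+(A) = sup {\<tau>(B) | B \<subseteq> A}\<close> and \<open>\<tau>\<^sup>- = (-\<tau>)\<^sup>+\<close>.  Note that \<open>ennreal\<close> sends negative reals to \<open>0\<close>,
  which does not change the supremum because \<open>B = {}\<close> is admitted.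
\<close>

definition pos_part :: "'a measure \<Rightarrow> ('a set \<Rightarrow> real) \<Rightarrow> 'a measure" where
  "pos_part M \<tau> = measure_of (space M) (sets M)
     (\<lambda>A. SUP B\<in>{B \<in> sets M. B \<subseteq> A}. ennreal (\<tau> B))"

definition neg_part :: "'a measure \<Rightarrow> ('a set \<Rightarrow> real) \<Rightarrow> 'a measure" where
  "neg_part M \<tau> = pos_part M (\<lambda>A. - \<tau> A)"

definition total_variation :: "'a measure \<Rightarrow> ('a set \<Rightarrow> real) \<Rightarrow> 'a measure" where
  "total_variation M \<tau> = measure_of (space M) (sets M)
     (\<lambda>A. emeasure (pos_part M \<tau>) A + emeasure (neg_part M \<tau>) A)"

definition sintegrable :: "'a measure \<Rightarrow> ('a set \<Rightarrow> real) \<Rightarrow> ('a \<Rightarrow> real) \<Rightarrow> bool" where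
  "sintegrable M \<tau> f \<longleftrightarrow> integrable (total_variation M \<tau>) f"

definition sintegral :: "'a measure \<Rightarrow> ('a set \<Rightarrow> real) \<Rightarrow> ('a \<Rightarrow> real) \<Rightarrow> real" where
  "sintegral M \<tau> f = (\<integral>x. f x \<partial>pos_part M \<tau>) - (\<integral>x. f x \<partial>neg_part M \<tau>)"

definition sconv :: "(real set \<Rightarrow> real) \<Rightarrow> (real set \<Rightarrow> real) \<Rightarrow> real set \<Rightarrow> real" where
  "sconv \<sigma> \<tau> A = sintegral borel \<tau> (\<lambda>y. \<sigma> {x. x + y \<in> A})"

text \<open>Convolution powers are meant for exponents \<open>q \<ge> 1\<close>; the first power is the argument itself.\<close>

definition sconv_power :: "(real set \<Rightarrow> real) \<Rightarrow> nat \<Rightarrow> real set \<Rightarrow> real" where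
  "sconv_power \<tau> q = ((\<lambda>\<sigma>. sconv \<sigma> \<tau>) ^^ (q - 1)) \<tau>"

definition fconv :: "(real \<Rightarrow> real) \<Rightarrow> (real \<Rightarrow> real) \<Rightarrow> real \<Rightarrow> real" where
  "fconv f g x = (\<integral>y. f (x - y) * g y \<partial>lborel)"

definition fconv_power :: "(real \<Rightarrow> real) \<Rightarrow> nat \<Rightarrow> real \<Rightarrow> real" where
  "fconv_power g q = ((\<lambda>h. fconv h g) ^^ (q - 1)) g"

definition tail :: "(real set \<Rightarrow> real) \<Rightarrow> real \<Rightarrow> real" where
  "tail \<tau> x = \<tau> {x..}"

text \<open>
  The space \<open>\<real>\<^sup>d\<close> is the set of extensional functions on \<open>{..<d}\<close>, so coordinates are numbered from
  \<open>0\<close>.  Its Borel sets are those of the following product; as a topological space it is a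
  subspace of the product space \<open>nat \<Rightarrow> real\<close>.
\<close>

abbreviation Rd :: "nat \<Rightarrow> (nat \<Rightarrow> real) measure" where
  "Rd d \<equiv> Pi\<^sub>M {..<d} (\<lambda>_. borel)"

text \<open>
  The product \<open>(\<tau>\<^sub>0\<^sup>+ - \<tau>\<^sub>0\<^sup>-) \<otimes> \<dots> \<otimes> (\<tau>\<^bsub>d-1\<^esub>\<^sup>+ - \<tau>\<^bsub>d-1\<^esub>\<^sup>-)\<close> expanded multilinearly into products of
  measures; \<open>S\<close> is the set of coordinates that contribute their negative part.
\<close>

definition sprod :: "nat \<Rightarrow> (nat \<Rightarrow> real set \<Rightarrow> real) \<Rightarrow> (nat \<Rightarrow> real) set \<Rightarrow> real" where
  "sprod d \<tau> E = (\<Sum>S\<in>Pow {..<d}. (- 1) ^ card S *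
     measure (Pi\<^sub>M {..<d} (\<lambda>i. if i \<in> S then neg_part borel (\<tau> i) else pos_part borel (\<tau> i))) E)"

text \<open>\<open>divdiff g x i k\<close> is the divided difference \<open>[x\<^sub>i, \<dots>, x\<^bsub>i+k\<^esub>; g]\<close>.\<close>

primrec divdiff :: "(real \<Rightarrow> real) \<Rightarrow> (nat \<Rightarrow> real) \<Rightarrow> nat \<Rightarrow> nat \<Rightarrow> real" where
  "divdiff g x i 0 = g (x i)"
| "divdiff g x i (Suc k) =
     (divdiff g x (Suc i) k - divdiff g x i k) / (x (i + Suc k) - x i)"

text \<open>
  \<open>X i j\<close> is the \<open>j\<close>-th coordinate of the vector \<open>\<^bold>x\<^sub>i\<close>.  The recursion starts at \<open>d = 0\<close>, where
  \<open>\<lambda>_. undefined\<close> is the only point of the space; at \<open>d = 1\<close> it gives the ordinary divided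
  difference.
\<close>

primrec mdivdiff :: "(nat \<Rightarrow> nat) \<Rightarrow> (nat \<Rightarrow> nat \<Rightarrow> real) \<Rightarrow> nat \<Rightarrow> ((nat \<Rightarrow> real) \<Rightarrow> real) \<Rightarrow> real" where
  "mdivdiff n X 0 f = f (\<lambda>_. undefined)"
| "mdivdiff n X (Suc d) f =
     divdiff (\<lambda>x. mdivdiff n X d (\<lambda>y. f (y(d := x)))) (X d) 0 (n d)"

definition box_convex :: "nat \<Rightarrow> (nat \<Rightarrow> nat) \<Rightarrow> ((nat \<Rightarrow> real) \<Rightarrow> real) \<Rightarrow> bool" where
  "box_convex d n f \<longleftrightarrow>
     (\<forall>X. (\<forall>i<d. inj_on (X i) {..n i}) \<longrightarrow> 0 \<le> mdivdiff n X d f)"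

definition box_cx_nonneg :: "nat \<Rightarrow> (nat \<Rightarrow> nat) \<Rightarrow> ((nat \<Rightarrow> real) set \<Rightarrow> real) \<Rightarrow> bool" where
  "box_cx_nonneg d n \<gamma> \<longleftrightarrow>
     (\<forall>f. continuous_on (space (Rd d)) f \<and> box_convex d n f \<and> sintegrable (Rd d) \<gamma> f
        \<longrightarrow> 0 \<le> sintegral (Rd d) \<gamma> f)"

end

theory Submission
  imports Defs
begin

text \<open>
  Let \<open>\<gamma>\<^sub>i = (\<nu>\<^sub>i - \<mu>\<^sub>i)\<^sup>*\<^sup>n\<close> with \<open>n = n\<^sub>i\<close>.  It annihilates the polynomials of degree less than \<open>n\<close>, and
  iterated Fubini gives \<open>\<integral> (x - A)\<^sub>+\<^bsup>n-1\<^esup> / (n-1)! d\<gamma>\<^sub>i = K\<^sub>i(A)\<close>, where \<open>K\<^sub>i\<close> is the convolution power of the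
  tail difference.  Products of truncated powers are box-convex, so the integral inequality implies
  \<open>\<Prod> K\<^sub>i(A\<^sub>i) \<ge> 0\<close>.

  For the converse let \<open>f\<close> be continuous, box-convex and integrable.  Subtracting from \<open>f\<close> its Lagrange
  interpolant in each coordinate, with nodes at which the slices of \<open>f\<close> are integrable, does not change
  the integral, so \<open>f\<close> may be assumed to vanish whenever some coordinate is a node.  Then \<open>f\<close> is the
  limit, as the mesh tends to \<open>0\<close>, of the interpolation remainders of its B-spline quasi-interpolants;
  summation by parts turns these into sums of mixed finite differences of \<open>f\<close>, which are nonnegative,
  times products of Peano kernels \<open>k\<^sub>i(x\<^sub>i, t\<^sub>i)\<close>.  The Peano kernels satisfy \<open>\<integral> k\<^sub>i(x, t) \<gamma>\<^sub>i(dx) = K\<^sub>i(t)\<close>, so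
  keeping only the knots in a cube gives functions with nonnegative integral.  For fixed \<open>x\<close> all terms
  of the sum have the same sign, so this truncation only decreases the absolute value, and two
  passages to the limit (mesh to \<open>0\<close>, then cube to \<open>\<real>\<^sup>d\<close>) finish the proof.  No differentiability of \<open>f\<close>
  is needed.
\<close>

section \<open>Divided differences and truncated powers\<close>

text \<open>Integrability of \<open>f\<close> for the product measure controls neither individual
  slices nor finite differences of \<open>f\<close>. Hence the nodes have to be chosen by Fubini,
  and the approximants cannot be dominated by a multiple of \<open>f\<close>. For a fixed cube they
  have a bound that is polynomial of degree \<open>n i - 1\<close> in each coordinate and uniform in
  the mesh; the moment hypotheses make it integrable, which settles the mesh limit. Outside the cube
  the truncated sums need not converge to \<open>f\<close>, but because of the constant sign they
  are dominated by the sums for any larger cube, which do converge to \<open>f\<close> there. So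
  asymptotically they exceed \<open>f\<close> nowhere in absolute value and cost at most twice the
  integral of \<open>|f|\<close> off the cube. The sign is constant because the Peano kernel at
  \<open>x\<close> is the node polynomial at \<open>x\<close> times a B-spline whose knots are the
  nodes and \<open>x\<close>. Jordan parts are reached through a polar form: a density
  \<open>s\<close> with \<open>|s| = 1\<close> relative to the total variation.\<close>

definition ddiff :: "real set \<Rightarrow> (real \<Rightarrow> real) \<Rightarrow> real" where
  "ddiff A g = (\<Sum>a\<in>A. g a / (\<Prod>b\<in>A - {a}. a - b))"

lemma ddiff_singleton [simp]: "ddiff {a} g = g a"
  by (simp add: ddiff_def)

lemma ddiff_add: "ddiff A (\<lambda>x. f x + g x) = ddiff A f + ddiff A g"
  by (simp add: ddiff_def add_divide_distrib sum.distrib)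

lemma ddiff_diff: "ddiff A (\<lambda>x. f x - g x) = ddiff A f - ddiff A g"
  by (simp add: ddiff_def diff_divide_distrib sum_subtractf)

lemma ddiff_cmult: "ddiff A (\<lambda>x. c * g x) = c * ddiff A g"
  by (simp add: ddiff_def sum_distrib_left)

lemma ddiff_cong: "(\<And>x. x \<in> A \<Longrightarrow> f x = g x) \<Longrightarrow> ddiff A f = ddiff A g"
  by (simp add: ddiff_def)

lemma ddiff_mult_linear:
  assumes "finite A" "p \<in> A"
  shows "ddiff A (\<lambda>x. (x - p) * g x) = ddiff (A - {p}) g"
proof -
  have "(a - p) * g a / (\<Prod>b\<in>A - {a}. a - b) = g a / (\<Prod>b\<in>A - {p} - {a}. a - b)"
    if "a \<in> A - {p}" for a
  proof -
    have "A - {a} = insert p (A - {p} - {a})" using assms that by auto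
    then have "(\<Prod>b\<in>A - {a}. a - b) = (a - p) * (\<Prod>b\<in>A - {p} - {a}. a - b)"
      using assms by (metis (no_types, lifting) DiffE finite_Diff insertI1 prod.insert)
    with that show ?thesis by simp
  qed
  then show ?thesis
    unfolding ddiff_def using assms by (subst sum.remove[of A p]) (auto intro!: sum.cong)
qed

text \<open>Write \<open>q - p = (x - p) - (x - q)\<close>; each summand removes one node.\<close>

lemma ddiff_rec:
  assumes "finite A" "p \<in> A" "q \<in> A"
  shows "(q - p) * ddiff A g = ddiff (A - {p}) g - ddiff (A - {q}) g"
proof -
  have "(q - p) * ddiff A g = ddiff A (\<lambda>x. (x - p) * g x - (x - q) * g x)"
    unfolding ddiff_cmult[symmetric] by (rule ddiff_cong) (simp add: algebra_simps)
  also have "\<dots> = ddiff (A - {p}) g - ddiff (A - {q}) g"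
    using assms by (simp add: ddiff_diff ddiff_mult_linear)
  finally show ?thesis .
qed

text \<open>The linear function \<open>x - t\<close> is interpolated at \<open>p\<close> and
  \<open>q\<close>: \<open>(q - p) * (x - t) = (q - t) * (x - p) + (t - p) * (x - q)\<close>. The
  two coefficients become the Cox--de Boor weights.\<close>

lemma ddiff_mult_shift:
  assumes "finite A" "p \<in> A" "q \<in> A"
  shows "(q - p) * ddiff A (\<lambda>x. (x - t) * g x) = (q - t) * ddiff (A - {p}) g + (t - p) * ddiff (A - {q}) g"
proof -
  have "(q - p) * ddiff A (\<lambda>x. (x - t) * g x)
      = ddiff A (\<lambda>x. (q - t) * ((x - p) * g x) + (t - p) * ((x - q) * g x))"
    unfolding ddiff_cmult[symmetric] by (rule ddiff_cong) (simp add: algebra_simps)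
  also have "\<dots> = (q - t) * ddiff (A - {p}) g + (t - p) * ddiff (A - {q}) g"
    using assms by (simp add: ddiff_add ddiff_cmult ddiff_mult_linear)
  finally show ?thesis .
qed

lemma ddiff_const:
  assumes "card A \<ge> 2"
  shows "ddiff A (\<lambda>_. c) = 0"
  using assms
proof (induction "card A" arbitrary: A rule: less_induct)
  case less
  have fin: "finite A" using less.prems card.infinite by fastforce
  obtain p q where pq: "p \<in> A" "q \<in> A" "p \<noteq> q"
    using less.prems by (metis card_2_iff' obtain_subset_with_card_n subset_eq)
  have "(q - p) * ddiff A (\<lambda>_. c) = ddiff (A - {p}) (\<lambda>_. c) - ddiff (A - {q}) (\<lambda>_. c)"
    by (rule ddiff_rec[OF fin pq(1,2)])
  also have "\<dots> = 0"
  proof (cases "card A = 2")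
    case True
    then have "A = {p, q}"
      using pq fin by (metis card_2_iff doubleton_eq_iff insertE singletonD)
    then have "A - {p} = {q}" "A - {q} = {p}" using pq by auto
    then show ?thesis by simp
  next
    case False
    then have "2 \<le> card (A - {p})" "2 \<le> card (A - {q})" "card (A - {p}) < card A" "card (A - {q}) < card A"
      using less.prems pq fin by auto
    then show ?thesis using less.hyps by simp
  qed
  finally show ?case using pq by simp
qed

lemma ddiff_power_eq_0:
  assumes "k + 1 < card A"
  shows "ddiff A (\<lambda>x. x ^ k) = 0"
  using assms
proof (induction k arbitrary: A)
  case 0
  then show ?case using ddiff_const[of A 1] by simp
next
  case (Suc k)
  have fin: "finite A" using Suc.prems card.infinite by fastforce
  obtain p where p: "p \<in> A" using Suc.prems by fastforce
  have "ddiff A (\<lambda>x. x ^ Suc k) = ddiff A (\<lambda>x. (x - p) * x ^ k + p * x ^ k)"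
    by (rule ddiff_cong) (simp add: algebra_simps)
  also have "\<dots> = ddiff (A - {p}) (\<lambda>x. x ^ k) + p * ddiff A (\<lambda>x. x ^ k)"
    using fin p by (simp add: ddiff_add ddiff_cmult ddiff_mult_linear)
  finally show ?case using Suc.prems fin p by (simp add: Suc.IH)
qed

lemma ddiff_power_eq_1:
  assumes "card A = Suc k"
  shows "ddiff A (\<lambda>x. x ^ k) = 1"
  using assms
proof (induction k arbitrary: A)
  case 0
  then obtain a where "A = {a}" by (metis One_nat_def card_1_singletonE)
  then show ?case by simp
next
  case (Suc k)
  have fin: "finite A" using Suc.prems card.infinite by fastforce
  obtain p where p: "p \<in> A" using Suc.prems by fastforce
  have "ddiff A (\<lambda>x. x ^ Suc k) = ddiff A (\<lambda>x. (x - p) * x ^ k + p * x ^ k)"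
    by (rule ddiff_cong) (simp add: algebra_simps)
  also have "\<dots> = ddiff (A - {p}) (\<lambda>x. x ^ k) + p * ddiff A (\<lambda>x. x ^ k)"
    using fin p by (simp add: ddiff_add ddiff_cmult ddiff_mult_linear)
  finally show ?case using Suc.prems fin p by (simp add: Suc.IH ddiff_power_eq_0)
qed

lemma ddiff_sum: "ddiff A (\<lambda>x. \<Sum>i\<in>I. f i x) = (\<Sum>i\<in>I. ddiff A (f i))"
  unfolding ddiff_def by (subst sum.swap) (simp add: sum_divide_distrib)

lemma ddiff_power_diff_eq_0:
  assumes "k + 1 < card A"
  shows "ddiff A (\<lambda>x. (x - t) ^ k) = 0"
proof -
  have "ddiff A (\<lambda>x. (x - t) ^ k) = ddiff A (\<lambda>x. \<Sum>i\<le>k. (of_nat (k choose i) * (-t) ^ (k - i)) * x ^ i)"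
    by (rule ddiff_cong) (simp add: binomial_ring[of _ "-t", simplified] mult_ac)
  also have "\<dots> = 0"
    unfolding ddiff_sum ddiff_cmult using assms
    by (intro sum.neutral) (auto simp: ddiff_power_eq_0)
  finally show ?thesis .
qed

text \<open>Truncated powers; \<open>tpow 0 t\<close> is the Heaviside function that is \<open>1\<close> at the jump.\<close>

definition tpow :: "nat \<Rightarrow> real \<Rightarrow> real \<Rightarrow> real" where
  "tpow k t x = (if t \<le> x then (x - t) ^ k / fact k else 0)"

lemma tpow_Suc: "tpow (Suc k) t x = (x - t) * tpow k t x / (Suc k)"
  by (simp add: tpow_def)

lemma tpow_nonneg: "0 \<le> tpow k t x"
  by (simp add: tpow_def)

text \<open>Right of \<open>t\<close> the truncated power is a polynomial of degree
  \<open>k\<close>. Together with \<open>ddiff_tpow_right\<close> this confines the B-spline to the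
  hull of its knots; that one condition is weak and the other strict reflects the jump for
  \<open>k = 0\<close>.\<close>

lemma ddiff_tpow_left:
  assumes "k + 1 < card A" "\<And>a. a \<in> A \<Longrightarrow> t \<le> a"
  shows "ddiff A (tpow k t) = 0"
proof -
  have "ddiff A (tpow k t) = ddiff A (\<lambda>x. (1 / fact k) * (x - t) ^ k)"
    using assms by (intro ddiff_cong) (simp add: tpow_def)
  also have "\<dots> = 0"
    unfolding ddiff_cmult using assms by (simp add: ddiff_power_diff_eq_0)
  finally show ?thesis .
qed

lemma ddiff_tpow_right:
  assumes "\<And>a. a \<in> A \<Longrightarrow> a < t"
  shows "ddiff A (tpow k t) = 0"
  using assms by (force simp: ddiff_def tpow_def intro!: sum.neutral)

text \<open>The Cox--de Boor recursion: \<open>ddiff A (tpow k t)\<close> is a B-spline in \<open>t\<close> with knots \<open>A\<close>.\<close>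

lemma ddiff_tpow_Suc:
  assumes "finite A" "p \<in> A" "q \<in> A"
  shows "real (Suc k) * (q - p) * ddiff A (tpow (Suc k) t)
    = (q - t) * ddiff (A - {p}) (tpow k t) + (t - p) * ddiff (A - {q}) (tpow k t)"
proof -
  have "ddiff A (tpow (Suc k) t) = ddiff A (\<lambda>x. (1 / Suc k) * ((x - t) * tpow k t x))"
    by (rule ddiff_cong) (simp add: tpow_Suc)
  also have "\<dots> = (1 / Suc k) * ddiff A (\<lambda>x. (x - t) * tpow k t x)"
    by (rule ddiff_cmult)
  finally have "real (Suc k) * ddiff A (tpow (Suc k) t) = ddiff A (\<lambda>x. (x - t) * tpow k t x)"
    by (simp del: of_nat_Suc)
  then show ?thesis using ddiff_mult_shift[OF assms, of t "tpow k t"]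
    by (metis mult.assoc mult.commute)
qed

text \<open>In the Cox--de Boor recursion at the two extreme knots both weights are positive for
  \<open>t\<close> strictly between them, so positivity passes from degree \<open>k\<close> to
  degree \<open>Suc k\<close>.\<close>

lemma ddiff_tpow_nonneg_pos:
  assumes "card A = k + 2"
  shows "0 \<le> ddiff A (tpow k t)"
    and "Min A < t \<Longrightarrow> t < Max A \<Longrightarrow> 0 < ddiff A (tpow k t)"
proof -
  \<comment> \<open>In degree \<open>0\<close> the B-spline lives on a half-open interval, so the
    right end \<open>t = q\<close> is part of the induction hypothesis. It is used in passing to
    degree \<open>1\<close> when \<open>t\<close> is the interior knot.\<close>
  have "0 \<le> ddiff A (tpow k t) \<and> (\<forall>p\<in>A. \<forall>q\<in>A. p < t \<and> (t < q \<or> k = 0 \<and> t = q) \<longrightarrow> 0 < ddiff A (tpow k t))"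
    using assms
  proof (induction k arbitrary: A)
    case 0
    then obtain p q where A: "A = {p, q}" "p < q"
      by (metis add_0 card_2_iff linorder_neqE_linordered_idom doubleton_eq_iff)
    then have *: "{p, q} - {p} = {q}" "{p, q} - {q} = {p}" by auto
    have "(q - p) * ddiff A (tpow 0 t) = tpow 0 t q - tpow 0 t p"
      using ddiff_rec[of A p q "tpow 0 t"] A * by simp
    then have "ddiff A (tpow 0 t) = (tpow 0 t q - tpow 0 t p) / (q - p)"
      using A by (simp add: field_simps)
    moreover have "tpow 0 t q - tpow 0 t p = (if p < t \<and> t \<le> q then 1 else 0)"
      using A by (auto simp: tpow_def)
    ultimately show ?case using A by auto
  next
    case (Suc k)
    have fin: "finite A" using Suc.prems card.infinite by fastforce
    have ne: "A \<noteq> {}" using Suc.prems by auto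
    define p q where "p = Min A" and "q = Max A"
    have pq: "p \<in> A" "q \<in> A" using fin ne by (auto simp: p_def q_def)
    have le: "p \<le> a" "a \<le> q" if "a \<in> A" for a using fin that by (auto simp: p_def q_def)
    have "p \<noteq> q"
    proof
      assume "p = q"
      then have "A \<subseteq> {p}" using le by force
      then have "card A \<le> 1" by (metis card_mono card.empty card_insert_disjoint finite.emptyI finite_insert One_nat_def empty_iff)
      then show False using Suc.prems by simp
    qed
    then have pq': "p < q" using le(1)[OF pq(2)] by simp
    have c: "card (A - {p}) = k + 2" "card (A - {q}) = k + 2" using Suc.prems fin pq by auto
    note IH = Suc.IH[OF c(1)] Suc.IH[OF c(2)]
    have st1: "0 < ddiff (A - {p}) (tpow k t)"
      if "p' \<in> A - {p}" "q' \<in> A - {p}" "p' < t" "t < q' \<or> k = 0 \<and> t = q'" for p' q'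
      using IH(1)[THEN conjunct2, rule_format, of p' q'] that by simp
    have st2: "0 < ddiff (A - {q}) (tpow k t)"
      if "p' \<in> A - {q}" "q' \<in> A - {q}" "p' < t" "t < q' \<or> k = 0 \<and> t = q'" for p' q'
      using IH(2)[THEN conjunct2, rule_format, of p' q'] that by simp
    have nn: "0 \<le> ddiff (A - {p}) (tpow k t)" "0 \<le> ddiff (A - {q}) (tpow k t)"
      using IH by simp_all
    have rec: "real (Suc k) * (q - p) * ddiff A (tpow (Suc k) t)
    = (q - t) * ddiff (A - {p}) (tpow k t) + (t - p) * ddiff (A - {q}) (tpow k t)"
      by (rule ddiff_tpow_Suc[OF fin pq])
    have pos: "0 < real (Suc k) * (q - p)" using pq' by simp
    show ?case
    proof (cases "p < t \<and> t < q")
      case False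
      then have "ddiff A (tpow (Suc k) t) = 0"
      proof (cases "t \<le> p")
        case True
        then have "t \<le> a" if "a \<in> A" for a using le(1)[OF that] by simp
        then show ?thesis using Suc.prems by (intro ddiff_tpow_left) simp_all
      next
        case False
        then have "q \<le> t" using \<open>\<not> (p < t \<and> t < q)\<close> by auto
        then have "ddiff A (tpow (Suc k) t) = ddiff A (\<lambda>x. 0 * x)"
          by (intro ddiff_cong) (use le(2) in \<open>force simp: tpow_def\<close>)
        then show ?thesis unfolding ddiff_cmult by simp
      qed
      moreover have "\<not> (p' < t \<and> t < q')" if "p' \<in> A" "q' \<in> A" for p' q'
        using False le[OF that(1)] le[OF that(2)] by auto
      ultimately show ?thesis by fastforce
    next
      case True
      \<comment> \<open>There are \<open>k + 3\<close> knots, hence one strictly between the ends.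
        For \<open>t\<close> on either side of it, one of the two smaller knot sets has
        \<open>t\<close> strictly inside its hull.\<close>
      have "card (A - {p} - {q}) \<noteq> 0" using Suc.prems fin pq pq' by simp
      then have "A - {p} - {q} \<noteq> {}" by force
      then obtain c where c: "c \<in> A" "c \<noteq> p" "c \<noteq> q" by blast
      have *: "p < c" "c < q" using c le[of c] by auto
      have "0 < (q - t) * ddiff (A - {p}) (tpow k t) + (t - p) * ddiff (A - {q}) (tpow k t)"
      proof (cases "c < t")
        case True2: True
        then have "0 < ddiff (A - {p}) (tpow k t)"
          using c * pq pq' True by (intro st1[of c q]) simp_all
        then show ?thesis using True nn by (intro add_pos_nonneg) auto
      next
        case False
        have "0 < ddiff (A - {q}) (tpow k t) \<or> 0 < ddiff (A - {p}) (tpow k t)"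
        proof (cases "t < c \<or> k = 0")
          case True3: True
          have "t < c \<or> t = c" using False by auto
          with True3 have "t < c \<or> k = 0 \<and> t = c" by blast
          moreover have "p \<in> A - {q}" "c \<in> A - {q}" using c * pq pq' by blast+
          ultimately have "0 < ddiff (A - {q}) (tpow k t)"
            using True by (intro st2[of p c]) simp_all
          then show ?thesis by simp
        next
          case False3: False
          then have tc: "t = c" "k \<noteq> 0" using False by auto
          \<comment> \<open>For \<open>k \<ge> 1\<close> there are at least four knots; a second
            interior knot \<open>e\<close>, different from \<open>t = c\<close>, takes over the role
            of \<open>c\<close>.\<close>
          have "card (A - {p} - {q} - {c}) \<noteq> 0" using Suc.prems fin pq pq' c tc by simp
          then have "A - {p} - {q} - {c} \<noteq> {}" by force
          then obtain e where e: "e \<in> A" "e \<noteq> p" "e \<noteq> q" "e \<noteq> c" by blast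
          have "p < e" "e < q" using le[of e] e by auto
          show ?thesis
          proof (cases "e < t")
            case True
            then have "0 < ddiff (A - {p}) (tpow k t)" using e pq pq' \<open>p < t \<and> t < q\<close> by (intro st1[of e q]) simp_all
            then show ?thesis ..
          next
            case False
            then have "t < e" using e tc by simp
            then have "0 < ddiff (A - {q}) (tpow k t)" using e pq pq' \<open>p < t \<and> t < q\<close> by (intro st2[of p e]) simp_all
            then show ?thesis ..
          qed
        qed
        then have "0 < (q - t) * ddiff (A - {p}) (tpow k t) \<or> 0 < (t - p) * ddiff (A - {q}) (tpow k t)"
          using True by auto
        moreover have "0 \<le> (q - t) * ddiff (A - {p}) (tpow k t)" "0 \<le> (t - p) * ddiff (A - {q}) (tpow k t)"
          using True nn by simp_all
        ultimately show ?thesis by linarith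
      qed
      then have "0 < ddiff A (tpow (Suc k) t)"
        unfolding rec[symmetric] using pos by (rule zero_less_mult_pos)
      then show ?thesis by (simp add: less_imp_le)
    qed
  qed
  moreover have "finite A" "A \<noteq> {}" using assms card.infinite by fastforce+
  then have "Min A \<in> A" "Max A \<in> A" by simp_all
  ultimately show "0 \<le> ddiff A (tpow k t)"
    and "Min A < t \<Longrightarrow> t < Max A \<Longrightarrow> 0 < ddiff A (tpow k t)"
    by blast+
qed

text \<open>Replaces a recursion that depends on the order of the points by a formula symmetric in
  them. Dropping the first or the last index removes one node, so \<open>ddiff_rec\<close> is
  exactly the recursion step.\<close>

lemma divdiff_eq_ddiff:
  assumes "inj_on x {i..i + k}"
  shows "divdiff g x i k = ddiff (x ` {i..i + k}) g"
  using assms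
proof (induction k arbitrary: i)
  case 0
  then show ?case by simp
next
  case (Suc k)
  have e1: "x ` {Suc i..Suc i + k} = x ` {i..i + Suc k} - {x i}"
  proof -
    have "{Suc i..Suc i + k} = {i..i + Suc k} - {i}" by auto
    then show ?thesis using inj_on_image_set_diff[OF Suc.prems, of "{i..i + Suc k}" "{i}"] by auto
  qed
  have e2: "x ` {i..i + k} = x ` {i..i + Suc k} - {x (i + Suc k)}"
  proof -
    have "{i..i + k} = {i..i + Suc k} - {i + Suc k}" by auto
    then show ?thesis using inj_on_image_set_diff[OF Suc.prems, of "{i..i + Suc k}" "{i + Suc k}"] by auto
  qed
  have "x (i + Suc k) \<noteq> x i" using inj_onD[OF Suc.prems, of "i + Suc k" i] by auto
  moreover have "(x (i + Suc k) - x i) * ddiff (x ` {i..i + Suc k}) g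
      = ddiff (x ` {Suc i..Suc i + k}) g - ddiff (x ` {i..i + k}) g"
    unfolding e1 e2 by (rule ddiff_rec) auto
  moreover have "divdiff g x (Suc i) k = ddiff (x ` {Suc i..Suc i + k}) g"
    "divdiff g x i k = ddiff (x ` {i..i + k}) g"
    by (rule Suc.IH, rule inj_on_subset[OF Suc.prems], force)+
  ultimately show ?case by (simp add: field_simps)
qed

section \<open>Tensor products of functionals\<close>

text \<open>Follows the recursion of \<open>mdivdiff\<close>, which thereby becomes an instance.
  Finite differences, interpolation remainders and quasi-interpolants in \<open>d\<close> variables
  are further instances, so identities between one-variable functionals transfer through
  \<open>tensor_cong\<close> and \<open>tensor_sum\<close>.\<close>

primrec tensor :: "(nat \<Rightarrow> (real \<Rightarrow> real) \<Rightarrow> real) \<Rightarrow> nat \<Rightarrow> ((nat \<Rightarrow> real) \<Rightarrow> real) \<Rightarrow> real" where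
  "tensor L 0 f = f (\<lambda>_. undefined)"
| "tensor L (Suc d) f = L d (\<lambda>x. tensor L d (\<lambda>y. f (y(d := x))))"

definition linear_functional :: "((real \<Rightarrow> real) \<Rightarrow> real) \<Rightarrow> bool" where
  "linear_functional L \<longleftrightarrow> (\<forall>f g. L (\<lambda>x. f x + g x) = L f + L g) \<and> (\<forall>c f. L (\<lambda>x. c * f x) = c * L f)"

lemma linear_functionalD:
  assumes "linear_functional L"
  shows "L (\<lambda>x. f x + g x) = L f + L g" "L (\<lambda>x. c * f x) = c * L f" "L (\<lambda>x. f x * c) = L f * c" "L (\<lambda>x. 0) = 0"
    "L (\<lambda>x. f x - g x) = L f - L g"
proof -
  have 1: "\<And>f g. L (\<lambda>x. f x + g x) = L f + L g" and 2: "\<And>c f. L (\<lambda>x. c * f x) = c * L f"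
    using assms by (simp_all only: linear_functional_def)
  show "L (\<lambda>x. f x + g x) = L f + L g" "L (\<lambda>x. c * f x) = c * L f" by (rule 1, rule 2)
  have "(\<lambda>x. f x * c) = (\<lambda>x. c * f x)" by (simp add: mult.commute)
  then show "L (\<lambda>x. f x * c) = L f * c" using 2[of c f] by (simp only: mult.commute)
  show "L (\<lambda>x. 0) = 0" using 2[of 0 "\<lambda>x. 0"] by simp
  have "L (\<lambda>x. f x + (-1) * g x) = L f + (-1) * L g"
    by (simp only: 1 2)
  then show "L (\<lambda>x. f x - g x) = L f - L g" by simp
qed

lemma linear_functional_sum:
  assumes "linear_functional L"
  shows "L (\<lambda>x. \<Sum>i\<in>I. f i x) = (\<Sum>i\<in>I. L (f i))"
  by (induction I rule: infinite_finite_induct) (simp_all add: linear_functionalD(1)[OF assms] linear_functionalD(4)[OF assms])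

lemma mdivdiff_eq_tensor: "mdivdiff n X d f = tensor (\<lambda>i g. divdiff g (X i) 0 (n i)) d f"
  by (induction d arbitrary: f) auto

lemma tensor_cong:
  assumes "\<And>i. i < d \<Longrightarrow> L i = L' i" "\<And>y. y \<in> extensional {..<d} \<Longrightarrow> f y = g y"
  shows "tensor L d f = tensor L' d g"
  using assms
proof (induction d arbitrary: f g)
  case 0
  then show ?case by simp
next
  case (Suc d)
  have "tensor L d (\<lambda>y. f (y(d := x))) = tensor L' d (\<lambda>y. g (y(d := x)))" for x
    using Suc.prems by (intro Suc.IH Suc.prems) (auto simp: extensional_def)
  then show ?case using Suc.prems by simp
qed

lemma tensor_linear:
  assumes "\<And>i. i < d \<Longrightarrow> linear_functional (L i)"
  shows "tensor L d (\<lambda>y. f y + g y) = tensor L d f + tensor L d g"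
    and "tensor L d (\<lambda>y. c * f y) = c * tensor L d f"
    and "tensor L d (\<lambda>y. f y - g y) = tensor L d f - tensor L d g"
proof -
  have "(\<forall>f g. tensor L d (\<lambda>y. f y + g y) = tensor L d f + tensor L d g) \<and>
    (\<forall>f. tensor L d (\<lambda>y. c * f y) = c * tensor L d f) \<and>
    (\<forall>f g. tensor L d (\<lambda>y. f y - g y) = tensor L d f - tensor L d g)"
    using assms
  proof (induction d)
    case (Suc d)
    have "linear_functional (L d)" using Suc.prems by simp
    with Suc.IH Suc.prems show ?case by (simp add: linear_functionalD[where L = "L d"])
  qed simp
  then show "tensor L d (\<lambda>y. f y + g y) = tensor L d f + tensor L d g"
    "tensor L d (\<lambda>y. c * f y) = c * tensor L d f"
    "tensor L d (\<lambda>y. f y - g y) = tensor L d f - tensor L d g" by blast+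
qed

lemma tensor_sum_arg:
  assumes "\<And>i. i < d \<Longrightarrow> linear_functional (L i)"
  shows "tensor L d (\<lambda>y. \<Sum>i\<in>I. f i y) = (\<Sum>i\<in>I. tensor L d (f i))"
  using assms
proof (induction I rule: infinite_finite_induct)
  case (insert x F)
  then show ?case by (simp add: tensor_linear)
qed (use tensor_linear(2)[OF assms, where c = 0] in auto)

lemma tensor_prod:
  assumes "\<And>i. i < d \<Longrightarrow> linear_functional (L i)"
  shows "tensor L d (\<lambda>y. \<Prod>i<d. g i (y i)) = (\<Prod>i<d. L i (g i))"
  using assms
proof (induction d)
  case (Suc d)
  have "tensor L d (\<lambda>y. \<Prod>i<Suc d. g i ((y(d := x)) i)) = g d x * (\<Prod>i<d. L i (g i))" for x
  proof -
    have "tensor L d (\<lambda>y. \<Prod>i<Suc d. g i ((y(d := x)) i)) = tensor L d (\<lambda>y. g d x * (\<Prod>i<d. g i (y i)))"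
      by (rule arg_cong[where f = "tensor L d"]) (auto simp: mult.commute intro!: ext prod.cong)
    then show ?thesis using Suc by (simp add: tensor_linear)
  qed
  then show ?case using Suc.prems by (simp add: linear_functionalD[where L = "L d"] mult.commute)
qed simp

lemma tensor_scale:
  assumes "\<And>i. i < d \<Longrightarrow> linear_functional (L i)"
  shows "tensor (\<lambda>i g. c i * L i g) d f = (\<Prod>i<d. c i) * tensor L d f"
  using assms by (induction d arbitrary: f) (auto simp: linear_functionalD[where L = "L _"] mult_ac)

text \<open>The factor \<open>f (y(i := a))\<close> is constant in coordinate \<open>i\<close>, so
  the functional \<open>L i\<close> meets only \<open>l\<close>. With \<open>l\<close> a Lagrange
  polynomial, subtracting an interpolant leaves mixed divided differences unchanged.\<close>

lemma tensor_coordinate_eq_0: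
  assumes "\<And>i. i < d \<Longrightarrow> linear_functional (L i)" "i < d" "L i l = 0"
  shows "tensor L d (\<lambda>y. l (y i) * f (y(i := a))) = 0"
  using assms
proof (induction d arbitrary: f)
  case (Suc d)
  show ?case
  proof (cases "i = d")
    case True
    have "tensor L d (\<lambda>y. l ((y(d := x)) i) * f ((y(d := x))(i := a))) = l x * tensor L d (\<lambda>y. f (y(d := a)))" for x
      using True Suc.prems by (simp add: tensor_linear)
    then have e: "tensor L (Suc d) (\<lambda>y. l (y i) * f (y(i := a))) = L d (\<lambda>x. l x * tensor L d (\<lambda>y. f (y(d := a))))"
      by simp
    show ?thesis unfolding e using True Suc.prems by (simp add: linear_functionalD(3)[where L = "L d"])
  next
    case False
    then have "i < d" using Suc.prems by simp
    have "tensor L d (\<lambda>y. l ((y(d := x)) i) * f ((y(d := x))(i := a))) = 0" for x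
    proof -
      have "(y(d := x))(i := a) = (y(i := a))(d := x)" for y :: "nat \<Rightarrow> real"
        by (rule fun_upd_twist) (use False in simp)
      then show ?thesis
        using Suc.IH[of "\<lambda>y. f (y(d := x))"] Suc.prems \<open>i < d\<close>
        by (simp only: fun_upd_other[OF False] less_Suc_eq simp_thms)
    qed
    then show ?thesis using linear_functionalD(4)[of "L d"] Suc.prems by (simp only: tensor.simps lessI)
  qed
qed simp

lemma sum_PiE_lessThan_Suc:
  fixes f :: "(nat \<Rightarrow> 'a) \<Rightarrow> real"
  shows "sum f (PiE {..<Suc d} T) = (\<Sum>t\<in>T d. \<Sum>\<tau>\<in>PiE {..<d} T. f (\<tau>(d := t)))"
proof -
  have inj: "inj_on (\<lambda>(t, \<tau>). \<tau>(d := t)) (T d \<times> PiE {..<d} T)"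
  proof (rule inj_onI, clarsimp)
    fix t \<tau> t' \<tau>'
    assume H: "t \<in> T d" "t' \<in> T d" "\<tau> \<in> PiE {..<d} T" "\<tau>' \<in> PiE {..<d} T" "\<tau>(d := t) = \<tau>'(d := t')"
    have "\<tau> i = \<tau>' i" for i
      using fun_cong[OF H(5), of i] PiE_arb[OF H(3), of i] PiE_arb[OF H(4), of i] by (cases "i = d") auto
    then show "t = t' \<and> \<tau> = \<tau>'" using fun_cong[OF H(5), of d] by auto
  qed
  have "PiE {..<Suc d} T = (\<lambda>(t, \<tau>). \<tau>(d := t)) ` (T d \<times> PiE {..<d} T)"
    using PiE_insert_eq[of d "{..<d}" T] by (simp add: lessThan_Suc)
  then have "sum f (PiE {..<Suc d} T) = (\<Sum>(t, \<tau>)\<in>T d \<times> PiE {..<d} T. f (\<tau>(d := t)))"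
    by (simp only: sum.reindex[OF inj]) (simp add: o_def case_prod_unfold)
  then show ?thesis by (simp add: sum.cartesian_product)
qed

text \<open>Multilinearity of the tensor product; it serves for sums over knots, over grid points
  and over the evaluation points of a remainder.\<close>

lemma tensor_sum:
  assumes "\<And>i t. i < d \<Longrightarrow> t \<in> T i \<Longrightarrow> linear_functional (L i t)"
  shows "tensor (\<lambda>i g. \<Sum>t\<in>T i. c i t * L i t g) d f
    = (\<Sum>\<tau>\<in>PiE {..<d} T. (\<Prod>i<d. c i (\<tau> i)) * tensor (\<lambda>i. L i (\<tau> i)) d f)"
  using assms
proof (induction d arbitrary: f)
  case (Suc d)
  have *: "tensor (\<lambda>i. L i ((\<tau>(d := t)) i)) d f = tensor (\<lambda>i. L i (\<tau> i)) d f" for \<tau> t f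
    by (rule tensor_cong) auto
  have **: "(\<Prod>i<d. c i ((\<tau>(d := t)) i)) = (\<Prod>i<d. c i (\<tau> i))" for \<tau> t
    by (rule prod.cong) auto
  have "tensor (\<lambda>i g. \<Sum>t\<in>T i. c i t * L i t g) (Suc d) f
     = (\<Sum>t\<in>T d. c d t * L d t (\<lambda>x. \<Sum>\<tau>\<in>PiE {..<d} T. (\<Prod>i<d. c i (\<tau> i)) * tensor (\<lambda>i. L i (\<tau> i)) d (\<lambda>y. f (y(d := x)))))"
    using Suc by simp
  also have "\<dots> = (\<Sum>t\<in>T d. \<Sum>\<tau>\<in>PiE {..<d} T. c d t * ((\<Prod>i<d. c i (\<tau> i)) * L d t (\<lambda>x. tensor (\<lambda>i. L i (\<tau> i)) d (\<lambda>y. f (y(d := x))))))"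
    using Suc.prems by (simp add: linear_functional_sum[where L = "L d _"] linear_functionalD[where L = "L d _"] sum_distrib_left)
  also have "\<dots> = (\<Sum>\<tau>\<in>PiE {..<Suc d} T. (\<Prod>i<Suc d. c i (\<tau> i)) * tensor (\<lambda>i. L i (\<tau> i)) (Suc d) f)"
    unfolding sum_PiE_lessThan_Suc prod.lessThan_Suc tensor.simps * ** fun_upd_same by (simp add: mult_ac)
  finally show ?case .
qed simp

lemma tensor_eval: "tensor (\<lambda>i g. g (z i)) d f = f (restrict z {..<d})"
proof (induction d arbitrary: f)
  case 0
  then show ?case by (simp add: restrict_def)
next
  case (Suc d)
  have *: "(restrict z {..<d})(d := z d) = restrict z {..<Suc d}" by (auto simp: restrict_def)
  show ?case by (simp only: tensor.simps Suc *)
qed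

lemma tensor_sum_eval:
  "tensor (\<lambda>i g. \<Sum>t\<in>T i. c i t * g (p i t)) d f
    = (\<Sum>\<tau>\<in>PiE {..<d} T. (\<Prod>i<d. c i (\<tau> i)) * f (\<lambda>i\<in>{..<d}. p i (\<tau> i)))"
proof -
  have "tensor (\<lambda>i g. \<Sum>t\<in>T i. c i t * g (p i t)) d f
    = (\<Sum>\<tau>\<in>PiE {..<d} T. (\<Prod>i<d. c i (\<tau> i)) * tensor (\<lambda>i g. g (p i (\<tau> i))) d f)"
    using tensor_sum[where L = "\<lambda>i t g. g (p i t)" and T = T and c = c and d = d and f = f] by (simp add: linear_functional_def)
  then show ?thesis by (simp add: tensor_eval)
qed

section \<open>Lagrange interpolation and Peano kernels\<close>

definition lagrange :: "real set \<Rightarrow> real \<Rightarrow> real \<Rightarrow> real" where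
  "lagrange A a x = (\<Prod>b\<in>A - {a}. (x - b) / (a - b))"

definition interp_rem :: "real set \<Rightarrow> (real \<Rightarrow> real) \<Rightarrow> real \<Rightarrow> real" where
  "interp_rem A g x = g x - (\<Sum>a\<in>A. lagrange A a x * g a)"

lemma lagrange_eq: "finite A \<Longrightarrow> a \<in> A \<Longrightarrow> x \<in> A \<Longrightarrow> lagrange A a x = (if x = a then 1 else 0)"
  by (auto simp: lagrange_def prod_zero_iff intro!: prod.neutral)

lemma interp_rem_node: "finite A \<Longrightarrow> x \<in> A \<Longrightarrow> interp_rem A g x = 0"
  by (simp add: interp_rem_def lagrange_eq if_distrib[of "\<lambda>c. c * _"] sum.delta' cong: if_cong)

text \<open>Multiplying the divided difference by the node polynomial turns its term at
  \<open>x\<close> into \<open>g x\<close> and its term at a node into minus a Lagrange term. The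
  sign of the remainder is thus separated into the node polynomial and a divided difference.\<close>

lemma interp_rem_eq_ddiff:
  assumes "finite A" "x \<notin> A"
  shows "interp_rem A g x = (\<Prod>b\<in>A. x - b) * ddiff (insert x A) g"
proof -
  let ?w = "\<Prod>b\<in>A. x - b"
  have w: "?w \<noteq> 0" using assms by (auto simp: prod_zero_iff)
  have *: "?w * (g a / (\<Prod>b\<in>insert x A - {a}. a - b)) = - (lagrange A a x * g a)" if "a \<in> A" for a
  proof -
    have "x \<noteq> a" using that assms by auto
    have "insert x A - {a} = insert x (A - {a})" using that assms by auto
    then have 1: "(\<Prod>b\<in>insert x A - {a}. a - b) = (a - x) * (\<Prod>b\<in>A - {a}. a - b)"
      using assms by simp
    have 2: "?w = (x - a) * (\<Prod>b\<in>A - {a}. x - b)"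
      using assms that by (simp add: prod.remove)
    have "?w * (g a / ((a - x) * (\<Prod>b\<in>A - {a}. a - b)))
        = ((x - a) / (a - x)) * ((\<Prod>b\<in>A - {a}. x - b) / (\<Prod>b\<in>A - {a}. a - b) * g a)"
      unfolding 2 by simp
    also have "(x - a) / (a - x) = -1" using \<open>x \<noteq> a\<close> by (simp add: field_simps)
    finally show ?thesis unfolding 1 lagrange_def by (simp add: prod_dividef)
  qed
  have "insert x A - {x} = A" using assms by auto
  then have "?w * ddiff (insert x A) g = ?w * (g x / ?w) + (\<Sum>a\<in>A. ?w * (g a / (\<Prod>b\<in>insert x A - {a}. a - b)))"
    using assms by (simp add: ddiff_def distrib_left sum_distrib_left)
  also have "(\<Sum>a\<in>A. ?w * (g a / (\<Prod>b\<in>insert x A - {a}. a - b))) = (\<Sum>a\<in>A. - (lagrange A a x * g a))"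
    by (rule sum.cong[OF refl]) (rule *)
  finally show ?thesis using w by (simp add: interp_rem_def sum_negf)
qed

lemma interp_rem_cmult: "interp_rem A (\<lambda>x. c * g x) x = c * interp_rem A g x"
  by (simp add: interp_rem_def right_diff_distrib sum_distrib_left mult_ac)

lemma interp_rem_diff: "interp_rem A (\<lambda>x. f x - g x) x = interp_rem A f x - interp_rem A g x"
  by (simp add: interp_rem_def right_diff_distrib sum_subtractf)

lemma interp_rem_sum: "interp_rem A (\<lambda>x. \<Sum>i\<in>I. f i x) x = (\<Sum>i\<in>I. interp_rem A (f i) x)"
  unfolding interp_rem_def sum_subtractf sum_distrib_left by (subst (2) sum.swap) simp

text \<open>For \<open>card A = Suc k\<close> and smooth \<open>g\<close>, Peano's formula expresses
  the remainder at \<open>x\<close> as the integral over \<open>t\<close> of this kernel times the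
  derivative of \<open>g\<close> of order \<open>Suc k\<close>. The discrete form used here is
  \<open>peano_kernel_fdiff_sum\<close>.\<close>

definition peano_kernel :: "real set \<Rightarrow> nat \<Rightarrow> real \<Rightarrow> real \<Rightarrow> real" where
  "peano_kernel A k t x = interp_rem A (tpow k t) x"

text \<open>Off the nodes the kernel is the node polynomial times a nonnegative B-spline, so one
  sign serves all \<open>t\<close>. This rules out cancellation between knots.\<close>

lemma peano_kernel_sgn:
  assumes "card A = Suc k"
  shows "\<bar>peano_kernel A k t x\<bar> = sgn (\<Prod>b\<in>A. x - b) * peano_kernel A k t x"
proof -
  have fin: "finite A" using assms card.infinite by fastforce
  show ?thesis
  proof (cases "x \<in> A")
    case True
    then show ?thesis using fin by (simp add: peano_kernel_def interp_rem_node)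
  next
    case False
    then have "0 \<le> ddiff (insert x A) (tpow k t)"
      using assms fin by (intro ddiff_tpow_nonneg_pos) simp
    moreover have "\<bar>\<Prod>b\<in>A. x - b\<bar> = sgn (\<Prod>b\<in>A. x - b) * (\<Prod>b\<in>A. x - b)"
      by (simp only: abs_sgn mult.commute)
    ultimately show ?thesis
      by (simp add: peano_kernel_def interp_rem_eq_ddiff fin False abs_mult)
  qed
qed

text \<open>The B-spline with knots in \<open>insert x A\<close> vanishes at such \<open>t\<close>.
  For fixed \<open>x\<close> the kernel therefore has bounded support in \<open>t\<close>, and
  truncation to a large cube loses nothing.\<close>

lemma peano_kernel_eq_0:
  assumes "card A = Suc k" "(\<forall>a\<in>insert x A. t \<le> a) \<or> (\<forall>a\<in>insert x A. a < t)"
  shows "peano_kernel A k t x = 0"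
proof -
  have fin: "finite A" using assms card.infinite by fastforce
  show ?thesis
  proof (cases "x \<in> A")
    case True
    then show ?thesis using fin by (simp add: peano_kernel_def interp_rem_node)
  next
    case False
    then have "ddiff (insert x A) (tpow k t) = 0"
      using assms fin ddiff_tpow_left[of k "insert x A" t] ddiff_tpow_right[of "insert x A" t k] by auto
    then show ?thesis by (simp add: peano_kernel_def interp_rem_eq_ddiff fin False)
  qed
qed

lemma peano_kernel_neq_0:
  assumes "card A = Suc k" "x \<notin> A" "a \<in> insert x A" "a < t" "b \<in> insert x A" "t < b"
  shows "peano_kernel A k t x \<noteq> 0"
proof -
  have fin: "finite A" using assms card.infinite by fastforce
  have "0 < ddiff (insert x A) (tpow k t)"
  proof (rule ddiff_tpow_nonneg_pos(2))
    show "Min (insert x A) < t" "t < Max (insert x A)"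
      using fin assms by (meson Min_le Max_ge finite_insert le_less_trans less_le_trans)+
  qed (use assms fin in simp)
  then show ?thesis using fin assms by (auto simp: peano_kernel_def interp_rem_eq_ddiff prod_zero_iff)
qed

section \<open>Growth of the kernels in \<open>x\<close> for knots in a bounded interval\<close>

lemma tpow_eq_max: "k \<ge> 1 \<Longrightarrow> tpow k t x = (max 0 (x - t)) ^ k / fact k"
  by (auto simp: tpow_def max_def)

lemma tpow_measurable [measurable]: "tpow k t \<in> borel_measurable borel"
  unfolding tpow_def[abs_def] by measurable

lemma lagrange_measurable [measurable]: "lagrange A a \<in> borel_measurable borel"
  unfolding lagrange_def[abs_def] by measurable

lemma peano_kernel_measurable [measurable]: "peano_kernel A k t \<in> borel_measurable borel"
  unfolding peano_kernel_def[abs_def] interp_rem_def by measurable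

lemma tpow_le: "tpow k t x \<le> (\<bar>x\<bar> + \<bar>t\<bar>) ^ k"
proof (cases "t \<le> x")
  case True
  have "(x - t) ^ k / fact k \<le> (x - t) ^ k / 1"
    using True by (intro divide_left_mono) (auto simp: fact_ge_1)
  also have "\<dots> \<le> (\<bar>x\<bar> + \<bar>t\<bar>) ^ k" using True by (simp add: power_mono)
  finally show ?thesis using True by (simp add: tpow_def)
qed (simp add: tpow_def)

lemma lagrange_bound:
  assumes "finite A" "a \<in> A"
  shows "\<exists>C\<ge>0. \<forall>x. \<bar>lagrange A a x\<bar> \<le> C * (1 + \<bar>x\<bar>) ^ (card A - 1)"
proof -
  define C where "C = (\<Prod>b\<in>A - {a}. (1 + \<bar>b\<bar>) / \<bar>a - b\<bar>)"
  have "C \<ge> 0" unfolding C_def by (intro prod_nonneg) auto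
  moreover have "\<bar>lagrange A a x\<bar> \<le> C * (1 + \<bar>x\<bar>) ^ (card A - 1)" for x
  proof -
    have "\<bar>lagrange A a x\<bar> = (\<Prod>b\<in>A - {a}. \<bar>x - b\<bar> / \<bar>a - b\<bar>)"
      unfolding lagrange_def abs_prod by (simp add: abs_divide)
    also have "\<dots> \<le> (\<Prod>b\<in>A - {a}. (1 + \<bar>b\<bar>) / \<bar>a - b\<bar> * (1 + \<bar>x\<bar>))"
    proof (rule prod_mono, safe)
      fix b
      have "\<bar>x - b\<bar> \<le> 1 * \<bar>x\<bar> + \<bar>b\<bar> * 1 " by simp
      also have "\<dots> \<le> (1 + \<bar>b\<bar>) * (1 + \<bar>x\<bar>)" by (simp add: algebra_simps)
      finally show "\<bar>x - b\<bar> / \<bar>a - b\<bar> \<le> (1 + \<bar>b\<bar>) / \<bar>a - b\<bar> * (1 + \<bar>x\<bar>)"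
        by (simp add: divide_right_mono)
    qed simp
    also have "\<dots> = C * (1 + \<bar>x\<bar>) ^ (card A - 1)"
      unfolding C_def prod.distrib using assms by simp
    finally show ?thesis .
  qed
  ultimately show ?thesis by blast
qed

lemma peano_kernel_bound:
  assumes "card A = Suc k"
  shows "\<exists>C\<ge>0. \<forall>t x. \<bar>t\<bar> \<le> R \<longrightarrow> \<bar>peano_kernel A k t x\<bar> \<le> C * (1 + \<bar>x\<bar>) ^ k"
proof -
  have fin: "finite A" using assms card.infinite by fastforce
  obtain C where C: "\<And>a. a \<in> A \<Longrightarrow> C a \<ge> 0" "\<And>a x. a \<in> A \<Longrightarrow> \<bar>lagrange A a x\<bar> \<le> C a * (1 + \<bar>x\<bar>) ^ k"
    using lagrange_bound[OF fin] assms by (metis diff_Suc_1)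
  define D where "D = (1 + \<bar>R\<bar>) ^ k + (\<Sum>a\<in>A. C a * (\<bar>a\<bar> + \<bar>R\<bar>) ^ k)"
  have "D \<ge> 0" unfolding D_def using C by (intro add_nonneg_nonneg sum_nonneg) auto
  moreover have "\<bar>peano_kernel A k t x\<bar> \<le> D * (1 + \<bar>x\<bar>) ^ k" if "\<bar>t\<bar> \<le> R" for t x
  proof -
    have tp: "\<bar>tpow k t y\<bar> \<le> (\<bar>y\<bar> + \<bar>R\<bar>) ^ k" for y
      using tpow_le[of k t y] tpow_nonneg[of k t y] that
        power_mono[of "\<bar>y\<bar> + \<bar>t\<bar>" "\<bar>y\<bar> + \<bar>R\<bar>" k] by simp
    have "\<bar>peano_kernel A k t x\<bar> \<le> \<bar>tpow k t x\<bar> + (\<Sum>a\<in>A. \<bar>lagrange A a x\<bar> * \<bar>tpow k t a\<bar>)"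
      unfolding peano_kernel_def interp_rem_def
      by (rule order_trans[OF abs_triangle_ineq4] add_left_mono order_trans[OF sum_abs])+ (simp add: abs_mult)
    also have "\<dots> \<le> (1 + \<bar>R\<bar>) ^ k * (1 + \<bar>x\<bar>) ^ k + (\<Sum>a\<in>A. (C a * (1 + \<bar>x\<bar>) ^ k) * (\<bar>a\<bar> + \<bar>R\<bar>) ^ k)"
    proof (intro add_mono sum_mono mult_mono)
      have "(\<bar>x\<bar> + \<bar>R\<bar>) ^ k \<le> ((1 + \<bar>R\<bar>) * (1 + \<bar>x\<bar>)) ^ k"
        by (intro power_mono) (auto simp: algebra_simps)
      then show "\<bar>tpow k t x\<bar> \<le> (1 + \<bar>R\<bar>) ^ k * (1 + \<bar>x\<bar>) ^ k"
        using tp[of x] by (simp add: power_mult_distrib)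
    qed (use C tp in auto)
    also have "\<dots> = D * (1 + \<bar>x\<bar>) ^ k"
      by (simp add: D_def distrib_right distrib_left sum_distrib_right sum_distrib_left mult_ac)
    finally show ?thesis .
  qed
  ultimately show ?thesis by blast
qed

text \<open>
  The weights \<open>\<bar>k(Z, t)\<bar> + \<bar>k(-Z, t)\<bar>\<close> are positive on \<open>[-R, R]\<close>; this bounds a sum over knots in
  \<open>[-R, R]\<close> at any \<open>x\<close> by its values at the finitely many points with coordinates \<open>\<plusminus> Z\<close>.
\<close>

lemma peano_kernel_dominated:
  assumes "card A = Suc k" "k \<ge> 1" "R < Z" "\<And>a. a \<in> A \<Longrightarrow> \<bar>a\<bar> < Z"
  shows "\<exists>C\<ge>0. \<forall>t x. \<bar>t\<bar> \<le> R \<longrightarrow> \<bar>peano_kernel A k t x\<bar> \<le> C * (1 + \<bar>x\<bar>) ^ k * (\<bar>peano_kernel A k t Z\<bar> + \<bar>peano_kernel A k t (-Z)\<bar>)"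
proof (cases "R < 0")
  case True
  then show ?thesis by (intro exI[of _ 0]) auto
next
  case False
  have fin: "finite A" using assms card.infinite by fastforce
  let ?h = "\<lambda>t. \<bar>peano_kernel A k t Z\<bar> + \<bar>peano_kernel A k t (-Z)\<bar>"
  \<comment> \<open>Continuity in \<open>t\<close> is where \<open>k \<ge> 1\<close> enters. The
    minimum \<open>?h s\<close> over the compact interval is positive, and \<open>C / ?h s\<close>
    is the constant sought.\<close>
  have "continuous_on {-R..R} ?h"
    unfolding peano_kernel_def interp_rem_def tpow_eq_max[OF assms(2)] by (intro continuous_intros) auto
  then obtain s where s: "s \<in> {-R..R}" "\<And>t. t \<in> {-R..R} \<Longrightarrow> ?h s \<le> ?h t"
    using False continuous_attains_inf[of "{-R..R}" ?h] by auto
  \<comment> \<open>If some node lies left of \<open>s\<close>, then \<open>s\<close> is strictly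
    inside the hull of the nodes and \<open>Z\<close>. Otherwise the larger of two distinct nodes
    lies right of \<open>s\<close>, and \<open>-Z\<close> works.\<close>
  have "0 < ?h s"
  proof -
    have Z: "Z \<notin> A" "-Z \<notin> A" using assms(4) by force+
    have sZ: "s < Z" "-Z < s" using s(1) assms(3) by auto
    obtain a b where ab: "a \<in> A" "b \<in> A" "a \<noteq> b"
    proof -
      have "\<not> card A \<le> 1" using assms by simp
      then show thesis using that fin by (metis card_le_Suc0_iff_eq One_nat_def)
    qed
    show ?thesis
    proof (cases "\<exists>c\<in>A. c < s")
      case True
      then have "peano_kernel A k s Z \<noteq> 0" using peano_kernel_neq_0[OF assms(1) Z(1)] sZ by blast
      then show ?thesis by linarith
    next
      case False
      have "s < max a b" using False ab by (metis linorder_neqE_linordered_idom max.strict_coboundedI1 max.strict_coboundedI2)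
      moreover have "max a b \<in> A" using ab by (simp add: max_def)
      ultimately have "peano_kernel A k s (-Z) \<noteq> 0" using peano_kernel_neq_0[OF assms(1) Z(2)] sZ by blast
      then show ?thesis by linarith
    qed
  qed
  obtain C where C: "C \<ge> 0" "\<And>t x. \<bar>t\<bar> \<le> R \<Longrightarrow> \<bar>peano_kernel A k t x\<bar> \<le> C * (1 + \<bar>x\<bar>) ^ k"
    using peano_kernel_bound[OF assms(1)] by blast
  have "\<bar>peano_kernel A k t x\<bar> \<le> C / ?h s * (1 + \<bar>x\<bar>) ^ k * ?h t" if "\<bar>t\<bar> \<le> R" for t x
  proof -
    have "C * (1 + \<bar>x\<bar>) ^ k * 1 \<le> C * (1 + \<bar>x\<bar>) ^ k * (?h t / ?h s)"
      using C s(2)[of t] that \<open>0 < ?h s\<close> by (intro mult_left_mono) (auto simp: abs_le_iff)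
    then show ?thesis using C(2)[OF that, of x] by (simp add: field_simps)
  qed
  moreover have "C / ?h s \<ge> 0" using C \<open>0 < ?h s\<close> by simp
  ultimately show ?thesis by blast
qed

section \<open>Finite differences and cardinal B-splines\<close>

primrec fdiff :: "nat \<Rightarrow> (real \<Rightarrow> real) \<Rightarrow> real \<Rightarrow> real" where
  "fdiff 0 g = g"
| "fdiff (Suc n) g = fdiff n (\<lambda>x. g (x + 1) - g x)"

lemma fdiff_Suc: "fdiff (Suc n) g x = fdiff n g (x + 1) - fdiff n g x"
proof (induction n arbitrary: g)
  case (Suc n)
  have "fdiff (Suc (Suc n)) g x = fdiff n (\<lambda>x. g (x + 1) - g x) (x + 1) - fdiff n (\<lambda>x. g (x + 1) - g x) x"
    by (subst fdiff.simps(2)) (rule Suc)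
  then show ?case by (simp only: fdiff.simps(2))
qed simp

lemma linear_functional_fdiff: "linear_functional (\<lambda>g. fdiff n (\<lambda>u. g (u / N)) x)"
proof -
  have 1: "fdiff n (\<lambda>x. f x + g x) x = fdiff n f x + fdiff n g x" for f g x
    by (induction n arbitrary: x) (simp_all add: fdiff_Suc del: fdiff.simps(2))
  have 2: "fdiff n (\<lambda>x. c * f x) x = c * fdiff n f x" for f c x
    by (induction n arbitrary: x) (simp_all add: fdiff_Suc right_diff_distrib del: fdiff.simps(2))
  show ?thesis by (simp add: linear_functional_def 1 2)
qed

text \<open>On an equidistant grid all denominators of order \<open>j\<close> equal
  \<open>j / N\<close>, and they accumulate to \<open>fact k / N ^ k\<close>. This turns
  box-convexity into a sign condition on finite differences.\<close>

lemma divdiff_grid: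
  fixes N :: real
  assumes "N > 0"
  shows "divdiff g (\<lambda>j. (\<tau> + real j) / N) i k = N ^ k / fact k * fdiff k (\<lambda>u. g (u / N)) (\<tau> + real i)"
proof (induction k arbitrary: i)
  case (Suc k)
  have "(\<tau> + real (i + Suc k)) / N - (\<tau> + real i) / N = Suc k / N"
    by (simp add: diff_divide_distrib[symmetric])
  then have "divdiff g (\<lambda>j. (\<tau> + real j) / N) i (Suc k)
    = (N ^ k / fact k * (fdiff k (\<lambda>u. g (u / N)) (\<tau> + real i + 1) - fdiff k (\<lambda>u. g (u / N)) (\<tau> + real i))) / (Suc k / N)"
    by (simp only: divdiff.simps Suc right_diff_distrib) (simp add: add_ac)
  also have "\<dots> = N ^ Suc k / fact (Suc k) * fdiff (Suc k) (\<lambda>u. g (u / N)) (\<tau> + real i)"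
    unfolding fdiff_Suc using assms by (simp add: field_simps)
  finally show ?case .
qed simp

lemma fdiff_eq_ddiff: "fdiff k g v = fact k * ddiff ((\<lambda>j. v + real j) ` {0..k}) g"
proof -
  have "inj_on (\<lambda>j. v + real j) {0..0 + k}" by (auto intro: inj_onI)
  from divdiff_eq_ddiff[OF this, of g] divdiff_grid[of 1 g v 0 k]
  show ?thesis by simp
qed

text \<open>\<open>bdiff n\<close> is the transpose of \<open>fdiff n\<close> with respect to summation over the integers.\<close>

primrec bdiff :: "nat \<Rightarrow> (int \<Rightarrow> real) \<Rightarrow> int \<Rightarrow> real" where
  "bdiff 0 \<kappa> = \<kappa>"
| "bdiff (Suc n) \<kappa> = (\<lambda>l. bdiff n \<kappa> (l - 1) - bdiff n \<kappa> l)"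

lemma bdiff_eq_0: "(\<And>j. j \<notin> {A..B} \<Longrightarrow> \<kappa> j = 0) \<Longrightarrow> l \<notin> {A..B + int n} \<Longrightarrow> bdiff n \<kappa> l = 0"
  by (induction n arbitrary: l) auto

lemma sum_shift_int: "(\<Sum>l\<in>{A..B}. f (l::int)) = (\<Sum>l\<in>{A+1..B+1}. f (l - 1))"
  by (rule sum.reindex_bij_witness[of _ "\<lambda>l. l - 1" "\<lambda>l. l + 1"]) auto

text \<open>A unit shift of \<open>G\<close> is moved to the coefficients, whose vanishing outside
  the range absorbs the boundary terms. Each difference enlarges the range by one index at the upper
  end.\<close>

lemma sum_by_parts:
  fixes \<kappa> :: "int \<Rightarrow> real"
  assumes "\<And>j. j \<notin> {A..B} \<Longrightarrow> \<kappa> j = 0"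
  shows "(\<Sum>j\<in>{A..B}. \<kappa> j * fdiff n G (of_int j)) = (\<Sum>l\<in>{A..B + int n}. bdiff n \<kappa> l * G (of_int l))"
proof (induction n arbitrary: G)
  case (Suc n)
  let ?B = "B + int n"
  have "(\<Sum>j\<in>{A..B}. \<kappa> j * fdiff (Suc n) G (of_int j))
     = (\<Sum>l\<in>{A..?B}. bdiff n \<kappa> l * G (of_int l + 1)) - (\<Sum>l\<in>{A..?B}. bdiff n \<kappa> l * G (of_int l))"
    by (simp add: Suc right_diff_distrib sum_subtractf)
  also have "(\<Sum>l\<in>{A..?B}. bdiff n \<kappa> l * G (of_int l + 1)) = (\<Sum>l\<in>{A+1..?B+1}. bdiff n \<kappa> (l - 1) * G (of_int l))"
    by (subst sum_shift_int) simp
  also have "\<dots> = (\<Sum>l\<in>{A..?B+1}. bdiff n \<kappa> (l - 1) * G (of_int l))"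
    using bdiff_eq_0[OF assms, of A B] by (intro sum.mono_neutral_left) auto
  also have "(\<Sum>l\<in>{A..?B}. bdiff n \<kappa> l * G (of_int l)) = (\<Sum>l\<in>{A..?B+1}. bdiff n \<kappa> l * G (of_int l))"
    using bdiff_eq_0[OF assms, of A B] by (intro sum.mono_neutral_left) auto
  finally show ?case by (simp add: left_diff_distrib sum_subtractf add_ac)
qed simp

text \<open>The index enters only through \<open>u - j\<close>, so lowering it by one raises the
  argument by one: the transposed difference in the index is the forward difference in the
  argument.\<close>

lemma bdiff_reflect: "bdiff n (\<lambda>j. \<psi> (u - of_int j)) l = fdiff n \<psi> (u - of_int l)"
  by (induction n arbitrary: l) (simp_all add: fdiff_Suc algebra_simps del: fdiff.simps(2))

text \<open>The cardinal B-spline of degree \<open>k\<close> in reflected position: it vanishes for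
  \<open>v \<ge> 0\<close> and for \<open>v < - real (Suc k)\<close>. The scaling makes its integer
  translates sum to one.\<close>

definition bspline :: "nat \<Rightarrow> real \<Rightarrow> real" where
  "bspline k = fdiff (Suc k) (tpow k 0)"

lemma card_grid: "card ((\<lambda>j. v + real j) ` {0..k}) = Suc k"
  by (subst card_image) (auto intro: inj_onI)

lemma bspline_nonneg: "0 \<le> bspline k v"
  unfolding bspline_def fdiff_eq_ddiff
  by (intro mult_nonneg_nonneg ddiff_tpow_nonneg_pos) (auto simp: card_grid simp del: image_Suc_atLeastAtMost)

lemma bspline_eq_0:
  assumes "v \<ge> 0 \<or> v + real (Suc k) < 0"
  shows "bspline k v = 0"
proof -
  let ?S = "(\<lambda>j. v + real j) ` {0..Suc k}"
  have "ddiff ?S (tpow k 0) = 0"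
    using assms
  proof
    assume "v \<ge> 0"
    then show ?thesis by (intro ddiff_tpow_left) (auto simp: card_grid simp del: image_Suc_atLeastAtMost)
  next
    assume *: "v + real (Suc k) < 0"
    have "v + real j < 0" if "j \<le> Suc k" for j
    proof -
      have "real j \<le> real (Suc k)" using that by (simp only: of_nat_le_iff)
      then show ?thesis using * by linarith
    qed
    then show ?thesis by (intro ddiff_tpow_right) auto
  qed
  then show ?thesis by (simp add: bspline_def fdiff_eq_ddiff del: fdiff.simps fact_Suc)
qed

text \<open>A telescoping sum of increments of \<open>fdiff k (tpow k 0)\<close>. That function is
  \<open>1\<close> on the nonnegative half-line, where it is \<open>fact k\<close> times the leading
  coefficient of \<open>x ^ k / fact k\<close>, and \<open>0\<close> far to the left; the bounds on
  \<open>L\<close> and \<open>M\<close> place the two ends in these regions.\<close>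

lemma sum_bspline:
  assumes "u - of_int L + 1 \<ge> 0" "u - of_int M + real k < 0" "L \<le> M"
  shows "(\<Sum>l\<in>{L..M}. bspline k (u - of_int l)) = 1"
proof -
  let ?f = "\<lambda>v. fdiff k (tpow k 0) v"
  have 1: "?f v = 1" if "v \<ge> 0" for v
  proof -
    have "ddiff ((\<lambda>j. v + real j) ` {0..k}) (tpow k 0) = ddiff ((\<lambda>j. v + real j) ` {0..k}) (\<lambda>x. (1 / fact k) * x ^ k)"
      using that by (intro ddiff_cong) (auto simp: tpow_def)
    also have "\<dots> = 1 / fact k" unfolding ddiff_cmult by (simp add: ddiff_power_eq_1 card_grid)
    finally show ?thesis unfolding fdiff_eq_ddiff by simp
  qed
  have 0: "?f v = 0" if "v + real k < 0" for v
  proof -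
    have "v + real j < 0" if "j \<le> k" for j using that \<open>v + real k < 0\<close> by linarith
    then have "ddiff ((\<lambda>j. v + real j) ` {0..k}) (tpow k 0) = 0"
      by (intro ddiff_tpow_right) auto
    then show ?thesis unfolding fdiff_eq_ddiff by simp
  qed
  have "(\<Sum>l\<in>{L..L + int m}. bspline k (u - of_int l)) = ?f (u - of_int L + 1) - ?f (u - of_int (L + int m))" for m
  proof (induction m)
    case 0
    then show ?case by (simp add: bspline_def fdiff_Suc del: fdiff.simps)
  next
    case (Suc m)
    have "{L..L + int (Suc m)} = insert (L + int (Suc m)) {L..L + int m}" by auto
    then have "(\<Sum>l\<in>{L..L + int (Suc m)}. bspline k (u - of_int l))
       = bspline k (u - of_int (L + int (Suc m))) + (?f (u - of_int L + 1) - ?f (u - of_int (L + int m)))"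
      using Suc by simp
    then show ?case by (simp add: bspline_def fdiff_Suc algebra_simps del: fdiff.simps)
  qed
  from this[of "nat (M - L)"] show ?thesis using assms 1[of "u - of_int L + 1"] 0[of "u - of_int M"] by simp
qed

lemma tpow_scale: "N > 0 \<Longrightarrow> tpow k (j / N) x * N ^ k = tpow k 0 (N * x - j)"
  by (auto simp: tpow_def field_simps power_mult_distrib[symmetric])

text \<open>Summation by parts moves the differences from \<open>g\<close> to the knot variable of
  the kernel. There they commute with interpolation in \<open>x\<close> and turn truncated powers
  into B-splines. The bound \<open>R\<close> on \<open>x\<close> and the nodes makes the kernel
  vanish outside the index range.\<close>

lemma peano_kernel_fdiff_sum:
  fixes N R :: nat and x :: real
  assumes "card A = Suc k" "N > 0" "\<bar>x\<bar> < real R" "\<And>a. a \<in> A \<Longrightarrow> \<bar>a\<bar> < real R"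
  shows "(\<Sum>j\<in>{-int (R * N)..int (R * N)}. peano_kernel A k (j / N) x * (N ^ k * fdiff (Suc k) (\<lambda>u. g (u / N)) j))
    = interp_rem A (\<lambda>c. \<Sum>l\<in>{-int (R * N)..int (R * N) + int (Suc k)}. bspline k (N * c - l) * g (l / N)) x"
proof -
  let ?I = "{-int (R * N)..int (R * N)}" and ?I' = "{-int (R * N)..int (R * N) + int (Suc k)}"
  define \<kappa> where "\<kappa> j = peano_kernel A k (of_int j / N) x * N ^ k" for j :: int
  \<comment> \<open>The factor \<open>N ^ k\<close> rescales the truncated power to integer
    knots.\<close>
  have \<kappa>_eq: "\<kappa> = (\<lambda>j. interp_rem A (\<lambda>c. tpow k 0 (N * c - of_int j)) x)"
    unfolding \<kappa>_def peano_kernel_def using assms(2)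
    by (simp add: interp_rem_cmult[symmetric] tpow_scale[of "real N", symmetric] mult.commute[of _ "real N ^ k"])
  have \<kappa>0: "\<kappa> j = 0" if "j \<notin> ?I" for j
  proof -
    have "real_of_int j / N \<le> - real R \<or> real R \<le> real_of_int j / N"
    proof -
      have "j \<le> - int (R * N) \<or> int (R * N) \<le> j" using that by auto
      then have "real_of_int j \<le> - (real R * N) \<or> real R * N \<le> real_of_int j"
        by (metis of_int_le_iff of_int_minus of_int_of_nat_eq of_nat_mult)
      then show ?thesis using assms(2) by (auto simp: field_simps)
    qed
    moreover have "- real R < a \<and> a < real R" if "a \<in> insert x A" for a
      using that assms(3) assms(4)[of a] by (auto simp: abs_less_iff)
    ultimately have "(\<forall>a\<in>insert x A. real_of_int j / N \<le> a) \<or> (\<forall>a\<in>insert x A. a < real_of_int j / N)"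
      by (meson less_imp_le less_le_trans le_less_trans)
    then show ?thesis unfolding \<kappa>_def by (simp add: peano_kernel_eq_0[OF assms(1)])
  qed
  have bdiff: "bdiff n \<kappa> l = interp_rem A (\<lambda>c. bdiff n (\<lambda>j. tpow k 0 (N * c - of_int j)) l) x" for n l
    by (induction n arbitrary: l) (simp_all add: \<kappa>_eq interp_rem_diff)
  have "(\<Sum>j\<in>?I. peano_kernel A k (j / N) x * (N ^ k * fdiff (Suc k) (\<lambda>u. g (u / N)) j)) = (\<Sum>j\<in>?I. \<kappa> j * fdiff (Suc k) (\<lambda>u. g (u / N)) j)"
    by (simp add: \<kappa>_def mult.assoc)
  also have "\<dots> = (\<Sum>l\<in>?I'. bdiff (Suc k) \<kappa> l * g (l / N))"
    by (rule sum_by_parts[OF \<kappa>0])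
  also have "\<dots> = (\<Sum>l\<in>?I'. interp_rem A (\<lambda>c. g (l / N) * bspline k (N * c - l)) x)"
    unfolding bdiff bdiff_reflect bspline_def interp_rem_cmult by (simp add: mult.commute)
  finally show ?thesis unfolding interp_rem_sum[symmetric] by (simp add: mult.commute)
qed

section \<open>Approximation of normalized box-convex functions\<close>

lemma linear_functional_divdiff: "linear_functional (\<lambda>g. divdiff g x i k)"
proof -
  have "divdiff (\<lambda>x. f x + g x) x i k = divdiff f x i k + divdiff g x i k" for f g
    by (induction k arbitrary: i) (simp_all add: add_divide_distrib diff_divide_distrib)
  moreover have "divdiff (\<lambda>x. c * g x) x i k = c * divdiff g x i k" for c g
    by (induction k arbitrary: i) (simp_all add: right_diff_distrib)
  ultimately show ?thesis by (simp add: linear_functional_def)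
qed

lemma linear_functional_sum_eval: "linear_functional (\<lambda>g. \<Sum>l\<in>I. b l * g (p l))"
  by (simp add: linear_functional_def distrib_left sum.distrib sum_distrib_left mult.left_commute)

text \<open>A basic neighbourhood in the product topology is a product of open sets. Extensional
  points agree from coordinate \<open>d\<close> on, so the least of finitely many radii
  suffices.\<close>

lemma continuous_at_coordinatewise:
  fixes F :: "(nat \<Rightarrow> real) \<Rightarrow> real"
  assumes "continuous_on UNIV F" "e > 0" "z \<in> extensional {..<d}"
  shows "\<exists>\<delta>>0. \<forall>y\<in>extensional {..<d}. (\<forall>i<d. \<bar>y i - z i\<bar> < \<delta>) \<longrightarrow> \<bar>F y - F z\<bar> < e"
proof -
  have "open (F -` ball (F z) e)"
    using assms(1) by (simp add: continuous_on_open_vimage)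
  then have "openin (product_topology (\<lambda>i. euclidean) UNIV) (F -` ball (F z) e)"
    by (simp only: open_fun_def)
  moreover have "z \<in> F -` ball (F z) e" using assms(2) by simp
  ultimately obtain X where X: "z \<in> PiE UNIV X" "\<And>i. open (X i)" "PiE UNIV X \<subseteq> F -` ball (F z) e"
    using product_topology_open_contains_basis[of "\<lambda>i. euclidean" UNIV "F -` ball (F z) e" z] by auto
  have "\<exists>\<delta>>0. \<forall>u. \<bar>u - z i\<bar> < \<delta> \<longrightarrow> u \<in> X i" for i
    using X(1,2) by (metis (no_types, lifting) PiE_E UNIV_I dist_real_def open_dist)
  then obtain \<delta> where \<delta>: "\<And>i. \<delta> i > 0" "\<And>i u. \<bar>u - z i\<bar> < \<delta> i \<Longrightarrow> u \<in> X i" by metis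
  \<comment> \<open>The element \<open>1\<close> keeps the minimum meaningful for
    \<open>d = 0\<close>.\<close>
  define \<delta>' where "\<delta>' = Min (insert 1 (\<delta> ` {..<d}))"
  have "\<delta>' > 0" unfolding \<delta>'_def using \<delta>(1) by (subst Min_gr_iff) auto
  moreover have "\<bar>F y - F z\<bar> < e" if "y \<in> extensional {..<d}" "\<And>i. i < d \<Longrightarrow> \<bar>y i - z i\<bar> < \<delta>'" for y
  proof -
    have "y i \<in> X i" for i
    proof (cases "i < d")
      case True
      then have "\<delta>' \<le> \<delta> i" unfolding \<delta>'_def by (intro Min_le) auto
      then show ?thesis using that(2)[OF True] by (intro \<delta>) simp
    next
      case False
      then have "y i = z i" using that(1) assms(3) by (simp add: extensional_def)
      then show ?thesis using \<delta>(1)[of i] by (intro \<delta>) simp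
    qed
    then have "y \<in> PiE UNIV X" by (simp add: PiE_iff)
    then have "y \<in> F -` ball (F z) e" using X(3) by (rule subsetD[rotated])
    then show ?thesis by (simp add: dist_real_def abs_minus_commute)
  qed
  ultimately show ?thesis by blast
qed

text \<open>Products of B-splines are nonnegative weights of sum one, concentrated on grid points at
  distance of order \<open>1 / N\<close> from \<open>z\<close>; the tensor is therefore an average
  of \<open>F\<close> near \<open>z\<close>.\<close>

lemma quasi_interpolation_tendsto:
  fixes F :: "(nat \<Rightarrow> real) \<Rightarrow> real" and R :: nat and z :: "nat \<Rightarrow> real"
  assumes "continuous_on UNIV F" "\<And>i. i < d \<Longrightarrow> \<bar>z i\<bar> < real R"
  shows "(\<lambda>N::nat. tensor (\<lambda>i g. \<Sum>l\<in>{-int (R * N)..int (R * N) + int (Suc (k i))}.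
      bspline (k i) (N * z i - l) * g (l / N)) d F) \<longlonglongrightarrow> F (restrict z {..<d})"
proof (rule LIMSEQ_I)
  fix e :: real assume "e > 0"
  let ?z = "restrict z {..<d}"
  obtain \<delta> where \<delta>: "\<delta> > 0" "\<And>y. y \<in> extensional {..<d} \<Longrightarrow> (\<And>i. i < d \<Longrightarrow> \<bar>y i - z i\<bar> < \<delta>) \<Longrightarrow> \<bar>F y - F ?z\<bar> < e / 2"
    using continuous_at_coordinatewise[OF assms(1), of "e / 2" ?z d] \<open>e > 0\<close> by auto
  \<comment> \<open>A B-spline of degree \<open>k\<close> has support of length
    \<open>k + 1\<close>, so the grid points that carry weight differ from \<open>z\<close> by at
    most \<open>(m + 1) / N\<close> in each coordinate.\<close>
  define m where "m = Max (insert 0 (k ` {..<d}))"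
  have m: "k i \<le> m" if "i < d" for i unfolding m_def using that by (intro Max_ge) auto
  obtain N0 :: nat where N0: "real N0 > (real m + 1) / \<delta>" using reals_Archimedean2 by blast
  have "norm (tensor (\<lambda>i g. \<Sum>l\<in>{-int (R * N)..int (R * N) + int (Suc (k i))}.
      bspline (k i) (N * z i - l) * g (l / N)) d F - F ?z) < e" if "N \<ge> N0" for N
  proof -
    let ?J = "\<lambda>i. {-int (R * N)..int (R * N) + int (Suc (k i))}"
    let ?b = "\<lambda>i l. bspline (k i) (N * z i - of_int l)"
    let ?P = "\<lambda>\<tau>. \<Prod>i<d. ?b i (\<tau> i)"
    let ?p = "\<lambda>\<tau>. \<lambda>i\<in>{..<d}. real_of_int (\<tau> i) / N"
    have "(real m + 1) / \<delta> > 0" using \<delta> by simp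
    then have "real N > 0" using that N0 by (meson less_le_trans less_trans of_nat_le_iff)
    then have "N > 0" by simp
    have N: "(real m + 1) / N < \<delta>"
    proof -
      have "(real m + 1) / \<delta> < N" using N0 that by (meson less_le_trans of_nat_le_iff)
      then show ?thesis using \<delta>(1) \<open>N > 0\<close> by (simp add: field_simps)
    qed
    have P_nn: "?P \<tau> \<ge> 0" for \<tau> by (intro prod_nonneg) (simp add: bspline_nonneg)
    have b1: "(\<Sum>l\<in>?J i. ?b i l) = 1" if "i < d" for i
    proof (rule sum_bspline)
      have "- real R \<le> z i" "z i \<le> real R" using assms(2)[OF that] by auto
      then have "real N * (- real R) \<le> real N * z i" "real N * z i \<le> real N * real R"
        by (simp_all only: mult_left_mono of_nat_0_le_iff)
      then show "0 \<le> real N * z i - of_int (- int (R * N)) + 1"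
        "real N * z i - of_int (int (R * N) + int (Suc (k i))) + real (k i) < 0"
        by (simp_all add: algebra_simps)
    qed simp
    have sumP: "(\<Sum>\<tau>\<in>PiE {..<d} ?J. ?P \<tau>) = 1"
      using prod_sum_PiE[of "{..<d}" ?J ?b] b1 by simp
    have "\<bar>?P \<tau> * (F (?p \<tau>) - F ?z)\<bar> \<le> ?P \<tau> * (e / 2)" for \<tau>
    proof (cases "?P \<tau> = 0")
      case False
      have "\<bar>F (?p \<tau>) - F ?z\<bar> < e / 2"
      proof (rule \<delta>(2))
        fix i assume "i < d"
        then have "?b i (\<tau> i) \<noteq> 0" using False by (auto simp: prod_zero_iff)
        then have "\<not> (N * z i - \<tau> i \<ge> 0)" "\<not> (N * z i - \<tau> i + real (Suc (k i)) < 0)"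
          using bspline_eq_0 by blast+
        then have "\<bar>\<tau> i - N * z i\<bar> \<le> real m + 1" using m[OF \<open>i < d\<close>] by simp
        moreover have "\<tau> i / N - z i = (\<tau> i - N * z i) / N" using \<open>N > 0\<close> by (simp add: field_simps)
        ultimately have "\<bar>\<tau> i / N - z i\<bar> \<le> (real m + 1) / N"
          by (simp add: abs_divide divide_right_mono)
        then show "\<bar>?p \<tau> i - z i\<bar> < \<delta>" using N \<open>i < d\<close> by simp
      qed simp
      then show ?thesis unfolding abs_mult using P_nn[of \<tau>] by (intro mult_mono) auto
    next
      case True
      show ?thesis unfolding True by simp
    qed
    then have "\<bar>\<Sum>\<tau>\<in>PiE {..<d} ?J. ?P \<tau> * (F (?p \<tau>) - F ?z)\<bar> \<le> (\<Sum>\<tau>\<in>PiE {..<d} ?J. ?P \<tau> * (e / 2))"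
      by (intro order_trans[OF sum_abs] sum_mono)
    also have "\<dots> = e / 2" unfolding sum_distrib_right[symmetric] sumP by simp
    also have "(\<Sum>\<tau>\<in>PiE {..<d} ?J. ?P \<tau> * (F (?p \<tau>) - F ?z)) = (\<Sum>\<tau>\<in>PiE {..<d} ?J. ?P \<tau> * F (?p \<tau>)) - F ?z"
      unfolding right_diff_distrib sum_subtractf sum_distrib_right[symmetric] sumP by simp
    finally show ?thesis using \<open>e > 0\<close> unfolding tensor_sum_eval by simp
  qed
  then show "\<exists>no. \<forall>N\<ge>no. norm (tensor (\<lambda>i g. \<Sum>l\<in>{-int (R * N)..int (R * N) + int (Suc (k i))}.
      bspline (k i) (N * z i - l) * g (l / N)) d F - F ?z) < e" by blast
qed

text \<open>Interpolation at \<open>n i\<close> nodes has degree at most \<open>n i - 1\<close>: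
  this is the growth that the moment hypotheses permit, and divided differences of order
  \<open>n i\<close> annihilate such polynomials.\<close>

locale normalized_box_convex =
  fixes d :: nat and n :: "nat \<Rightarrow> nat" and A :: "nat \<Rightarrow> real set" and F :: "(nat \<Rightarrow> real) \<Rightarrow> real"
  assumes n: "\<And>i. i < d \<Longrightarrow> n i \<ge> 2"
    and cardA: "\<And>i. i < d \<Longrightarrow> card (A i) = n i"
    and contF: "continuous_on UNIV F"
    and box: "box_convex d n F"
    and node: "\<And>x i. i < d \<Longrightarrow> x i \<in> A i \<Longrightarrow> F x = 0"
begin

lemma finA: "i < d \<Longrightarrow> finite (A i)"
  using n[of i] cardA[of i] card.infinite[of "A i"] by fastforce

lemma cardA': "i < d \<Longrightarrow> card (A i) = Suc (n i - 1)"
  using n[of i] cardA[of i] by simp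

text \<open>A difference quotient of order \<open>n i\<close> would carry the factor
  \<open>N ^ n i\<close>. The exponent \<open>n i - 1\<close> includes in addition the cell length
  \<open>1 / N\<close>, as in a Riemann sum for Peano's formula.\<close>

definition grid_diff :: "nat \<Rightarrow> (nat \<Rightarrow> int) \<Rightarrow> real" where
  "grid_diff N \<tau> = tensor (\<lambda>i g. real N ^ (n i - 1) * fdiff (n i) (\<lambda>u. g (u / N)) (\<tau> i)) d F"

definition grid_box :: "nat \<Rightarrow> nat \<Rightarrow> (nat \<Rightarrow> int) set" where
  "grid_box N R = PiE {..<d} (\<lambda>_. {-int (R * N)..int (R * N)})"

text \<open>
  The interpolation remainder of the quasi-interpolant of \<open>F\<close> with mesh \<open>1/N\<close>, written as a sum over
  knots and truncated to the knots in \<open>[-R, R]\<^sup>d\<close>.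
\<close>

definition approx :: "nat \<Rightarrow> nat \<Rightarrow> (nat \<Rightarrow> real) \<Rightarrow> real" where
  "approx N R x = (\<Sum>\<tau>\<in>grid_box N R. (\<Prod>i<d. peano_kernel (A i) (n i - 1) (\<tau> i / N) (x i)) * grid_diff N \<tau>)"

lemma finite_grid_box: "finite (grid_box N R)"
  unfolding grid_box_def by (intro finite_PiE) auto

lemma grid_diff_nonneg:
  assumes "N > 0"
  shows "0 \<le> grid_diff N \<tau>"
proof -
  define X where "X i j = (of_int (\<tau> i) + real j) / N" for i j
  have "real N ^ (n i - 1) * fdiff (n i) (\<lambda>u. g (u / N)) (\<tau> i) = (real N ^ (n i - 1) * (fact (n i) / real N ^ n i)) * divdiff g (X i) 0 (n i)" for i g
    using divdiff_grid[of "real N" g "\<tau> i" 0 "n i"] assms unfolding X_def by simp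
  then have "grid_diff N \<tau> = tensor (\<lambda>i g. (real N ^ (n i - 1) * (fact (n i) / real N ^ n i)) * divdiff g (X i) 0 (n i)) d F"
    unfolding grid_diff_def by (simp only:)
  also have "\<dots> = (\<Prod>i<d. real N ^ (n i - 1) * (fact (n i) / real N ^ n i)) * mdivdiff n X d F"
    unfolding mdivdiff_eq_tensor by (rule tensor_scale) (rule linear_functional_divdiff)
  finally have "grid_diff N \<tau> = (\<Prod>i<d. real N ^ (n i - 1) * (fact (n i) / real N ^ n i)) * mdivdiff n X d F" .
  moreover have "inj_on (X i) {..n i}" for i
    unfolding X_def using assms by (auto intro!: inj_onI)
  then have "0 \<le> mdivdiff n X d F" using box by (simp add: box_convex_def)
  ultimately show ?thesis by (simp add: prod_nonneg)
qed

text \<open>Once the cube contains \<open>x\<close> and all nodes, the kernels vanish at every knot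
  left out, so the truncated sum is the whole remainder of the quasi-interpolant.\<close>

lemma approx_eq_tensor:
  assumes "N > 0" "\<And>i. i < d \<Longrightarrow> \<bar>x i\<bar> < real R" "\<And>i a. i < d \<Longrightarrow> a \<in> A i \<Longrightarrow> \<bar>a\<bar> < real R"
  shows "approx N R x = tensor (\<lambda>i g. interp_rem (A i) (\<lambda>c. \<Sum>l\<in>{-int (R * N)..int (R * N) + int (Suc (n i - 1))}.
      bspline (n i - 1) (N * c - l) * g (l / N)) (x i)) d F"
proof -
  have L: "linear_functional (\<lambda>g. real N ^ (n i - 1) * fdiff (n i) (\<lambda>u. g (u / N)) t)" for i t
  proof -
    have "linear_functional (\<lambda>g. fdiff (n i) (\<lambda>u. g (u / N)) t)" by (rule linear_functional_fdiff)
    then show ?thesis unfolding linear_functional_def by (simp only: distrib_left mult.left_commute simp_thms)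
  qed
  have "approx N R x = tensor (\<lambda>i g. \<Sum>j\<in>{-int (R * N)..int (R * N)}. peano_kernel (A i) (n i - 1) (j / N) (x i)
       * (real N ^ (n i - 1) * fdiff (n i) (\<lambda>u. g (u / N)) j)) d F"
    unfolding approx_def grid_box_def grid_diff_def
    by (rule tensor_sum[symmetric]) (rule L)
  also have "\<dots> = tensor (\<lambda>i g. interp_rem (A i) (\<lambda>c. \<Sum>l\<in>{-int (R * N)..int (R * N) + int (Suc (n i - 1))}.
      bspline (n i - 1) (N * c - l) * g (l / N)) (x i)) d F"
  proof (rule tensor_cong)
    fix i assume i: "i < d"
    have "Suc (n i - 1) = n i" using n[OF i] by simp
    then show "(\<lambda>g. \<Sum>j\<in>{-int (R * N)..int (R * N)}. peano_kernel (A i) (n i - 1) (j / N) (x i)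
       * (real N ^ (n i - 1) * fdiff (n i) (\<lambda>u. g (u / N)) j)) =
      (\<lambda>g. interp_rem (A i) (\<lambda>c. \<Sum>l\<in>{-int (R * N)..int (R * N) + int (Suc (n i - 1))}.
      bspline (n i - 1) (N * c - l) * g (l / N)) (x i))"
      using peano_kernel_fdiff_sum[OF cardA'[OF i] assms(1) assms(2)[OF i] assms(3)[OF i]] by auto
  qed simp
  finally show ?thesis .
qed

text \<open>If some \<open>x i\<close> is a node, both sides vanish. Otherwise each remainder is a
  finite combination of evaluations at \<open>x i\<close> and at the nodes; quasi-interpolation
  converges at every resulting point, and \<open>F\<close> vanishes at all of them except
  \<open>x\<close>.\<close>

lemma approx_tendsto:
  assumes "\<And>i. i < d \<Longrightarrow> \<bar>x i\<bar> < real R" "\<And>i a. i < d \<Longrightarrow> a \<in> A i \<Longrightarrow> \<bar>a\<bar> < real R"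
  shows "(\<lambda>N. approx N R x) \<longlonglongrightarrow> F (restrict x {..<d})"
proof (cases "\<exists>i<d. x i \<in> A i")
  case True
  then obtain i where i: "i < d" "x i \<in> A i" by blast
  have "(\<Prod>i<d. peano_kernel (A i) (n i - 1) (\<tau> i / N) (x i)) = 0" for \<tau> :: "nat \<Rightarrow> int" and N :: nat
    using i finA by (auto simp: prod_zero_iff peano_kernel_def interp_rem_node intro!: bexI[of _ i])
  then have "approx N R x = 0" for N by (simp only: approx_def mult_zero_left sum.neutral_const)
  moreover have "F (restrict x {..<d}) = 0" using i by (intro node[of i]) auto
  ultimately show ?thesis by simp
next
  case False
  \<comment> \<open>The coefficients of the remainder functional on
    \<open>insert (x i) (A i)\<close>. Testing \<open>c = x i\<close> separates the two kinds of
    points because \<open>x i\<close> is not a node in this case.\<close>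
  define w where "w i c = (if c = x i then 1 else - lagrange (A i) c (x i))" for i c
  have rem: "interp_rem (A i) g (x i) = (\<Sum>c\<in>insert (x i) (A i). w i c * g c)" if "i < d" for i g
  proof -
    have "x i \<notin> A i" using False that by blast
    then have "(\<Sum>c\<in>insert (x i) (A i). w i c * g c) = g (x i) + (\<Sum>c\<in>A i. w i c * g c)"
      using finA[OF that] by (simp add: w_def)
    also have "(\<Sum>c\<in>A i. w i c * g c) = (\<Sum>c\<in>A i. - (lagrange (A i) c (x i) * g c))"
      using \<open>x i \<notin> A i\<close> by (intro sum.cong) (auto simp: w_def)
    finally show ?thesis by (simp add: interp_rem_def sum_negf)
  qed
  let ?Q = "\<lambda>(N::nat) i (c::real) g. \<Sum>l\<in>{-int (R * N)..int (R * N) + int (Suc (n i - 1))}. bspline (n i - 1) (N * c - l) * g (l / N)"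
  let ?S = "PiE {..<d} (\<lambda>i. insert (x i) (A i))"
  have linQ: "linear_functional (?Q N i c)" for N :: nat and i c
    by (rule linear_functional_sum_eval)
  have eq: "approx N R x = (\<Sum>\<sigma>\<in>?S. (\<Prod>i<d. w i (\<sigma> i)) * tensor (\<lambda>i. ?Q N i (\<sigma> i)) d F)" if "N > 0" for N
  proof -
    have "approx N R x = tensor (\<lambda>i g. interp_rem (A i) (\<lambda>c. ?Q N i c g) (x i)) d F"
      by (rule approx_eq_tensor[OF that]) (use assms in auto)
    also have "\<dots> = tensor (\<lambda>i g. \<Sum>c\<in>insert (x i) (A i). w i c * ?Q N i c g) d F"
      by (rule tensor_cong) (simp_all only: rem)
    also have "\<dots> = (\<Sum>\<sigma>\<in>?S. (\<Prod>i<d. w i (\<sigma> i)) * tensor (\<lambda>i. ?Q N i (\<sigma> i)) d F)"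
      by (rule tensor_sum) (rule linQ)
    finally show ?thesis .
  qed
  have lim: "(\<lambda>N. \<Sum>\<sigma>\<in>?S. (\<Prod>i<d. w i (\<sigma> i)) * tensor (\<lambda>i. ?Q N i (\<sigma> i)) d F)
     \<longlonglongrightarrow> (\<Sum>\<sigma>\<in>?S. (\<Prod>i<d. w i (\<sigma> i)) * F (restrict \<sigma> {..<d}))"
  proof (intro tendsto_sum tendsto_mult tendsto_const quasi_interpolation_tendsto[OF contF])
    fix \<sigma> i assume "\<sigma> \<in> ?S" "i < d"
    then have "\<sigma> i \<in> insert (x i) (A i)" by (auto dest: PiE_mem)
    then show "\<bar>\<sigma> i\<bar> < real R" using assms \<open>i < d\<close> by auto
  qed
  have "(\<Sum>\<sigma>\<in>?S. (\<Prod>i<d. w i (\<sigma> i)) * F (restrict \<sigma> {..<d}))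
      = (\<Sum>\<sigma>\<in>{restrict x {..<d}}. (\<Prod>i<d. w i (\<sigma> i)) * F (restrict \<sigma> {..<d}))"
  proof (rule sum.mono_neutral_right)
    show "finite ?S" using finA by (intro finite_PiE) auto
    show "\<forall>\<sigma>\<in>?S - {restrict x {..<d}}. (\<Prod>i<d. w i (\<sigma> i)) * F (restrict \<sigma> {..<d}) = 0"
    proof safe
      fix \<sigma> assume \<sigma>: "\<sigma> \<in> ?S" "(\<Prod>i<d. w i (\<sigma> i)) * F (restrict \<sigma> {..<d}) \<noteq> 0"
      have "\<sigma> i = x i" if "i < d" for i
      proof (rule ccontr)
        assume "\<sigma> i \<noteq> x i"
        then have "\<sigma> i \<in> A i" using \<sigma>(1) that by (auto dest: PiE_mem)
        then have "F (restrict \<sigma> {..<d}) = 0" using that by (intro node[of i]) auto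
        then show False using \<sigma>(2) by simp
      qed
      then show "\<sigma> = restrict x {..<d}" using \<sigma>(1) by (intro ext) (auto simp: restrict_def dest: PiE_arb)
    qed
  qed auto
  also have "\<dots> = F (restrict x {..<d})" by (simp add: w_def restrict_def cong: if_cong)
  finally have "(\<lambda>N. \<Sum>\<sigma>\<in>?S. (\<Prod>i<d. w i (\<sigma> i)) * tensor (\<lambda>i. ?Q N i (\<sigma> i)) d F) \<longlonglongrightarrow> F (restrict x {..<d})"
    using lim by simp
  then show ?thesis
    by (rule Lim_transform_eventually[OF _ eventually_mono[OF eventually_gt_at_top[of 0]]]) (rule eq[symmetric])
qed

text \<open>Each kernel has the sign of its node polynomial and the grid differences are
  nonnegative, so for fixed \<open>x\<close> all summands share one sign. If a node polynomial is
  zero at \<open>x\<close>, both sides are zero.\<close>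

lemma abs_approx:
  assumes "N > 0"
  shows "\<bar>approx N R x\<bar> = (\<Sum>\<tau>\<in>grid_box N R. (\<Prod>i<d. \<bar>peano_kernel (A i) (n i - 1) (\<tau> i / N) (x i)\<bar>) * grid_diff N \<tau>)"
    (is "_ = ?V")
proof -
  have V: "0 \<le> ?V" by (intro sum_nonneg mult_nonneg_nonneg prod_nonneg) (auto simp: grid_diff_nonneg assms)
  let ?s = "\<Prod>i<d. sgn (\<Prod>b\<in>A i. x i - b)"
  have "(\<Prod>i<d. \<bar>peano_kernel (A i) (n i - 1) (\<tau> i / N) (x i)\<bar>) = ?s * (\<Prod>i<d. peano_kernel (A i) (n i - 1) (\<tau> i / N) (x i))" for \<tau> :: "nat \<Rightarrow> int"
    unfolding prod.distrib[symmetric] by (intro prod.cong refl peano_kernel_sgn cardA') simp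
  then have eq: "?V = ?s * approx N R x" unfolding approx_def by (simp add: sum_distrib_left mult.assoc)
  show ?thesis
  proof (cases "?s = 0")
    case True
    then obtain i where i: "i < d" "(\<Prod>b\<in>A i. x i - b) = 0" by (auto simp: prod_zero_iff sgn_zero_iff)
    then have "x i \<in> A i" using finA by (auto simp: prod_zero_iff)
    then have "(\<Prod>i<d. peano_kernel (A i) (n i - 1) (\<tau> i / N) (x i)) = 0" for \<tau> :: "nat \<Rightarrow> int"
      using i finA by (auto simp: prod_zero_iff peano_kernel_def interp_rem_node intro!: bexI[of _ i])
    then have "approx N R x = 0" by (simp only: approx_def mult_zero_left sum.neutral_const)
    then show ?thesis using eq by simp
  next
    case False
    have "\<bar>?s\<bar> = 1" unfolding abs_prod
    proof (intro prod.neutral ballI)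
      fix i assume "i \<in> {..<d}"
      then have "sgn (\<Prod>b\<in>A i. x i - b) \<noteq> 0" using False by (auto simp: prod_zero_iff)
      then show "\<bar>sgn (\<Prod>b\<in>A i. x i - b)\<bar> = 1" by (auto simp: sgn_if split: if_splits)
    qed
    then have "\<bar>approx N R x\<bar> = \<bar>?V\<bar>" unfolding eq abs_mult by simp
    then show ?thesis using V by simp
  qed
qed

text \<open>By \<open>abs_approx\<close> a larger cube only adds nonnegative terms. This is what
  controls the approximants outside their cube.\<close>

lemma abs_approx_mono:
  assumes "N > 0" "R \<le> R'"
  shows "\<bar>approx N R x\<bar> \<le> \<bar>approx N R' x\<bar>"
  unfolding abs_approx[OF assms(1)]
proof (rule sum_mono2)
  have "int (R * N) \<le> int (R' * N)" using assms by (simp only: of_nat_le_iff mult_le_mono1)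
  then show "grid_box N R \<subseteq> grid_box N R'" unfolding grid_box_def by (intro PiE_mono) auto
qed (auto simp: finite_grid_box grid_diff_nonneg assms intro!: mult_nonneg_nonneg prod_nonneg)

lemma obtain_node_bound:
  obtains R0 :: nat where "\<And>i a. i < d \<Longrightarrow> a \<in> A i \<Longrightarrow> \<bar>a\<bar> < real R0"
proof -
  obtain R0 :: nat where R0: "real R0 > Max (insert 0 (\<Union>i<d. abs ` A i))" using reals_Archimedean2 by blast
  have "\<bar>a\<bar> < real R0" if "i < d" "a \<in> A i" for i a
  proof -
    have "\<bar>a\<bar> \<le> Max (insert 0 (\<Union>i<d. abs ` A i))" using that finA by (intro Max_ge) auto
    then show ?thesis using R0 by simp
  qed
  then show thesis by (rule that)
qed

text \<open>\<open>peano_kernel_dominated\<close> splits the sum over knots into growth in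
  \<open>x\<close> and the values at the corners of the cube of half-width \<open>Z\<close>. At each
  corner the approximants for a larger cube converge, hence are bounded in \<open>N\<close>.\<close>

lemma approx_bound:
  "\<exists>C\<ge>0. \<forall>N>0. \<forall>x. \<bar>approx N R x\<bar> \<le> C * (\<Prod>i<d. (1 + \<bar>x i\<bar>) ^ (n i - 1))"
proof -
  obtain R0 where R0: "\<And>i a. i < d \<Longrightarrow> a \<in> A i \<Longrightarrow> \<bar>a\<bar> < real R0" using obtain_node_bound by blast
  define Z where "Z = Suc (max R0 R)"
  have "\<exists>C\<ge>0. \<forall>t x. \<bar>t\<bar> \<le> real R \<longrightarrow> \<bar>peano_kernel (A i) (n i - 1) t x\<bar> \<le> C * (1 + \<bar>x\<bar>) ^ (n i - 1)
      * (\<bar>peano_kernel (A i) (n i - 1) t (real Z)\<bar> + \<bar>peano_kernel (A i) (n i - 1) t (- real Z)\<bar>)" if "i < d" for i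
  proof (rule peano_kernel_dominated[OF cardA'[OF that]])
    show "1 \<le> n i - 1" using n[OF that] by simp
    show "\<bar>a\<bar> < real Z" if "a \<in> A i" for a using R0[OF \<open>i < d\<close> that] by (simp add: Z_def)
  qed (simp add: Z_def)
  then obtain c where c: "\<And>i. i < d \<Longrightarrow> c i \<ge> 0"
      "\<And>i t x. i < d \<Longrightarrow> \<bar>t\<bar> \<le> real R \<Longrightarrow> \<bar>peano_kernel (A i) (n i - 1) t x\<bar> \<le> c i * (1 + \<bar>x\<bar>) ^ (n i - 1)
      * (\<bar>peano_kernel (A i) (n i - 1) t (real Z)\<bar> + \<bar>peano_kernel (A i) (n i - 1) t (- real Z)\<bar>)" by metis
  let ?S = "PiE {..<d} (\<lambda>_. {real Z, - real Z})"
  have "\<exists>B. \<forall>N>0. \<bar>approx N R z\<bar> \<le> B" if "z \<in> ?S" for z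
  proof -
    \<comment> \<open>Convergence requires the corner strictly inside the cube, hence
      \<open>Suc Z\<close>; monotonicity leads back to \<open>R\<close>.\<close>
    have "(\<lambda>N. approx N (Suc Z) z) \<longlonglongrightarrow> F (restrict z {..<d})"
    proof (rule approx_tendsto)
      fix i assume "i < d"
      then have "z i \<in> {real Z, - real Z}" using that by (auto dest: PiE_mem)
      then show "\<bar>z i\<bar> < real (Suc Z)" by auto
    next
      fix i a assume "i < d" "a \<in> A i"
      then show "\<bar>a\<bar> < real (Suc Z)" using R0[of i a] by (simp add: Z_def)
    qed
    then have "Bseq (\<lambda>N. approx N (Suc Z) z)" by (intro convergent_imp_Bseq convergentI)
    then obtain B where B: "\<And>N. \<bar>approx N (Suc Z) z\<bar> \<le> B" by (auto simp: Bseq_def)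
    have "\<bar>approx N R z\<bar> \<le> B" if "N > 0" for N
    proof -
      have "R \<le> Suc Z" by (simp add: Z_def)
      then show ?thesis using abs_approx_mono[OF that, of R "Suc Z" z] B[of N] by linarith
    qed
    then show ?thesis by blast
  qed
  then obtain B where B: "\<And>z N. z \<in> ?S \<Longrightarrow> N > 0 \<Longrightarrow> \<bar>approx N R z\<bar> \<le> B z" by metis
  define C where "C = (\<Prod>i<d. c i) * (\<Sum>z\<in>?S. B z)"
  have B0: "B z \<ge> 0" if "z \<in> ?S" for z using B[OF that, of 1] by (meson abs_ge_zero order_trans zero_less_one)
  have "C \<ge> 0" unfolding C_def using c B0 by (intro mult_nonneg_nonneg prod_nonneg sum_nonneg) auto
  moreover have "\<bar>approx N R x\<bar> \<le> C * (\<Prod>i<d. (1 + \<bar>x i\<bar>) ^ (n i - 1))" if N: "N > 0" for N x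
  proof -
    let ?k = "\<lambda>i t y. \<bar>peano_kernel (A i) (n i - 1) t y\<bar>"
    let ?p = "(\<Prod>i<d. c i) * (\<Prod>i<d. (1 + \<bar>x i\<bar>) ^ (n i - 1))"
    have p: "?p \<ge> 0" using c by (intro mult_nonneg_nonneg prod_nonneg) auto
    have "\<bar>approx N R x\<bar> \<le> (\<Sum>\<tau>\<in>grid_box N R. ?p * (\<Sum>z\<in>?S. (\<Prod>i<d. ?k i (\<tau> i / N) (z i))) * grid_diff N \<tau>)"
      unfolding abs_approx[OF N]
    proof (intro sum_mono mult_right_mono grid_diff_nonneg N)
      fix \<tau> assume \<tau>: "\<tau> \<in> grid_box N R"
      have "(\<Prod>i<d. ?k i (\<tau> i / N) (x i)) \<le> (\<Prod>i<d. c i * (1 + \<bar>x i\<bar>) ^ (n i - 1) * (\<Sum>z\<in>{real Z, - real Z}. ?k i (\<tau> i / N) z))"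
      proof (rule prod_mono, rule conjI)
        fix i assume i: "i \<in> {..<d}"
        then have "\<tau> i \<in> {-int (R * N)..int (R * N)}" using PiE_mem[OF \<tau>[unfolded grid_box_def]] by blast
        then have "\<bar>\<tau> i\<bar> \<le> int (R * N)" by (simp only: atLeastAtMost_iff abs_le_iff minus_le_iff)
        then have "real_of_int \<bar>\<tau> i\<bar> \<le> real_of_int (int (R * N))" by (simp only: of_int_le_iff)
        then have "\<bar>real_of_int (\<tau> i)\<bar> \<le> real R * real N" by simp
        then have t: "\<bar>\<tau> i / N\<bar> \<le> real R" using N by (simp add: abs_divide pos_divide_le_eq)
        have "real Z \<noteq> - real Z" by (simp add: Z_def)
        then have "(\<Sum>z\<in>{real Z, - real Z}. ?k i (\<tau> i / N) z) = ?k i (\<tau> i / N) (real Z) + ?k i (\<tau> i / N) (- real Z)"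
          by (simp only: sum.insert sum.empty finite.intros insert_iff empty_iff simp_thms add_0_right)
        then show "?k i (\<tau> i / N) (x i) \<le> c i * (1 + \<bar>x i\<bar>) ^ (n i - 1) * (\<Sum>z\<in>{real Z, - real Z}. ?k i (\<tau> i / N) z)"
          using c(2)[of i, OF _ t, of "x i"] i by (simp only: lessThan_iff)
      qed simp
      \<comment> \<open>Multiplying out the product of two-term sums gives one term for each
        corner.\<close>
      also have "\<dots> = ?p * (\<Sum>z\<in>?S. (\<Prod>i<d. ?k i (\<tau> i / N) (z i)))"
        unfolding prod.distrib by (subst prod_sum_PiE) simp_all
      finally show "(\<Prod>i<d. ?k i (\<tau> i / N) (x i)) \<le> ?p * (\<Sum>z\<in>?S. (\<Prod>i<d. ?k i (\<tau> i / N) (z i)))" .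
    qed
    also have "\<dots> = ?p * (\<Sum>z\<in>?S. \<bar>approx N R z\<bar>)"
      unfolding abs_approx[OF N] by (subst sum.swap) (simp only: sum_distrib_left sum_distrib_right mult.assoc)
    also have "\<dots> \<le> ?p * (\<Sum>z\<in>?S. B z)" using B N p by (intro mult_left_mono sum_mono) auto
    finally show ?thesis by (simp add: C_def mult_ac)
  qed
  ultimately show ?thesis by blast
qed

lemma approx_measurable [measurable]: "approx N R \<in> borel_measurable (Rd d)"
  unfolding approx_def by measurable

text \<open>One cube at a time: inside it the approximants converge to \<open>F\<close>, and outside
  they asymptotically do not exceed \<open>|F|\<close>. The loss is at most twice the integral of
  \<open>|F|\<close> outside and disappears as the cube grows.\<close>

lemma integral_nonneg_of_approx:
  fixes \<sigma> :: "(nat \<Rightarrow> real) \<Rightarrow> real"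
  assumes sets: "sets \<rho> = sets (Rd d)"
    and intF: "integrable \<rho> F"
    and intP: "integrable \<rho> (\<lambda>x. \<Prod>i<d. (1 + \<bar>x i\<bar>) ^ (n i - 1))"
    and \<sigma>: "\<sigma> \<in> borel_measurable (Rd d)" "\<And>x. \<bar>\<sigma> x\<bar> = 1"
    and pos: "\<And>N R. N > 0 \<Longrightarrow> 0 \<le> (\<integral>x. approx N R x * \<sigma> x \<partial>\<rho>)"
  shows "0 \<le> (\<integral>x. F x * \<sigma> x \<partial>\<rho>)"
proof -
  note [measurable_cong] = sets
  note [measurable] = \<sigma>(1)
  have [measurable]: "F \<in> borel_measurable \<rho>" using intF by auto
  have space: "space \<rho> = space (Rd d)" by (rule sets_eq_imp_space_eq[OF sets])
  obtain R0 where R0: "\<And>i a. i < d \<Longrightarrow> a \<in> A i \<Longrightarrow> \<bar>a\<bar> < real R0" using obtain_node_bound by blast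
  define B where "B R = {x\<in>space (Rd d). \<forall>i<d. \<bar>x i\<bar> < real R}" for R :: nat
  have [measurable]: "B R \<in> sets (Rd d)" for R unfolding B_def by measurable
  have rst: "restrict x {..<d} = x" if "x \<in> space \<rho>" for x
    using that by (auto simp: space space_PiM PiE_def extensional_restrict)
  have bnd: "\<exists>R'::nat. R' \<ge> R0 \<and> x \<in> B R'" if "x \<in> space \<rho>" for x
  proof -
    obtain R' :: nat where R': "real R' > Max (insert 0 ((\<lambda>i. \<bar>x i\<bar>) ` {..<d}))" using reals_Archimedean2 by blast
    have "\<bar>x i\<bar> < real (max R0 R')" if "i < d" for i
    proof -
      have "\<bar>x i\<bar> \<le> Max (insert 0 ((\<lambda>i. \<bar>x i\<bar>) ` {..<d}))" using that by (intro Max_ge) auto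
      then have "\<bar>x i\<bar> < real R'" using R' by linarith
      then show ?thesis by (simp only: of_nat_max less_max_iff_disj simp_thms)
    qed
    then show ?thesis using that space by (intro exI[of _ "max R0 R'"]) (auto simp: B_def)
  qed
  have lower: "- 2 * (\<integral>x. indicator (- B R) x * \<bar>F x\<bar> \<partial>\<rho>) \<le> (\<integral>x. F x * \<sigma> x \<partial>\<rho>)" if R: "R \<ge> R0" for R
  proof -
    obtain C where C: "C \<ge> 0" "\<And>N x. N > 0 \<Longrightarrow> \<bar>approx N R x\<bar> \<le> C * (\<Prod>i<d. (1 + \<bar>x i\<bar>) ^ (n i - 1))"
      using approx_bound[of R] by blast
    let ?P = "\<lambda>x. \<Prod>i<d. (1 + \<bar>x i\<bar>) ^ (n i - 1)"
    \<comment> \<open>The part of the error that tends to \<open>0\<close> everywhere: the whole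
      error inside the cube, but outside it only the excess of \<open>|approx|\<close> over
      \<open>|F|\<close>. Using \<open>Suc N\<close> keeps the mesh index positive.\<close>
    define W where "W N x = (if x \<in> B R then \<bar>approx (Suc N) R x - F x\<bar> else max 0 (\<bar>approx (Suc N) R x\<bar> - \<bar>F x\<bar>))" for N x
    have Wm [measurable]: "W N \<in> borel_measurable \<rho>" for N unfolding W_def by measurable
    have int_a: "integrable \<rho> (approx (Suc N) R)" for N
      using C(2)[of "Suc N"] C(1)
      by (intro Bochner_Integration.integrable_bound[OF integrable_mult_right[OF intP, of C]])
        (auto simp: abs_mult abs_prod prod_nonneg)
    have dom: "integrable \<rho> (\<lambda>x. C * ?P x + \<bar>F x\<bar>)" using intP intF by simp
    have Wb: "\<bar>W N x\<bar> \<le> C * ?P x + \<bar>F x\<bar>" for N x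
    proof -
      have "\<bar>approx (Suc N) R x\<bar> \<le> C * ?P x" by (rule C) simp
      then show ?thesis by (auto simp: W_def)
    qed
    have "(\<lambda>N. \<integral>x. W N x \<partial>\<rho>) \<longlonglongrightarrow> (\<integral>x. 0 \<partial>\<rho>)"
    proof (rule integral_dominated_convergence[OF _ Wm dom])
      show "AE x in \<rho>. (\<lambda>N. W N x) \<longlonglongrightarrow> 0"
      proof (rule AE_I2)
        fix x assume x: "x \<in> space \<rho>"
        show "(\<lambda>N. W N x) \<longlonglongrightarrow> 0"
        proof (cases "x \<in> B R")
          case True
          have "(\<lambda>N. approx N R x) \<longlonglongrightarrow> F (restrict x {..<d})"
            using True R R0 by (intro approx_tendsto) (force simp: B_def)+
          then have "(\<lambda>N. approx (Suc N) R x) \<longlonglongrightarrow> F x" unfolding rst[OF x] by (rule LIMSEQ_Suc)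
          then have "(\<lambda>N. \<bar>approx (Suc N) R x - F x\<bar>) \<longlonglongrightarrow> \<bar>F x - F x\<bar>" by (intro tendsto_intros)
          then show ?thesis using True by (simp add: W_def)
        next
          case False
          \<comment> \<open>The sums for a larger cube around \<open>x\<close> converge to
            \<open>F x\<close> and dominate those for \<open>R\<close>, which squeezes the excess to
            \<open>0\<close>.\<close>
          obtain R' where R': "R' \<ge> R0" "x \<in> B R'" using bnd[OF x] by blast
          then have "R \<le> R'" using False by (force simp: B_def)
          have "(\<lambda>N. approx N R' x) \<longlonglongrightarrow> F (restrict x {..<d})"
            using R' R0 by (intro approx_tendsto) (force simp: B_def)+
          then have "(\<lambda>N. approx (Suc N) R' x) \<longlonglongrightarrow> F x" unfolding rst[OF x] by (rule LIMSEQ_Suc)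
          then have l: "(\<lambda>N. max 0 (\<bar>approx (Suc N) R' x\<bar> - \<bar>F x\<bar>)) \<longlonglongrightarrow> max 0 (\<bar>F x\<bar> - \<bar>F x\<bar>)" by (intro tendsto_intros)
          show ?thesis
          proof (rule tendsto_sandwich[OF _ _ tendsto_const])
            show "(\<lambda>N. max 0 (\<bar>approx (Suc N) R' x\<bar> - \<bar>F x\<bar>)) \<longlonglongrightarrow> 0" using l by simp
            show "\<forall>\<^sub>F N in sequentially. 0 \<le> W N x" by (simp add: W_def)
            show "\<forall>\<^sub>F N in sequentially. W N x \<le> max 0 (\<bar>approx (Suc N) R' x\<bar> - \<bar>F x\<bar>)"
            proof (rule always_eventually, rule allI)
              fix N
              show "W N x \<le> max 0 (\<bar>approx (Suc N) R' x\<bar> - \<bar>F x\<bar>)"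
                using abs_approx_mono[of "Suc N" R R' x] \<open>R \<le> R'\<close> False by (auto simp: W_def)
            qed
          qed
        qed
      qed
      show "AE x in \<rho>. norm (W N x) \<le> C * ?P x + \<bar>F x\<bar>" for N using Wb by simp
    qed simp
    then have lim: "(\<lambda>N. \<integral>x. W N x \<partial>\<rho>) \<longlonglongrightarrow> 0" by simp
    have intW: "integrable \<rho> (W N)" for N
      using Wb by (intro Bochner_Integration.integrable_bound[OF dom]) (auto intro: order_trans[OF _ abs_ge_self])
    let ?E = "\<integral>x. indicator (- B R) x * \<bar>F x\<bar> \<partial>\<rho>"
    have intE: "integrable \<rho> (\<lambda>x. indicator (- B R) x * \<bar>F x\<bar>)"
      using intF by (intro Bochner_Integration.integrable_bound[OF intF]) (auto simp: indicator_def)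
    have "- 2 * ?E - (\<integral>x. W N x \<partial>\<rho>) \<le> (\<integral>x. F x * \<sigma> x \<partial>\<rho>)" for N
    proof -
      have ig: "integrable \<rho> (\<lambda>x. g x * \<sigma> x)" if "integrable \<rho> g" for g
      proof -
        have [measurable]: "g \<in> borel_measurable \<rho>" using that by auto
        show ?thesis by (rule Bochner_Integration.integrable_bound[OF that]) (auto simp: abs_mult \<sigma>(2))
      qed
      note i1 = ig[OF intF] ig[OF int_a[of N]]
      have "(\<integral>x. approx (Suc N) R x * \<sigma> x \<partial>\<rho>) - (\<integral>x. F x * \<sigma> x \<partial>\<rho>) = (\<integral>x. approx (Suc N) R x * \<sigma> x - F x * \<sigma> x \<partial>\<rho>)"
        using i1 by simp
      also have "\<dots> \<le> (\<integral>x. W N x + 2 * (indicator (- B R) x * \<bar>F x\<bar>) \<partial>\<rho>)"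
      proof (rule integral_mono)
        fix x
        have "approx (Suc N) R x * \<sigma> x - F x * \<sigma> x \<le> \<bar>(approx (Suc N) R x - F x) * \<sigma> x\<bar>"
          by (simp add: left_diff_distrib)
        also have "\<dots> = \<bar>approx (Suc N) R x - F x\<bar>" using \<sigma>(2) by (simp add: abs_mult)
        \<comment> \<open>Outside the cube,
          \<open>|approx - F| \<le> |approx| + |F| \<le> W + 2 * |F|\<close>.\<close>
        also have "\<dots> \<le> W N x + 2 * (indicator (- B R) x * \<bar>F x\<bar>)" by (auto simp: W_def)
        finally show "approx (Suc N) R x * \<sigma> x - F x * \<sigma> x \<le> W N x + 2 * (indicator (- B R) x * \<bar>F x\<bar>)" .
      qed (use i1 intW intE in auto)
      also have "\<dots> = (\<integral>x. W N x \<partial>\<rho>) + 2 * ?E" using intW intE by simp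
      finally show ?thesis using pos[of "Suc N" R] by simp
    qed
    moreover have "(\<lambda>N. - 2 * ?E - (\<integral>x. W N x \<partial>\<rho>)) \<longlonglongrightarrow> - 2 * ?E - 0" by (intro tendsto_intros lim)
    ultimately show ?thesis by (intro LIMSEQ_le_const2[of _ "- 2 * ?E"]) auto
  qed
  have "(\<lambda>R. \<integral>x. indicator (- B R) x * \<bar>F x\<bar> \<partial>\<rho>) \<longlonglongrightarrow> (\<integral>x. 0 \<partial>\<rho>)"
  proof (rule integral_dominated_convergence[where w = "\<lambda>x. \<bar>F x\<bar>"])
    show "AE x in \<rho>. (\<lambda>R. indicator (- B R) x * \<bar>F x\<bar>) \<longlonglongrightarrow> 0"
    proof (rule AE_I2)
      fix x assume "x \<in> space \<rho>"
      then obtain R' where "x \<in> B R'" using bnd by blast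
      then have "x \<in> B R" if "R \<ge> R'" for R using that by (force simp: B_def)
      then have "\<forall>\<^sub>F R in sequentially. indicator (- B R) x * \<bar>F x\<bar> = 0"
        unfolding eventually_sequentially by (intro exI[of _ R']) simp
      then show "(\<lambda>R. indicator (- B R) x * \<bar>F x\<bar>) \<longlonglongrightarrow> 0" by (rule tendsto_eventually)
    qed
  qed (use intF in \<open>auto simp: indicator_def\<close>)
  then have "(\<lambda>R. - 2 * (\<integral>x. indicator (- B R) x * \<bar>F x\<bar> \<partial>\<rho>)) \<longlonglongrightarrow> - 2 * 0" by (intro tendsto_intros) simp
  then show ?thesis using lower by (intro LIMSEQ_le_const2[of _ 0]) auto
qed

end

section \<open>Signed measures with a density of modulus one\<close>

text \<open>\<open>pos_part\<close> and \<open>total_variation\<close> are bare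
  \<open>measure_of\<close> terms. Agreement with an existing measure on measurable sets identifies
  them and supplies countable additivity.\<close>

lemma measure_of_emeasure_eq:
  assumes "sets \<rho> = sets M" "\<And>A. A \<in> sets M \<Longrightarrow> f A = emeasure \<rho> A"
  shows "measure_of (space M) (sets M) f = \<rho>"
proof -
  have "space \<rho> = space M" using assms(1) by (rule sets_eq_imp_space_eq)
  have "measure_of (space M) (sets M) f = measure_of (space M) (sets M) (emeasure \<rho>)"
    using assms(2) by (intro measure_of_eq) (auto simp: sets.space_closed sets.sigma_sets_eq)
  also have "\<dots> = \<rho>" using measure_of_of_measure[of \<rho>] \<open>space \<rho> = space M\<close> assms(1) by simp
  finally show ?thesis .
qed

text \<open>Polar form of a finite signed measure. Since \<open>|s| = 1\<close>, the measure
  \<open>\<rho>\<close> is forced to be the total variation, and the Jordan parts are its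
  restrictions to \<open>s = 1\<close> and \<open>s = - 1\<close>.\<close>

locale signed_density =
  fixes M \<rho> :: "'a measure" and s :: "'a \<Rightarrow> real" and \<tau> :: "'a set \<Rightarrow> real"
  assumes fin: "finite_measure \<rho>" and sets_eq: "sets \<rho> = sets M"
    and s_meas: "s \<in> borel_measurable M" and s: "\<And>x. \<bar>s x\<bar> = 1"
    and \<tau>: "\<And>A. A \<in> sets M \<Longrightarrow> \<tau> A = (\<integral>x. indicator A x * s x \<partial>\<rho>)"
begin

lemma space_eq: "space \<rho> = space M"
  using sets_eq by (rule sets_eq_imp_space_eq)

lemma s_cases: "s x = 1 \<or> s x = - 1"
  using s[of x] by (auto simp: abs_if split: if_splits)

text \<open>The set where \<open>s = 1\<close> is the positive set of a Hahn decomposition: among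
  the measurable subsets of \<open>A\<close>, the intersection with it maximizes
  \<open>\<tau>\<close>.\<close>

lemma pos_part_eq: "pos_part M \<tau> = density \<rho> (indicator {x \<in> space M. s x = 1})"
proof -
  interpret finite_measure \<rho> by (rule fin)
  note [measurable_cong] = sets_eq
  note [measurable] = s_meas
  define P where "P = {x \<in> space M. s x = 1}"
  have [measurable]: "P \<in> sets M" unfolding P_def by measurable
  have s_eq: "s x = 2 * indicator P x - 1" if "x \<in> space M" for x
    using s[of x] that by (auto simp: P_def indicator_def abs_if split: if_splits)
  have \<tau>_eq: "\<tau> B = measure \<rho> (B \<inter> P) - measure \<rho> (B - P)" if [measurable]: "B \<in> sets M" for B
  proof -
    have "\<tau> B = (\<integral>x. indicator (B \<inter> P) x - indicator (B - P) x \<partial>\<rho>)"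
      unfolding \<tau>[OF that] using s_eq
      by (intro Bochner_Integration.integral_cong) (auto simp: space_eq indicator_def)
    also have "\<dots> = (\<integral>x. indicator (B \<inter> P) x \<partial>\<rho>) - (\<integral>x. indicator (B - P) x \<partial>\<rho>)"
      by (intro Bochner_Integration.integral_diff integrable_real_indicator) (auto simp: emeasure_finite less_top[symmetric] sets_eq)
    also have "\<dots> = measure \<rho> (B \<inter> P) - measure \<rho> (B - P)"
      by (simp add: sets_eq Int_absorb2 sets.sets_into_space)
    finally show ?thesis .
  qed
  have "(SUP B\<in>{B \<in> sets M. B \<subseteq> A}. ennreal (\<tau> B)) = emeasure (density \<rho> (indicator P)) A" if [measurable]: "A \<in> sets M" for A
  proof -
    have "emeasure (density \<rho> (indicator P)) A = (\<integral>\<^sup>+x. indicator P x * indicator A x \<partial>\<rho>)"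
      by (rule emeasure_density) measurable
    also have "\<dots> = (\<integral>\<^sup>+x. indicator (A \<inter> P) x \<partial>\<rho>)"
      by (simp only: indicator_inter_arith mult.commute)
    also have "\<dots> = emeasure \<rho> (A \<inter> P)" by (rule nn_integral_indicator) measurable
    also have "\<dots> = (SUP B\<in>{B \<in> sets M. B \<subseteq> A}. ennreal (\<tau> B))"
    proof (rule antisym)
      have "\<tau> (A \<inter> P) = measure \<rho> (A \<inter> P)"
      proof -
        have e: "A \<inter> P \<inter> P = A \<inter> P" "A \<inter> P - P = {}" by auto
        have "\<tau> (A \<inter> P) = measure \<rho> (A \<inter> P \<inter> P) - measure \<rho> (A \<inter> P - P)"
          by (rule \<tau>_eq) measurable
        then show ?thesis by (simp only: e measure_empty diff_zero)
      qed
      then show "emeasure \<rho> (A \<inter> P) \<le> (SUP B\<in>{B \<in> sets M. B \<subseteq> A}. ennreal (\<tau> B))"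
        by (intro SUP_upper2[of "A \<inter> P"]) (auto simp: emeasure_eq_measure)
      show "(SUP B\<in>{B \<in> sets M. B \<subseteq> A}. ennreal (\<tau> B)) \<le> emeasure \<rho> (A \<inter> P)"
      proof (rule SUP_least)
        fix B assume B: "B \<in> {B \<in> sets M. B \<subseteq> A}"
        then have "\<tau> B \<le> measure \<rho> (B \<inter> P)" by (simp add: \<tau>_eq)
        also have "\<dots> \<le> measure \<rho> (A \<inter> P)" using B by (intro finite_measure_mono) (auto simp: sets_eq)
        finally show "ennreal (\<tau> B) \<le> emeasure \<rho> (A \<inter> P)" by (simp add: emeasure_eq_measure)
      qed
    qed
    finally show ?thesis by simp
  qed
  then show ?thesis unfolding pos_part_def P_def[symmetric]
    by (intro measure_of_emeasure_eq) (auto simp: sets_eq)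
qed

end

lemma signed_density_neg: "signed_density M \<rho> s \<tau> \<Longrightarrow> signed_density M \<rho> (\<lambda>x. - s x) (\<lambda>A. - \<tau> A)"
  by (auto simp: signed_density_def)

context signed_density
begin

lemma neg_part_eq: "neg_part M \<tau> = density \<rho> (indicator {x \<in> space M. s x = - 1})"
proof -
  interpret neg: signed_density M \<rho> "\<lambda>x. - s x" "\<lambda>A. - \<tau> A"
    by (rule signed_density_neg) unfold_locales
  have "{x \<in> space M. - s x = 1} = {x \<in> space M. s x = - 1}" by auto
  then show ?thesis unfolding neg_part_def neg.pos_part_eq by simp
qed

lemma total_variation_eq: "total_variation M \<tau> = \<rho>"
  unfolding total_variation_def
proof (rule measure_of_emeasure_eq[OF sets_eq])
  note [measurable_cong] = sets_eq
  note [measurable] = s_meas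
  fix A assume [measurable]: "A \<in> sets M"
  have "emeasure (pos_part M \<tau>) A + emeasure (neg_part M \<tau>) A
     = (\<integral>\<^sup>+x. indicator {x \<in> space M. s x = 1} x * indicator A x + indicator {x \<in> space M. s x = - 1} x * indicator A x \<partial>\<rho>)"
    unfolding pos_part_eq neg_part_eq by (simp add: emeasure_density nn_integral_add)
  also have "\<dots> = (\<integral>\<^sup>+x. indicator A x \<partial>\<rho>)"
  proof (intro nn_integral_cong)
    fix x assume "x \<in> space \<rho>"
    then show "indicator {x \<in> space M. s x = 1} x * indicator A x + indicator {x \<in> space M. s x = - 1} x * indicator A x
        = (indicator A x :: ennreal)"
      using s_cases[of x] by (auto simp: space_eq indicator_def)
  qed
  finally show "emeasure (pos_part M \<tau>) A + emeasure (neg_part M \<tau>) A = emeasure \<rho> A"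
    by (simp add: sets_eq)
qed

lemma sintegrable_iff: "sintegrable M \<tau> f \<longleftrightarrow> integrable \<rho> f"
  by (simp add: sintegrable_def total_variation_eq)

lemma sintegral_eq:
  assumes "integrable \<rho> f"
  shows "sintegral M \<tau> f = (\<integral>x. f x * s x \<partial>\<rho>)"
proof -
  note [measurable_cong] = sets_eq
  note [measurable] = s_meas
  have [measurable]: "f \<in> borel_measurable \<rho>" using assms by auto
  define P N where "P = {x \<in> space M. s x = 1}" and "N = {x \<in> space M. s x = - 1}"
  have [measurable]: "P \<in> sets \<rho>" "N \<in> sets \<rho>" unfolding P_def N_def by measurable
  have *: "(\<integral>x. f x \<partial>density \<rho> (indicator Q)) = (\<integral>x. indicator Q x * f x \<partial>\<rho>)" if [measurable]: "Q \<in> sets \<rho>" for Q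
    using integral_density[of f \<rho> "indicator Q"] by (simp add: ennreal_indicator)
  have i: "integrable \<rho> (\<lambda>x. indicator Q x * f x)" if "Q \<in> sets \<rho>" for Q
    using integrable_mult_indicator[OF that assms] by simp
  have "sintegral M \<tau> f = (\<integral>x. indicator P x * f x \<partial>\<rho>) - (\<integral>x. indicator N x * f x \<partial>\<rho>)"
    unfolding sintegral_def pos_part_eq neg_part_eq P_def[symmetric] N_def[symmetric] by (simp add: *)
  also have "\<dots> = (\<integral>x. indicator P x * f x - indicator N x * f x \<partial>\<rho>)"
    by (simp add: i)
  also have "\<dots> = (\<integral>x. f x * s x \<partial>\<rho>)"
  proof (intro Bochner_Integration.integral_cong refl)
    fix x assume "x \<in> space \<rho>"
    then show "indicator P x * f x - indicator N x * f x = f x * s x"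
      using s_cases[of x] by (auto simp: space_eq P_def N_def indicator_def)
  qed
  finally show ?thesis .
qed

end

section \<open>Sums of two measures and the polar form of a difference\<close>

definition measure_add :: "'a measure \<Rightarrow> 'a measure \<Rightarrow> 'a measure" where
  "measure_add M N = measure_of (space M) (sets M) (\<lambda>A. emeasure M A + emeasure N A)"

lemma sets_measure_add [simp, measurable_cong]: "sets (measure_add M N) = sets M"
  by (simp add: measure_add_def)

lemma space_measure_add [simp]: "space (measure_add M N) = space M"
  by (simp add: measure_add_def)

lemma emeasure_measure_add:
  assumes [simp]: "sets N = sets M" and A: "A \<in> sets M"
  shows "emeasure (measure_add M N) A = emeasure M A + emeasure N A"
  unfolding measure_add_def using sets.sets_into_space[of _ M] A
proof (intro emeasure_measure_of)
  show "countably_additive (sets (measure_of (space M) (sets M) (\<lambda>A. emeasure M A + emeasure N A))) (\<lambda>A. emeasure M A + emeasure N A)"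
  proof (rule countably_additiveI)
    fix B :: "nat \<Rightarrow> _" assume B: "range B \<subseteq> sets (measure_of (space M) (sets M) (\<lambda>A. emeasure M A + emeasure N A))" "disjoint_family B"
    then show "(\<Sum>i. emeasure M (B i) + emeasure N (B i)) = emeasure M (\<Union> (range B)) + emeasure N (\<Union> (range B))"
      by (subst suminf_add[symmetric]) (auto simp: suminf_emeasure)
  qed
qed (auto simp: positive_def)

lemma nn_integral_measure_add:
  assumes [measurable_cong]: "sets N = sets M" and f: "f \<in> borel_measurable M"
  shows "(\<integral>\<^sup>+x. f x \<partial>measure_add M N) = (\<integral>\<^sup>+x. f x \<partial>M) + (\<integral>\<^sup>+x. f x \<partial>N)"
proof -
  have mN: "borel_measurable N = borel_measurable M"
    using assms(1) by (rule measurable_cong_sets) simp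
  have mQ: "borel_measurable (measure_add M N) = borel_measurable M"
    using sets_measure_add by (rule measurable_cong_sets) simp
  show ?thesis
    using f
  proof induction
  case (cong f g)
  have sp: "space N = space M" using assms(1) by (rule sets_eq_imp_space_eq)
  have "(\<integral>\<^sup>+x. f x \<partial>K) = (\<integral>\<^sup>+x. g x \<partial>K)" if "space K = space M" for K
    using cong(3) that by (intro nn_integral_cong) auto
  from this[of "measure_add M N"] this[of M] this[of N] cong(4) sp show ?case by simp
next
  case (set A)
  then show ?case using assms(1) by (simp add: emeasure_measure_add)
next
  case (mult f c)
  then have "f \<in> borel_measurable N" by (simp only: mN)
  with mult show ?case by (simp add: nn_integral_cmult distrib_left)
next
  case (add f g)
  then have "f \<in> borel_measurable N" "g \<in> borel_measurable N" by (simp_all only: mN)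
  with add show ?case by (simp add: nn_integral_add add_ac)
next
  case (seq U)
  then have m: "U i \<in> borel_measurable M" "U i \<in> borel_measurable N" "U i \<in> borel_measurable (measure_add M N)" for i
    by (simp_all only: mN mQ)
  have f: "f = (\<lambda>x. SUP i. U i x)" using \<open>f = (SUP i. U i)\<close> by (simp only: SUP_apply fun_eq_iff simp_thms)
  have *: "(\<integral>\<^sup>+x. f x \<partial>K) = (SUP i. \<integral>\<^sup>+x. U i x \<partial>K)" if "\<And>i. U i \<in> borel_measurable K" for K
    unfolding f by (rule nn_integral_monotone_convergence_SUP[OF \<open>incseq U\<close> that])
  have "incseq (\<lambda>i. \<integral>\<^sup>+x. U i x \<partial>K)" for K
    using \<open>incseq U\<close> by (auto intro!: nn_integral_mono simp: incseq_def le_fun_def)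
  then have "(SUP i. (\<integral>\<^sup>+x. U i x \<partial>M) + (\<integral>\<^sup>+x. U i x \<partial>N)) = (SUP i. \<integral>\<^sup>+x. U i x \<partial>M) + (SUP i. \<integral>\<^sup>+x. U i x \<partial>N)"
    by (intro ennreal_SUP_add)
  with seq.IH have "(\<integral>\<^sup>+x. f x \<partial>measure_add M N) = (\<integral>\<^sup>+x. f x \<partial>M) + (\<integral>\<^sup>+x. f x \<partial>N)"
    by (simp only: *[OF m(1)] *[OF m(2)] *[OF m(3)])
  then show ?case unfolding f by (simp only: SUP_apply)
qed
qed

lemma finite_measure_measure_add:
  assumes "finite_measure M" "finite_measure N" "sets N = sets M"
  shows "finite_measure (measure_add M N)"
  using assms finite_measure.emeasure_finite[of M "space M"] finite_measure.emeasure_finite[of N "space M"]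
  by (intro finite_measureI) (auto simp: emeasure_measure_add)

lemma measure_measure_add:
  assumes "finite_measure M" "finite_measure N" "sets N = sets M" "A \<in> sets M"
  shows "measure (measure_add M N) A = measure M A + measure N A"
  using assms finite_measure.emeasure_finite[of M A] finite_measure.emeasure_finite[of N A]
  by (simp add: measure_def emeasure_measure_add enn2real_plus less_top)

lemma integrable_measure_add_iff:
  fixes f :: "'a \<Rightarrow> real"
  assumes N: "sets N = sets M"
  shows "integrable (measure_add M N) f \<longleftrightarrow> integrable M f \<and> integrable N f"
proof -
  have "f \<in> borel_measurable N \<longleftrightarrow> f \<in> borel_measurable M" "f \<in> borel_measurable (measure_add M N) \<longleftrightarrow> f \<in> borel_measurable M"
    by (simp_all only: measurable_cong_sets[OF N refl] measurable_cong_sets[OF sets_measure_add refl])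
  then show ?thesis
    unfolding integrable_iff_bounded by (auto simp: nn_integral_measure_add[OF N])
qed

lemma integral_measure_add:
  fixes f :: "'a \<Rightarrow> real"
  assumes N: "sets N = sets M" and f: "integrable M f" "integrable N f"
  shows "(\<integral>x. f x \<partial>measure_add M N) = (\<integral>x. f x \<partial>M) + (\<integral>x. f x \<partial>N)"
proof -
  have m: "f \<in> borel_measurable M" using f by auto
  have fin: "(\<integral>\<^sup>+x. ennreal (g x) \<partial>K) < \<infinity>" if "integrable K f" "\<And>x. g x \<le> \<bar>f x\<bar>" for K g
  proof -
    have "(\<integral>\<^sup>+x. ennreal (g x) \<partial>K) \<le> (\<integral>\<^sup>+x. ennreal (norm (f x)) \<partial>K)"
      using that by (intro nn_integral_mono) (simp add: ennreal_leI)
    also have "\<dots> < \<infinity>" using that(1) by (simp add: integrable_iff_bounded)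
    finally show ?thesis .
  qed
  have fin': "(\<integral>\<^sup>+x. ennreal (f x) \<partial>K) < \<infinity>" "(\<integral>\<^sup>+x. ennreal (- f x) \<partial>K) < \<infinity>" if "integrable K f" for K
    using fin[OF that, of f] fin[OF that, of "\<lambda>x. - f x"] by auto
  have "integrable (measure_add M N) f" using f by (simp add: integrable_measure_add_iff[OF N])
  then show ?thesis
    using m fin'[OF f(1)] fin'[OF f(2)]
    by (simp add: real_lebesgue_integral_def f nn_integral_measure_add[OF N] enn2real_plus)
qed

text \<open>\<open>M\<close> and \<open>N\<close> may overlap and so need not be the Jordan parts of
  their difference. With Radon-Nikodym densities \<open>a\<close> and \<open>b\<close> relative to
  the sum of the two measures, the modulus and the sign of \<open>a - b\<close> give the polar
  form.\<close>

lemma difference_signed_density: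
  fixes M N :: "'a measure"
  assumes M: "finite_measure M" and N: "finite_measure N" "sets N = sets M"
  shows "\<exists>\<rho> s. signed_density M \<rho> s (\<lambda>A. measure M A - measure N A) \<and>
    (\<forall>f::'a \<Rightarrow> real. integrable M f \<longrightarrow> integrable N f \<longrightarrow> integrable \<rho> f \<and> (\<integral>x. f x * s x \<partial>\<rho>) = (\<integral>x. f x \<partial>M) - (\<integral>x. f x \<partial>N))"
proof -
  let ?Q = "measure_add M N"
  interpret Q: finite_measure ?Q by (rule finite_measure_measure_add[OF M N])
  have ac: "absolutely_continuous ?Q K" if "sets K = sets M" "\<And>A. A \<in> sets M \<Longrightarrow> emeasure K A \<le> emeasure ?Q A" for K
    unfolding absolutely_continuous_def
  proof
    fix A assume A: "A \<in> null_sets ?Q"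
    then have "A \<in> sets M" using null_setsD2[OF A] by simp
    moreover have "emeasure K A \<le> 0" using that(2)[OF \<open>A \<in> sets M\<close>] null_setsD1[OF A] by simp
    ultimately show "A \<in> null_sets K" using that(1) by (intro null_setsI) simp_all
  qed
  have ex: "\<exists>D. D \<in> borel_measurable M \<and> (\<forall>x. 0 \<le> D x) \<and> K = density ?Q (\<lambda>x. ennreal (D x))"
    if K: "finite_measure K" "sets K = sets M" "\<And>A. A \<in> sets M \<Longrightarrow> emeasure K A \<le> emeasure ?Q A" for K
  proof -
    have "sets K = sets ?Q" using K(2) by simp
    from Q.real_RN_deriv[OF K(1) ac[OF K(2,3)] this]
    obtain D where D: "D \<in> borel_measurable ?Q" "AE x in ?Q. RN_deriv ?Q K x = ennreal (D x)" "\<And>x. 0 \<le> D x"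
      by blast
    have "density ?Q (RN_deriv ?Q K) = density ?Q (\<lambda>x. ennreal (D x))"
      using D(1,2) by (intro density_cong) simp_all
    then have "K = density ?Q (\<lambda>x. ennreal (D x))"
      using Q.density_RN_deriv[OF ac[OF K(2,3)] \<open>sets K = sets ?Q\<close>] by (simp only:)
    moreover have "D \<in> borel_measurable M" using D(1) by simp
    ultimately show ?thesis using D(3) by blast
  qed
  have le: "emeasure M A \<le> emeasure ?Q A" "emeasure N A \<le> emeasure ?Q A" if "A \<in> sets M" for A
    using emeasure_measure_add[OF N(2) that] by simp_all
  obtain a where a: "a \<in> borel_measurable M" "\<And>x. 0 \<le> a x" "M = density ?Q (\<lambda>x. ennreal (a x))"
    using ex[OF M refl le(1)] by blast
  obtain b where b: "b \<in> borel_measurable M" "\<And>x. 0 \<le> b x" "N = density ?Q (\<lambda>x. ennreal (b x))"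
    using ex[OF N le(2)] by blast
  note [measurable] = a(1) b(1)
  define \<rho> where "\<rho> = density ?Q (\<lambda>x. ennreal \<bar>a x - b x\<bar>)"
  \<comment> \<open>Where \<open>a = b\<close> the measure \<open>\<rho>\<close> has no mass; the
    value \<open>1\<close> there keeps \<open>|s| = 1\<close> everywhere.\<close>
  define s where "s x = (if b x \<le> a x then 1 else - 1 :: real)" for x
  have [measurable]: "s \<in> borel_measurable M" unfolding s_def by measurable
  have int: "integrable \<rho> f \<and> (\<integral>x. f x * s x \<partial>\<rho>) = (\<integral>x. f x \<partial>M) - (\<integral>x. f x \<partial>N)"
    if f: "integrable M f" "integrable N f" for f :: "'a \<Rightarrow> real"
  proof -
    have [measurable]: "f \<in> borel_measurable M" using f by auto
    have ia: "integrable ?Q (\<lambda>x. a x * f x)" "(\<integral>x. f x \<partial>M) = (\<integral>x. a x * f x \<partial>?Q)"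
      using f(1) a(2) integrable_density[of f ?Q a] integral_density[of f ?Q a] unfolding a(3)[symmetric] by auto
    have ib: "integrable ?Q (\<lambda>x. b x * f x)" "(\<integral>x. f x \<partial>N) = (\<integral>x. b x * f x \<partial>?Q)"
      using f(2) b(2) integrable_density[of f ?Q b] integral_density[of f ?Q b] unfolding b(3)[symmetric] by auto
    have e1: "\<bar>a x - b x\<bar> * f x = (a x * f x - b x * f x) * s x" for x
      by (simp add: s_def algebra_simps abs_if)
    have e2: "\<bar>a x - b x\<bar> * (f x * s x) = a x * f x - b x * f x" for x
      by (simp add: s_def algebra_simps abs_if)
    have "integrable ?Q (\<lambda>x. (a x * f x - b x * f x) * s x)"
      by (rule Bochner_Integration.integrable_bound[OF Bochner_Integration.integrable_diff[OF ia(1) ib(1)]])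
        (auto simp: abs_mult s_def)
    then have 1: "integrable \<rho> f" unfolding \<rho>_def by (subst integrable_density) (simp_all add: e1)
    have "(\<integral>x. f x * s x \<partial>\<rho>) = (\<integral>x. \<bar>a x - b x\<bar> * (f x * s x) \<partial>?Q)"
      unfolding \<rho>_def by (subst integral_density) simp_all
    also have "\<dots> = (\<integral>x. a x * f x \<partial>?Q) - (\<integral>x. b x * f x \<partial>?Q)"
      unfolding e2 using ia(1) ib(1) by (rule Bochner_Integration.integral_diff)
    finally show ?thesis using 1 by (simp only: ia(2) ib(2) simp_thms)
  qed
  have fin: "finite_measure \<rho>"
  proof -
    have "integrable \<rho> (\<lambda>x. 1 :: real)" using int[of "\<lambda>x. 1"] M N by (simp add: finite_measure.integrable_const)
    then have "emeasure \<rho> (space \<rho>) < \<infinity>" by (simp add: integrable_iff_bounded)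
    then show ?thesis by (intro finite_measureI) simp
  qed
  have \<tau>: "measure M A - measure N A = (\<integral>x. indicator A x * s x \<partial>\<rho>)" if "A \<in> sets M" for A
  proof -
    have i: "integrable K (indicator A :: 'a \<Rightarrow> real)" if "finite_measure K" "sets K = sets M" for K
      using finite_measure.emeasure_finite[OF that(1), of A] \<open>A \<in> sets M\<close> that(2)
      by (intro integrable_real_indicator) (simp_all add: top.not_eq_extremum)
    have "A \<inter> space M = A" "A \<inter> space N = A"
      using sets.sets_into_space[OF that] sets_eq_imp_space_eq[OF N(2)] by blast+
    then show ?thesis using int[OF i[OF M refl] i[OF N]] by simp
  qed
  have "signed_density M \<rho> s (\<lambda>A. measure M A - measure N A)"
  proof (rule signed_density.intro)
    show "sets \<rho> = sets M" by (simp add: \<rho>_def)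
    show "\<bar>s x\<bar> = 1" for x by (simp add: s_def)
  qed (fact fin \<tau> \<open>s \<in> borel_measurable M\<close>)+
  then show ?thesis using int by blast
qed

section \<open>Convolution powers\<close>

lemma signed_density_cong:
  assumes "signed_density M \<rho> s \<tau>" "sets M = sets M'" "\<And>A. A \<in> sets M \<Longrightarrow> \<tau>' A = \<tau> A"
  shows "signed_density M' \<rho> s \<tau>'"
  using assms unfolding signed_density_def by (simp add: measurable_cong_sets[OF assms(2)[symmetric] refl])

definition moment_measure :: "nat \<Rightarrow> real measure \<Rightarrow> bool" where
  "moment_measure k M \<longleftrightarrow> finite_measure M \<and> sets M = sets borel \<and> integrable M (\<lambda>x. \<bar>x\<bar> ^ k)"

lemma one_plus_power_le: "(1 + \<bar>x\<bar>) ^ k \<le> 2 ^ k * (1 + \<bar>x\<bar> ^ k)" for x :: real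
proof -
  have "(1 + \<bar>x\<bar>) ^ k \<le> (2 * max 1 \<bar>x\<bar>) ^ k" by (intro power_mono) auto
  also have "\<dots> = 2 ^ k * (max 1 \<bar>x\<bar>) ^ k" by (rule power_mult_distrib)
  also have "(max 1 \<bar>x\<bar>) ^ k \<le> 1 + \<bar>x\<bar> ^ k" by (simp add: max_def)
  finally show ?thesis by simp
qed

lemma moment_measure_integrable:
  assumes "moment_measure k M" "f \<in> borel_measurable borel" "\<And>x. \<bar>f x\<bar> \<le> C * (1 + \<bar>x\<bar>) ^ k"
  shows "integrable M f"
proof -
  interpret finite_measure M using assms(1) by (simp add: moment_measure_def)
  have [measurable_cong]: "sets M = sets borel" using assms(1) by (simp add: moment_measure_def)
  note [measurable] = assms(2)
  have i: "integrable M (\<lambda>x. \<bar>C\<bar> * (2 ^ k * (1 + \<bar>x\<bar> ^ k)))"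
    using assms(1) by (auto simp: moment_measure_def)
  have le: "norm (f x) \<le> norm (\<bar>C\<bar> * (2 ^ k * (1 + \<bar>x\<bar> ^ k)))" for x
  proof -
    have "\<bar>f x\<bar> \<le> C * (1 + \<bar>x\<bar>) ^ k" by (rule assms(3))
    also have "\<dots> \<le> \<bar>C\<bar> * (1 + \<bar>x\<bar>) ^ k" by (intro mult_right_mono) auto
    also have "\<dots> \<le> \<bar>C\<bar> * (2 ^ k * (1 + \<bar>x\<bar> ^ k))" by (intro mult_left_mono one_plus_power_le) simp
    finally show ?thesis by simp
  qed
  show ?thesis by (rule Bochner_Integration.integrable_bound[OF i]) (use le in auto)
qed

lemma moment_measure_power_integrable:
  assumes "moment_measure k M" "j \<le> k"
  shows "integrable M (\<lambda>x. x ^ j)"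
proof (rule moment_measure_integrable[OF assms(1), where C = 1])
  fix x :: real
  have "\<bar>x\<bar> ^ j \<le> (1 + \<bar>x\<bar>) ^ j" by (intro power_mono) auto
  also have "\<dots> \<le> (1 + \<bar>x\<bar>) ^ k" using assms(2) by (intro power_increasing) auto
  finally show "\<bar>x ^ j\<bar> \<le> 1 * (1 + \<bar>x\<bar>) ^ k" by (simp add: power_abs)
qed simp

lemma tpow_bound:
  assumes "p \<le> k"
  shows "\<bar>tpow p t x\<bar> \<le> (1 + \<bar>t\<bar>) ^ k * (1 + \<bar>x\<bar>) ^ k"
proof -
  have "\<bar>tpow p t x\<bar> \<le> (\<bar>x\<bar> + \<bar>t\<bar>) ^ p" using tpow_le[of p t x] tpow_nonneg[of p t x] by simp
  also have "\<dots> \<le> ((1 + \<bar>t\<bar>) * (1 + \<bar>x\<bar>)) ^ p" by (intro power_mono) (auto simp: algebra_simps)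
  also have "\<dots> \<le> ((1 + \<bar>t\<bar>) * (1 + \<bar>x\<bar>)) ^ k"
  proof (intro power_increasing assms)
    have "1 * 1 \<le> (1 + \<bar>t\<bar>) * (1 + \<bar>x\<bar>)" by (intro mult_mono) auto
    then show "1 \<le> (1 + \<bar>t\<bar>) * (1 + \<bar>x\<bar>)" by simp
  qed
  finally show ?thesis by (simp add: power_mult_distrib)
qed

lemma moment_measure_tpow_integrable:
  assumes "moment_measure k M" "p \<le> k"
  shows "integrable M (tpow p t)"
  by (rule moment_measure_integrable[OF assms(1) _ tpow_bound[OF assms(2)]]) simp

text \<open>The estimate \<open>1 + |x + y| \<le> (1 + |x|) * (1 + |y|)\<close> lets the double
  integral split into two factors.\<close>

lemma moment_measure_convolution:
  assumes M: "moment_measure k M" and N: "moment_measure k N"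
  shows "moment_measure k (M \<star> N)"
proof -
  have fin: "finite_measure M" "finite_measure N" and s: "sets M = sets borel" "sets N = sets borel"
    using M N by (auto simp: moment_measure_def)
  note [measurable_cong] = s
  have b: "integrable K (\<lambda>x. (1 + \<bar>x\<bar>) ^ k)" if "moment_measure k K" for K
    by (rule moment_measure_integrable[OF that, where C = 1]) auto
  have f: "(\<integral>\<^sup>+x. ennreal ((1 + \<bar>x\<bar>) ^ k) \<partial>K) < \<infinity>" if "moment_measure k K" for K
    using b[OF that] by (simp add: integrable_iff_bounded power_abs)
  have "(\<integral>\<^sup>+x. ennreal (\<bar>x\<bar> ^ k) \<partial>(M \<star> N)) = (\<integral>\<^sup>+x. \<integral>\<^sup>+y. ennreal (\<bar>x + y\<bar> ^ k) \<partial>N \<partial>M)"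
    by (rule nn_integral_convolution[OF fin s(2,1)]) measurable
  also have "\<dots> \<le> (\<integral>\<^sup>+x. \<integral>\<^sup>+y. ennreal ((1 + \<bar>x\<bar>) ^ k) * ennreal ((1 + \<bar>y\<bar>) ^ k) \<partial>N \<partial>M)"
  proof (intro nn_integral_mono)
    fix x y :: real
    have "\<bar>x + y\<bar> \<le> \<bar>x\<bar> + \<bar>y\<bar>" by (rule abs_triangle_ineq)
    also have "\<dots> \<le> (1 + \<bar>x\<bar>) * (1 + \<bar>y\<bar>)" by (simp add: algebra_simps)
    finally have "\<bar>x + y\<bar> ^ k \<le> (1 + \<bar>x\<bar>) ^ k * (1 + \<bar>y\<bar>) ^ k"
      unfolding power_mult_distrib[symmetric] by (intro power_mono) auto
    then show "ennreal (\<bar>x + y\<bar> ^ k) \<le> ennreal ((1 + \<bar>x\<bar>) ^ k) * ennreal ((1 + \<bar>y\<bar>) ^ k)"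
      by (simp add: ennreal_mult[symmetric] ennreal_leI)
  qed
  also have "\<dots> = (\<integral>\<^sup>+x. ennreal ((1 + \<bar>x\<bar>) ^ k) \<partial>M) * (\<integral>\<^sup>+y. ennreal ((1 + \<bar>y\<bar>) ^ k) \<partial>N)"
    by (simp add: nn_integral_cmult nn_integral_multc)
  also have "\<dots> < \<infinity>" using f[OF M] f[OF N] by (simp add: ennreal_mult_less_top)
  finally have "integrable (M \<star> N) (\<lambda>x. \<bar>x\<bar> ^ k)"
    by (intro integrableI_bounded) (simp_all add: power_abs)
  then show ?thesis using convolution_finite[OF fin s(2,1)] by (simp add: moment_measure_def)
qed

text \<open>The variable of \<open>N\<close> is the outer one, matching the order of integration in
  \<open>sconv\<close>.\<close>

lemma integral_convolution:
  fixes M N :: "real measure" and f :: "real \<Rightarrow> real"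
  assumes fin: "finite_measure M" "finite_measure N" and s: "sets M = sets borel" "sets N = sets borel"
    and f: "integrable (M \<star> N) f"
  shows "integrable N (\<lambda>y. \<integral>x. f (x + y) \<partial>M)"
    and "(\<integral>x. f x \<partial>(M \<star> N)) = (\<integral>y. \<integral>x. f (x + y) \<partial>M \<partial>N)"
proof -
  note [measurable_cong] = s
  interpret M: finite_measure M by (rule fin)
  interpret N: finite_measure N by (rule fin)
  interpret pair_sigma_finite M N ..
  have [measurable]: "f \<in> borel_measurable borel" using f by auto
  have m: "(\<lambda>(x, y). x + y) \<in> measurable (M \<Otimes>\<^sub>M N) (borel :: real measure)" by measurable
  have "integrable (M \<Otimes>\<^sub>M N) (\<lambda>p. f (case p of (x, y) \<Rightarrow> x + y))"
    using f integrable_distr_eq[OF m, of f] unfolding convolution_def by simp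
  then have i: "integrable (M \<Otimes>\<^sub>M N) (\<lambda>(x, y). f (x + y))" by (simp add: case_prod_unfold)
  show "integrable N (\<lambda>y. \<integral>x. f (x + y) \<partial>M)" by (rule integrable_snd[OF i])
  have "(\<integral>x. f x \<partial>(M \<star> N)) = (\<integral>p. f (case p of (x, y) \<Rightarrow> x + y) \<partial>(M \<Otimes>\<^sub>M N))"
    unfolding convolution_def by (rule integral_distr[OF m]) simp
  then show "(\<integral>x. f x \<partial>(M \<star> N)) = (\<integral>y. \<integral>x. f (x + y) \<partial>M \<partial>N)"
    unfolding integral_snd[OF i] by (simp add: case_prod_unfold)
qed

lemma measure_convolution:
  fixes M N :: "real measure"
  assumes fin: "finite_measure M" "finite_measure N" and s: "sets M = sets borel" "sets N = sets borel"
    and A: "A \<in> sets borel"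
  shows "integrable N (\<lambda>y. measure M {x. x + y \<in> A})"
    and "measure (M \<star> N) A = (\<integral>y. measure M {x. x + y \<in> A} \<partial>N)"
proof -
  note [measurable_cong] = s
  note [measurable] = A
  interpret C: finite_measure "M \<star> N" by (rule convolution_finite[OF fin s(2,1)])
  have i: "integrable (M \<star> N) (indicator A :: real \<Rightarrow> real)"
    using A by (intro integrable_real_indicator) (simp_all add: less_top[symmetric])
  have e: "(\<integral>x. indicator A (x + y) \<partial>M) = measure M {x. x + y \<in> A}" for y
  proof -
    have "{x. x + y \<in> A} \<inter> space M = {x. x + y \<in> A}" using sets_eq_imp_space_eq[OF s(1)] by simp
    moreover have "(\<integral>x. indicator A (x + y) \<partial>M) = (\<integral>x. indicator {x. x + y \<in> A} x \<partial>M :: real)"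
      by (intro Bochner_Integration.integral_cong) (auto simp: indicator_def)
    ultimately show ?thesis by simp
  qed
  have "A \<inter> space (M \<star> N) = A" by simp
  then show "measure (M \<star> N) A = (\<integral>y. measure M {x. x + y \<in> A} \<partial>N)"
    using integral_convolution(2)[OF fin s i] by (simp add: e)
  show "integrable N (\<lambda>y. measure M {x. x + y \<in> A})"
    using integral_convolution(1)[OF fin s i] by (simp add: e)
qed

lemma moment_convolution:
  assumes M: "moment_measure k M" and N: "moment_measure k N" and j: "j \<le> k"
  shows "(\<integral>x. x ^ j \<partial>(M \<star> N)) = (\<Sum>i\<le>j. of_nat (j choose i) * (\<integral>x. x ^ i \<partial>M) * (\<integral>x. x ^ (j - i) \<partial>N))"
proof -
  have fin: "finite_measure M" "finite_measure N" and s: "sets M = sets borel" "sets N = sets borel"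
    using M N by (auto simp: moment_measure_def)
  have "(\<integral>x. x ^ j \<partial>(M \<star> N)) = (\<integral>y. \<integral>x. (x + y) ^ j \<partial>M \<partial>N)"
    by (rule integral_convolution(2)[OF fin s moment_measure_power_integrable[OF moment_measure_convolution[OF M N] j]])
  also have "\<dots> = (\<integral>y. (\<Sum>i\<le>j. of_nat (j choose i) * (\<integral>x. x ^ i \<partial>M) * y ^ (j - i)) \<partial>N)"
  proof (intro Bochner_Integration.integral_cong refl)
    fix y
    have "(\<integral>x. (x + y) ^ j \<partial>M) = (\<integral>x. (\<Sum>i\<le>j. of_nat (j choose i) * x ^ i * y ^ (j - i)) \<partial>M)"
      by (simp only: binomial_ring)
    also have "\<dots> = (\<Sum>i\<le>j. \<integral>x. of_nat (j choose i) * x ^ i * y ^ (j - i) \<partial>M)"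
      using j by (intro Bochner_Integration.integral_sum integrable_mult_left integrable_mult_right moment_measure_power_integrable[OF M]) simp
    finally show "(\<integral>x. (x + y) ^ j \<partial>M) = (\<Sum>i\<le>j. of_nat (j choose i) * (\<integral>x. x ^ i \<partial>M) * y ^ (j - i))"
      by simp
  qed
  also have "\<dots> = (\<Sum>i\<le>j. \<integral>y. of_nat (j choose i) * (\<integral>x. x ^ i \<partial>M) * y ^ (j - i) \<partial>N)"
    using j by (intro Bochner_Integration.integral_sum integrable_mult_right moment_measure_power_integrable[OF N]) simp
  finally show ?thesis by simp
qed

text \<open>As a function of \<open>y\<close> the integrand is
  \<open>(y - (A - x)) ^ p / fact p\<close> between \<open>A - x\<close> and \<open>z\<close>. The
  factorial in \<open>tpow\<close> makes the antiderivative a truncated power of the next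
  degree.\<close>

lemma nn_integral_tpow_indicator:
  "(\<integral>\<^sup>+y. ennreal (tpow p (A - y) x) * indicator {y..} z \<partial>lborel) = ennreal (tpow (Suc p) A (x + z))"
proof -
  have eq: "ennreal (tpow p (A - y) x) * indicator {y..} z = ennreal ((y - (A - x)) ^ p / fact p) * indicator {A - x..z} y" for y
    by (auto simp: tpow_def indicator_def algebra_simps)
  show ?thesis
  proof (cases "A - x \<le> z")
    case True
    have "(\<integral>\<^sup>+y. ennreal ((y - (A - x)) ^ p / fact p) * indicator {A - x..z} y \<partial>lborel)
        = ennreal ((z - (A - x)) ^ Suc p / fact (Suc p) - ((A - x) - (A - x)) ^ Suc p / fact (Suc p))"
    proof (rule nn_integral_FTC_Icc)
      fix y
      have "((\<lambda>y. (y - (A - x)) ^ Suc p) has_real_derivative (real (Suc p) * (y - (A - x)) ^ p)) (at y)"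
        by (auto intro!: derivative_eq_intros simp del: power_Suc)
      then have "((\<lambda>y. (y - (A - x)) ^ Suc p / fact (Suc p)) has_real_derivative (real (Suc p) * (y - (A - x)) ^ p / fact (Suc p))) (at y)"
        by (rule DERIV_cdivide)
      moreover have "real (Suc p) * (y - (A - x)) ^ p / fact (Suc p) = (y - (A - x)) ^ p / fact p"
        unfolding fact_Suc by (simp del: of_nat_Suc)
      ultimately show "((\<lambda>y. (y - (A - x)) ^ Suc p / fact (Suc p)) has_real_derivative (y - (A - x)) ^ p / fact p) (at y)"
        by (simp only:)
    qed (use True in auto)
    then show ?thesis using True unfolding eq by (simp add: tpow_def algebra_simps)
  next
    case False
    then have "{A - x..z} = {}" by simp
    then show ?thesis unfolding eq using False by (simp add: tpow_def)
  qed
qed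

text \<open>The tail is the integral of \<open>indicator {y..} z\<close> over \<open>z\<close>, and
  Tonelli's theorem brings the integral over \<open>y\<close> inside, where it raises the degree of
  the truncated power by one. As all integrands are nonnegative, integrability follows from the
  finite value, which the moments of order \<open>k\<close> provide.\<close>

lemma tail_convolution:
  assumes M: "moment_measure k M" and N: "moment_measure k N" and p: "Suc p \<le> k"
  shows "integrable lborel (\<lambda>y. (\<integral>x. tpow p (A - y) x \<partial>M) * measure N {y..})" (is "integrable _ ?f")
    and "(\<integral>y. (\<integral>x. tpow p (A - y) x \<partial>M) * measure N {y..} \<partial>lborel) = (\<integral>x. tpow (Suc p) A x \<partial>(M \<star> N))"
proof -
  have fin: "finite_measure M" "finite_measure N" and s: "sets M = sets borel" "sets N = sets borel"
    using M N by (auto simp: moment_measure_def)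
  note [measurable_cong] = s
  interpret M: finite_measure M by (rule fin)
  interpret N: finite_measure N by (rule fin)
  interpret LM: pair_sigma_finite lborel M ..
  interpret LN: pair_sigma_finite lborel N ..
  have p': "p \<le> k" using p by simp
  have m1 [measurable]: "(\<lambda>(y, x). tpow p (A - y) x) \<in> borel_measurable (lborel \<Otimes>\<^sub>M M)"
    unfolding tpow_def by measurable
  have m1' [measurable]: "(\<lambda>y. \<integral>x. tpow p (A - y) x \<partial>M) \<in> borel_measurable lborel"
    using M.borel_measurable_lebesgue_integral[of "\<lambda>y. tpow p (A - y)" lborel] m1 by simp
  have m2: "measure N {y..} = (\<integral>z. (if y \<le> z then 1 else 0) \<partial>N)" for y
  proof -
    have "measure N {y..} = (\<integral>z. indicator {y..} z \<partial>N)"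
      using sets_eq_imp_space_eq[OF s(2)] by simp
    also have "\<dots> = (\<integral>z. (if y \<le> z then 1 else 0) \<partial>N)"
      by (intro Bochner_Integration.integral_cong) (auto simp: indicator_def)
    finally show ?thesis .
  qed
  have m2' [measurable]: "(\<lambda>y. measure N {y..}) \<in> borel_measurable lborel"
    unfolding m2 by measurable
  have h: "ennreal (\<integral>x. tpow p (A - y) x \<partial>M) = (\<integral>\<^sup>+x. ennreal (tpow p (A - y) x) \<partial>M)" for y
    by (rule nn_integral_eq_integral[symmetric]) (auto intro: moment_measure_tpow_integrable[OF M p'] simp: tpow_nonneg)
  have m: "ennreal (measure N {y..}) = (\<integral>\<^sup>+z. indicator {y..} z \<partial>N)" for y
    by (simp add: N.emeasure_eq_measure s)
  have ind: "indicator {y..} z = (if y \<le> z then 1 else 0 :: ennreal)" for y z :: real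
    by (simp add: indicator_def)
  have t3: "(\<lambda>(y, x). ennreal (tpow p (A - y) x) * indicator {y..} z) \<in> borel_measurable (lborel \<Otimes>\<^sub>M M)" for z
    unfolding tpow_def ind by measurable
  have "(\<integral>\<^sup>+y. ennreal (?f y) \<partial>lborel) = (\<integral>\<^sup>+y. \<integral>\<^sup>+z. (\<integral>\<^sup>+x. ennreal (tpow p (A - y) x) \<partial>M) * indicator {y..} z \<partial>N \<partial>lborel)"
  proof (intro nn_integral_cong)
    fix y
    have "ennreal (?f y) = ennreal (\<integral>x. tpow p (A - y) x \<partial>M) * ennreal (measure N {y..})"
      by (intro ennreal_mult Bochner_Integration.integral_nonneg tpow_nonneg) simp
    also have "\<dots> = (\<integral>\<^sup>+z. (\<integral>\<^sup>+x. ennreal (tpow p (A - y) x) \<partial>M) * indicator {y..} z \<partial>N)"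
      unfolding h m by (rule nn_integral_cmult[symmetric]) measurable
    finally show "ennreal (?f y) = (\<integral>\<^sup>+z. (\<integral>\<^sup>+x. ennreal (tpow p (A - y) x) \<partial>M) * indicator {y..} z \<partial>N)" .
  qed
  also have "\<dots> = (\<integral>\<^sup>+z. \<integral>\<^sup>+y. (\<integral>\<^sup>+x. ennreal (tpow p (A - y) x) \<partial>M) * indicator {y..} z \<partial>lborel \<partial>N)"
  proof (rule LN.Fubini'[symmetric])
    have "(\<lambda>y. \<integral>\<^sup>+x. ennreal (tpow p (A - y) x) \<partial>M) \<in> borel_measurable lborel"
      unfolding h[symmetric] by measurable
    then show "(\<lambda>(y, z). (\<integral>\<^sup>+x. ennreal (tpow p (A - y) x) \<partial>M) * indicator {y..} z) \<in> borel_measurable (lborel \<Otimes>\<^sub>M N)"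
      unfolding ind by measurable
  qed
  also have "\<dots> = (\<integral>\<^sup>+z. \<integral>\<^sup>+x. ennreal (tpow (Suc p) A (x + z)) \<partial>M \<partial>N)"
  proof (intro nn_integral_cong)
    fix z
    have "(\<integral>\<^sup>+y. (\<integral>\<^sup>+x. ennreal (tpow p (A - y) x) \<partial>M) * indicator {y..} z \<partial>lborel)
       = (\<integral>\<^sup>+y. \<integral>\<^sup>+x. ennreal (tpow p (A - y) x) * indicator {y..} z \<partial>M \<partial>lborel)"
      by (intro nn_integral_cong nn_integral_multc[symmetric]) (simp add: measurable_cong_sets[OF s(1) refl])
    also have "\<dots> = (\<integral>\<^sup>+x. \<integral>\<^sup>+y. ennreal (tpow p (A - y) x) * indicator {y..} z \<partial>lborel \<partial>M)"
      by (rule LM.Fubini'[symmetric, OF t3])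
    finally show "(\<integral>\<^sup>+y. (\<integral>\<^sup>+x. ennreal (tpow p (A - y) x) \<partial>M) * indicator {y..} z \<partial>lborel)
      = (\<integral>\<^sup>+x. ennreal (tpow (Suc p) A (x + z)) \<partial>M)"
      by (simp only: nn_integral_tpow_indicator)
  qed
  also have "\<dots> = (\<integral>\<^sup>+x. \<integral>\<^sup>+z. ennreal (tpow (Suc p) A (x + z)) \<partial>N \<partial>M)"
  proof -
    interpret MN: pair_sigma_finite M N ..
    show ?thesis by (rule MN.Fubini') (simp add: tpow_def)
  qed
  also have "\<dots> = (\<integral>\<^sup>+x. ennreal (tpow (Suc p) A x) \<partial>(M \<star> N))"
    by (rule nn_integral_convolution[OF fin s(2,1), symmetric]) simp
  also have "\<dots> = ennreal (\<integral>x. tpow (Suc p) A x \<partial>(M \<star> N))"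
    by (rule nn_integral_eq_integral) (auto intro: moment_measure_tpow_integrable[OF moment_measure_convolution[OF M N] p] simp: tpow_nonneg)
  finally have eq: "(\<integral>\<^sup>+y. ennreal (?f y) \<partial>lborel) = ennreal (\<integral>x. tpow (Suc p) A x \<partial>(M \<star> N))" .
  have nn: "0 \<le> ?f y" for y by (intro mult_nonneg_nonneg Bochner_Integration.integral_nonneg tpow_nonneg) simp
  have I: "0 \<le> (\<integral>x. tpow (Suc p) A x \<partial>(M \<star> N))" by (intro Bochner_Integration.integral_nonneg tpow_nonneg)
  have fm: "?f \<in> borel_measurable lborel" by measurable
  show "integrable lborel ?f"
    by (rule integrableI_nn_integral_finite[OF fm _ eq]) (simp add: nn)
  show "(\<integral>y. ?f y \<partial>lborel) = (\<integral>x. tpow (Suc p) A x \<partial>(M \<star> N))"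
    by (subst integral_eq_nn_integral[OF fm]) (simp_all add: nn eq I)
qed

text \<open>\<open>sintegral\<close> refers to Jordan parts, whereas convolution powers arise as
  differences of measures that need not be mutually singular. The polar form shows that any such
  representation gives the same integral.\<close>

lemma sintegral_difference:
  assumes "finite_measure M" "finite_measure N" "sets M = sets borel" "sets N = sets borel"
    and \<tau>: "\<And>A. A \<in> sets borel \<Longrightarrow> \<tau> A = measure M A - measure N A"
    and f: "integrable M f" "integrable N f"
  shows "sintegral borel \<tau> f = (\<integral>x. f x \<partial>M) - (\<integral>x. f x \<partial>N)"
proof -
  have "sets N = sets M" using assms by simp
  from difference_signed_density[OF assms(1,2) this] obtain \<rho> s
    where \<rho>: "signed_density M \<rho> s (\<lambda>A. measure M A - measure N A)"
      "integrable \<rho> f" "(\<integral>x. f x * s x \<partial>\<rho>) = (\<integral>x. f x \<partial>M) - (\<integral>x. f x \<partial>N)" using f by blast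
  interpret signed_density borel \<rho> s \<tau>
    by (rule signed_density_cong[OF \<rho>(1)]) (simp_all add: assms)
  show ?thesis using sintegral_eq[OF \<rho>(2)] \<rho>(3) by simp
qed

text \<open>The induction carries a pair of finite measures: a further factor leads to
  \<open>M \<star> \<nu> + N \<star> \<mu>\<close> and
  \<open>M \<star> \<mu> + N \<star> \<nu>\<close>. With \<open>Suc q\<close> factors of total mass
  zero the moments up to order \<open>q\<close> cancel, and each factor raises the degree of the
  truncated power by one.\<close>

lemma sconv_power_difference:
  assumes \<mu>: "prob_space \<mu>" "moment_measure k \<mu>" and \<nu>: "prob_space \<nu>" "moment_measure k \<nu>"
    and q: "q \<le> k"
  shows "\<exists>M N. moment_measure k M \<and> moment_measure k N
    \<and> (\<forall>A\<in>sets borel. sconv_power (\<lambda>A. measure \<nu> A - measure \<mu> A) (Suc q) A = measure M A - measure N A)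
    \<and> (\<forall>j\<le>q. (\<integral>x. x ^ j \<partial>M) = (\<integral>x. x ^ j \<partial>N))
    \<and> (\<forall>A. fconv_power (\<lambda>x. tail (measure \<nu>) x - tail (measure \<mu>) x) (Suc q) A
        = (\<integral>x. tpow q A x \<partial>M) - (\<integral>x. tpow q A x \<partial>N))"
  using q
proof (induction q)
  case 0
  \<comment> \<open>Degree \<open>0\<close> gives the tail itself: the value \<open>1\<close> at the
    jump matches the closed half-line in \<open>tail\<close>.\<close>
  have "tpow 0 A = indicator {A..}" for A by (auto simp: tpow_def indicator_def)
  moreover have "space \<mu> = UNIV" "space \<nu> = UNIV"
    using \<mu>(2) \<nu>(2) sets_eq_imp_space_eq[of \<mu> borel] sets_eq_imp_space_eq[of \<nu> borel] by (auto simp: moment_measure_def)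
  moreover have "measure \<mu> UNIV = 1" "measure \<nu> UNIV = 1"
    using \<mu>(1) \<nu>(1) prob_space.prob_space calculation by metis+
  ultimately show ?case using \<mu> \<nu>
    by (intro exI[of _ \<nu>] exI[of _ \<mu>]) (simp add: sconv_power_def fconv_power_def tail_def)
next
  case (Suc q)
  let ?\<tau> = "\<lambda>A. measure \<nu> A - measure \<mu> A"
  let ?g = "\<lambda>x. tail (measure \<nu>) x - tail (measure \<mu>) x"
  from Suc obtain M N where M: "moment_measure k M" and N: "moment_measure k N"
    and \<sigma>: "\<And>A. A \<in> sets borel \<Longrightarrow> sconv_power ?\<tau> (Suc q) A = measure M A - measure N A"
    and mom: "\<And>j. j \<le> q \<Longrightarrow> (\<integral>x. x ^ j \<partial>M) = (\<integral>x. x ^ j \<partial>N)"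
    and fc: "\<And>A. fconv_power ?g (Suc q) A = (\<integral>x. tpow q A x \<partial>M) - (\<integral>x. tpow q A x \<partial>N)"
    by (auto dest: Suc_leD)
  have fin: "finite_measure M" "finite_measure N" "finite_measure \<mu>" "finite_measure \<nu>"
    and s: "sets M = sets borel" "sets N = sets borel" "sets \<mu> = sets borel" "sets \<nu> = sets borel"
    using M N \<mu> \<nu> by (auto simp: moment_measure_def)
  define M' where "M' = measure_add (M \<star> \<nu>) (N \<star> \<mu>)"
  define N' where "N' = measure_add (M \<star> \<mu>) (N \<star> \<nu>)"
  note conv = moment_measure_convolution
  note [simp] = convolution_finite
  have mm: "moment_measure k (measure_add K L)" if "moment_measure k K" "moment_measure k L" for K L
    using that finite_measure_measure_add[of K L] integrable_measure_add_iff[of L K "\<lambda>x. \<bar>x\<bar> ^ k"] by (simp add: moment_measure_def)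
  have int_M': "(\<integral>x. f x \<partial>M') = (\<integral>x. f x \<partial>(M \<star> \<nu>)) + (\<integral>x. f x \<partial>(N \<star> \<mu>))"
    if "integrable (M \<star> \<nu>) f" "integrable (N \<star> \<mu>) f" for f :: "real \<Rightarrow> real"
    unfolding M'_def by (rule integral_measure_add) (use that in simp_all)
  have int_N': "(\<integral>x. f x \<partial>N') = (\<integral>x. f x \<partial>(M \<star> \<mu>)) + (\<integral>x. f x \<partial>(N \<star> \<nu>))"
    if "integrable (M \<star> \<mu>) f" "integrable (N \<star> \<nu>) f" for f :: "real \<Rightarrow> real"
    unfolding N'_def by (rule integral_measure_add) (use that in simp_all)
  have "sconv_power ?\<tau> (Suc (Suc q)) A = measure M' A - measure N' A" if A: "A \<in> sets borel" for A
  proof -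
    have e: "measure (measure_add K L) A = measure K A + measure L A"
      if "finite_measure K" "finite_measure L" "sets K = sets borel" "sets L = sets borel" for K L :: "real measure"
      by (rule measure_measure_add) (use that A in simp_all)
    have B: "{x. x + y \<in> A} \<in> sets borel" for y :: real using A by measurable
    have "sconv_power ?\<tau> (Suc (Suc q)) A = sintegral borel ?\<tau> (\<lambda>y. sconv_power ?\<tau> (Suc q) {x. x + y \<in> A})"
      by (simp add: sconv_power_def sconv_def)
    also have "\<dots> = sintegral borel ?\<tau> (\<lambda>y. measure M {x. x + y \<in> A} - measure N {x. x + y \<in> A})"
      by (simp only: \<sigma>[OF B])
    also have "\<dots> = (\<integral>y. measure M {x. x + y \<in> A} - measure N {x. x + y \<in> A} \<partial>\<nu>)
        - (\<integral>y. measure M {x. x + y \<in> A} - measure N {x. x + y \<in> A} \<partial>\<mu>)"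
      by (intro sintegral_difference fin s refl Bochner_Integration.integrable_diff measure_convolution A)
    also have "\<dots> = (measure (M \<star> \<nu>) A - measure (N \<star> \<nu>) A) - (measure (M \<star> \<mu>) A - measure (N \<star> \<mu>) A)"
      by (simp only: measure_convolution(2)[OF fin(1,4) s(1,4) A] measure_convolution(2)[OF fin(2,4) s(2,4) A]
        measure_convolution(2)[OF fin(1,3) s(1,3) A] measure_convolution(2)[OF fin(2,3) s(2,3) A]
        Bochner_Integration.integral_diff[OF measure_convolution(1)[OF fin(1,4) s(1,4) A] measure_convolution(1)[OF fin(2,4) s(2,4) A]]
        Bochner_Integration.integral_diff[OF measure_convolution(1)[OF fin(1,3) s(1,3) A] measure_convolution(1)[OF fin(2,3) s(2,3) A]])
    also have "\<dots> = measure M' A - measure N' A"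
      unfolding M'_def N'_def using fin s by (simp add: e)
    finally show ?thesis .
  qed
  moreover have "(\<integral>x. x ^ j \<partial>M') = (\<integral>x. x ^ j \<partial>N')" if j: "j \<le> Suc q" for j
  proof -
    have jk: "j \<le> k" using j Suc.prems by simp
    let ?m = "\<lambda>K i. \<integral>x. x ^ i \<partial>(K :: real measure)"
    \<comment> \<open>For \<open>i \<le> q\<close> the moments of \<open>M\<close> and
      \<open>N\<close> agree. Otherwise \<open>i = j = Suc q\<close>, and the remaining factor is
      the difference of two total masses, both \<open>1\<close>.\<close>
    have z: "(?m M i - ?m N i) * (?m \<nu> (j - i) - ?m \<mu> (j - i)) = 0" if "i \<le> j" for i
    proof (cases "i \<le> q")
      case False
      then have "j - i = 0" using j by simp
      moreover have "?m \<nu> 0 = 1" "?m \<mu> 0 = 1" using \<mu>(1) \<nu>(1) by (simp_all add: prob_space.prob_space)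
      ultimately show ?thesis by simp
    qed (simp add: mom)
    have "?m M' j - ?m N' j = (?m (M \<star> \<nu>) j + ?m (N \<star> \<mu>) j) - (?m (M \<star> \<mu>) j + ?m (N \<star> \<nu>) j)"
      by (subst int_M' int_N', (rule moment_measure_power_integrable[OF conv jk], fact M N \<mu> \<nu>, fact M N \<mu> \<nu>)+)+ simp
    also have "\<dots> = (\<Sum>i\<le>j. of_nat (j choose i) * ((?m M i - ?m N i) * (?m \<nu> (j - i) - ?m \<mu> (j - i))))"
      unfolding moment_convolution[OF M \<nu>(2) jk] moment_convolution[OF N \<nu>(2) jk]
        moment_convolution[OF M \<mu>(2) jk] moment_convolution[OF N \<mu>(2) jk]
      by (simp add: sum.distrib[symmetric] sum_subtractf[symmetric] algebra_simps)
    also have "\<dots> = 0" by (intro sum.neutral) (simp add: z)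
    finally show ?thesis by simp
  qed
  moreover have "fconv_power ?g (Suc (Suc q)) A = (\<integral>x. tpow (Suc q) A x \<partial>M') - (\<integral>x. tpow (Suc q) A x \<partial>N')" for A
  proof -
    note tc = tail_convolution[OF _ _ Suc.prems, where A = A]
    let ?t = "\<lambda>K y. \<integral>x. tpow q (A - y) x \<partial>(K :: real measure)"
    have "fconv_power ?g (Suc (Suc q)) A = (\<integral>y. fconv_power ?g (Suc q) (A - y) * ?g y \<partial>lborel)"
      by (simp add: fconv_power_def fconv_def)
    also have "\<dots> = (\<integral>y. (?t M y * measure \<nu> {y..} - ?t M y * measure \<mu> {y..}) - (?t N y * measure \<nu> {y..} - ?t N y * measure \<mu> {y..}) \<partial>lborel)"
      unfolding fc unfolding tail_def left_diff_distrib right_diff_distrib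
      by (intro Bochner_Integration.integral_cong refl) simp
    also have "\<dots> = ((\<integral>x. tpow (Suc q) A x \<partial>(M \<star> \<nu>)) - (\<integral>x. tpow (Suc q) A x \<partial>(M \<star> \<mu>)))
        - ((\<integral>x. tpow (Suc q) A x \<partial>(N \<star> \<nu>)) - (\<integral>x. tpow (Suc q) A x \<partial>(N \<star> \<mu>)))"
      using tc(1)[OF M \<nu>(2)] tc(1)[OF M \<mu>(2)] tc(1)[OF N \<nu>(2)] tc(1)[OF N \<mu>(2)]
      by (simp add: tc(2)[OF M \<nu>(2)] tc(2)[OF M \<mu>(2)] tc(2)[OF N \<nu>(2)] tc(2)[OF N \<mu>(2)])
    also have "\<dots> = (\<integral>x. tpow (Suc q) A x \<partial>M') - (\<integral>x. tpow (Suc q) A x \<partial>N')"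
      by (subst int_M' int_N', (rule moment_measure_tpow_integrable[OF conv Suc.prems], fact M N \<mu> \<nu>, fact M N \<mu> \<nu>)+)+ simp
    finally show ?thesis .
  qed
  moreover have "moment_measure k M'" "moment_measure k N'"
    unfolding M'_def N'_def by (intro mm conv M N \<mu>(2) \<nu>(2))+
  ultimately show ?case by blast
qed

text \<open>Taking \<open>q = k = n - 1\<close> is the balance point: moments of order
  \<open>n - 1\<close> suffice for the \<open>n\<close>-fold power to annihilate all degrees below
  \<open>n\<close>, and the truncated power has the same degree. The polar form then replaces the
  pair of measures.\<close>

lemma coordinate_density:
  assumes \<mu>: "real_distribution \<mu>" "integrable \<mu> (\<lambda>x. \<bar>x\<bar> ^ (n - 1))"
    and \<nu>: "real_distribution \<nu>" "integrable \<nu> (\<lambda>x. \<bar>x\<bar> ^ (n - 1))"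
    and n: "n \<ge> 1"
  shows "\<exists>\<rho> s. signed_density borel \<rho> s (sconv_power (\<lambda>A. measure \<nu> A - measure \<mu> A) n)
    \<and> moment_measure (n - 1) \<rho>
    \<and> (\<forall>j<n. (\<integral>x. x ^ j * s x \<partial>\<rho>) = 0)
    \<and> (\<forall>A. fconv_power (\<lambda>x. tail (measure \<nu>) x - tail (measure \<mu>) x) n A = (\<integral>x. tpow (n - 1) A x * s x \<partial>\<rho>))"
proof -
  have ps: "prob_space \<mu>" "prob_space \<nu>" using \<mu>(1) \<nu>(1) by (simp_all add: real_distribution_def)
  have mm: "moment_measure (n - 1) \<mu>" "moment_measure (n - 1) \<nu>"
    using \<mu> \<nu> ps by (simp_all add: moment_measure_def real_distribution.events_eq_borel prob_space_def)
  obtain M N where M: "moment_measure (n - 1) M" and N: "moment_measure (n - 1) N"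
    and \<sigma>: "\<And>A. A \<in> sets borel \<Longrightarrow> sconv_power (\<lambda>A. measure \<nu> A - measure \<mu> A) n A = measure M A - measure N A"
    and mom: "\<And>j. j \<le> n - 1 \<Longrightarrow> (\<integral>x. x ^ j \<partial>M) = (\<integral>x. x ^ j \<partial>N)"
    and fc: "\<And>A. fconv_power (\<lambda>x. tail (measure \<nu>) x - tail (measure \<mu>) x) n A = (\<integral>x. tpow (n - 1) A x \<partial>M) - (\<integral>x. tpow (n - 1) A x \<partial>N)"
    using sconv_power_difference[OF ps(1) mm(1) ps(2) mm(2) order_refl] n by auto
  have fin: "finite_measure M" "finite_measure N" and s: "sets M = sets borel" "sets N = sets M"
    using M N by (auto simp: moment_measure_def)
  obtain \<rho> s where \<rho>: "signed_density M \<rho> s (\<lambda>A. measure M A - measure N A)"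
    and int: "\<And>f. integrable M f \<Longrightarrow> integrable N f \<Longrightarrow> integrable \<rho> f \<and> (\<integral>x. f x * s x \<partial>\<rho>) = (\<integral>x. f x \<partial>M) - (\<integral>x. f x \<partial>N)"
    using difference_signed_density[OF fin s(2)] by blast
  have "signed_density borel \<rho> s (sconv_power (\<lambda>A. measure \<nu> A - measure \<mu> A) n)"
    by (rule signed_density_cong[OF \<rho>]) (simp_all add: s \<sigma>)
  moreover have "moment_measure (n - 1) \<rho>"
    using \<rho> int[of "\<lambda>x. \<bar>x\<bar> ^ (n - 1)"] M N s by (auto simp: moment_measure_def signed_density_def)
  moreover have "(\<integral>x. x ^ j * s x \<partial>\<rho>) = 0" if "j < n" for j
  proof -
    have j: "j \<le> n - 1" using that by simp
    show ?thesis using int[OF moment_measure_power_integrable[OF M j] moment_measure_power_integrable[OF N j]] mom[OF j] by simp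
  qed
  moreover have "fconv_power (\<lambda>x. tail (measure \<nu>) x - tail (measure \<mu>) x) n A = (\<integral>x. tpow (n - 1) A x * s x \<partial>\<rho>)" for A
    using int[OF moment_measure_tpow_integrable[OF M order_refl] moment_measure_tpow_integrable[OF N order_refl]] fc by simp
  ultimately show ?thesis by blast
qed

section \<open>Product measures\<close>

context product_sigma_finite
begin

text \<open>Splits off an arbitrary coordinate as a binary product, so that Fubini's theorem for
  pairs, including its almost-everywhere statement on slices, applies to it.\<close>

lemma distr_fun_upd_pair:
  assumes "finite I" "i \<notin> I"
  shows "distr (PiM I M \<Otimes>\<^sub>M M i) (PiM (insert i I) M) (\<lambda>(x, y). x(i := y)) = PiM (insert i I) M"
proof (rule PiM_eqI)
  interpret I: finite_product_sigma_finite M I by standard fact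
  fix A assume A: "\<And>j. j \<in> insert i I \<Longrightarrow> A j \<in> sets (M j)"
  have "(\<lambda>(x, y). x(i := y)) -` PiE (insert i I) A \<inter> space (PiM I M \<Otimes>\<^sub>M M i) = PiE I A \<times> A i"
    using A[THEN sets.sets_into_space] assms(2)
    by (auto simp: space_pair_measure space_PiM PiE_iff extensional_def split: if_splits)
  moreover have "PiE I A \<in> sets (PiM I M)" using A assms(1) by (intro sets_PiM_I_finite) auto
  ultimately show "emeasure (distr (PiM I M \<Otimes>\<^sub>M M i) (PiM (insert i I) M) (\<lambda>(x, y). x(i := y))) (PiE (insert i I) A)
      = (\<Prod>j\<in>insert i I. emeasure (M j) (A j))"
    using A assms
    by (simp add: emeasure_distr sets_PiM_I_finite sigma_finite_measure.emeasure_pair_measure_Times[OF sigma_finite_measures] emeasure_PiM mult.commute)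
qed (use assms in auto)

lemma integrable_fun_upd_pair:
  fixes f :: "('i \<Rightarrow> 'a) \<Rightarrow> real"
  assumes I: "finite I" "i \<notin> I" and f: "f \<in> borel_measurable (PiM (insert i I) M)"
  shows "integrable (PiM (insert i I) M) f \<longleftrightarrow> integrable (PiM I M \<Otimes>\<^sub>M M i) (\<lambda>(x, y). f (x(i := y)))"
    and "(\<integral>x. f x \<partial>PiM (insert i I) M) = (\<integral>(x, y). f (x(i := y)) \<partial>(PiM I M \<Otimes>\<^sub>M M i))"
proof -
  have m: "(\<lambda>(x, y). x(i := y)) \<in> measurable (PiM I M \<Otimes>\<^sub>M M i) (PiM (insert i I) M)"
    by (rule measurable_add_dim)
  show "integrable (PiM (insert i I) M) f \<longleftrightarrow> integrable (PiM I M \<Otimes>\<^sub>M M i) (\<lambda>(x, y). f (x(i := y)))"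
    using integrable_distr_eq[OF m f] unfolding distr_fun_upd_pair[OF I] by (simp add: case_prod_unfold)
  show "(\<integral>x. f x \<partial>PiM (insert i I) M) = (\<integral>(x, y). f (x(i := y)) \<partial>(PiM I M \<Otimes>\<^sub>M M i))"
    using integral_distr[OF m f] unfolding distr_fun_upd_pair[OF I] by (simp add: case_prod_unfold)
qed

end

lemma (in pair_sigma_finite) integrable_times:
  fixes f g :: "_ \<Rightarrow> real"
  assumes f: "integrable M1 f" and g: "integrable M2 g"
  shows "integrable (M1 \<Otimes>\<^sub>M M2) (\<lambda>(x, y). f x * g y)"
proof (rule Fubini_integrable)
  have [measurable]: "f \<in> borel_measurable M1" "g \<in> borel_measurable M2" using assms by auto
  show "(\<lambda>(x, y). f x * g y) \<in> borel_measurable (M1 \<Otimes>\<^sub>M M2)" by measurable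
qed (use assms in \<open>auto simp: abs_mult\<close>)

text \<open>Monomials are the form in which vanishing moments and vanishing divided differences are
  available.\<close>

lemma lagrange_polynomial:
  assumes "finite A" "a \<in> A"
  shows "\<exists>c. \<forall>x. lagrange A a x = (\<Sum>j<card A. c j * x ^ j)"
proof -
  let ?p = "\<Prod>b\<in>A - {a}. [:- b / (a - b), 1 / (a - b):]"
  have "degree ?p \<le> (\<Sum>b\<in>A - {a}. 1)"
    by (rule order_trans[OF degree_prod_sum_le]) (use assms in \<open>auto intro!: sum_mono\<close>)
  then have d: "degree ?p < card A" using assms by (simp add: card_gt_0_iff) (metis Suc_pred card_gt_0_iff empty_iff less_Suc_eq_le)
  have "lagrange A a x = (\<Sum>j<card A. coeff ?p j * x ^ j)" for x
  proof -
    have "lagrange A a x = poly ?p x" unfolding lagrange_def poly_prod by (intro prod.cong refl) (simp add: diff_divide_distrib)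
    also have "\<dots> = (\<Sum>j\<le>degree ?p. coeff ?p j * x ^ j)" by (rule poly_altdef)
    also have "\<dots> = (\<Sum>j<card A. coeff ?p j * x ^ j)"
      using d by (intro sum.mono_neutral_left) (auto simp: coeff_eq_0)
    finally show ?thesis .
  qed
  then show ?thesis by blast
qed

text \<open>\<open>\<rho> i\<close> weighted by \<open>s i\<close> is the signed measure in
  coordinate \<open>i\<close>, and \<open>R\<close> weighted by \<open>sgn_prod\<close> will be the
  product. Finiteness is demanded for every index because \<open>product_sigma_finite\<close>
  quantifies over all of them.\<close>

locale product_density =
  fixes d :: nat and n :: "nat \<Rightarrow> nat" and \<rho> :: "nat \<Rightarrow> real measure" and s :: "nat \<Rightarrow> real \<Rightarrow> real"
  assumes n: "\<And>i. i < d \<Longrightarrow> n i \<ge> 2"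
    and fin: "\<And>i. finite_measure (\<rho> i)" and sets_\<rho>: "\<And>i. sets (\<rho> i) = sets borel"
    and moment: "\<And>i. i < d \<Longrightarrow> moment_measure (n i - 1) (\<rho> i)"
    and s_meas: "\<And>i. s i \<in> borel_measurable borel" and s: "\<And>i x. \<bar>s i x\<bar> = 1"
    and vanish: "\<And>i j. i < d \<Longrightarrow> j < n i \<Longrightarrow> (\<integral>x. x ^ j * s i x \<partial>\<rho> i) = 0"
begin

sublocale product_sigma_finite \<rho>
  using fin by (simp add: product_sigma_finite_def finite_measure_def)

abbreviation R where "R \<equiv> PiM {..<d} \<rho>"

definition sgn_prod where "sgn_prod x = (\<Prod>i<d. s i (x i))"

definition K where "K i t = (\<integral>x. tpow (n i - 1) t x * s i x \<partial>\<rho> i)"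

lemma sets_R [measurable_cong]: "sets R = sets (Rd d)"
  by (rule sets_PiM_cong) (simp_all add: sets_\<rho>)

lemmas [measurable_cong] = sets_\<rho>

lemma sgn_prod_measurable [measurable]: "sgn_prod \<in> borel_measurable (Rd d)"
proof -
  note [measurable] = s_meas
  show ?thesis unfolding sgn_prod_def by measurable
qed

lemma abs_sgn_prod: "\<bar>sgn_prod x\<bar> = 1"
  by (simp add: sgn_prod_def abs_prod s)

lemma integrable_times_s:
  assumes "integrable (\<rho> i) f"
  shows "integrable (\<rho> i) (\<lambda>x. f x * s i x)"
proof -
  note [measurable] = s_meas
  have [measurable]: "f \<in> borel_measurable (\<rho> i)" using assms by auto
  show ?thesis by (rule Bochner_Integration.integrable_bound[OF assms]) (auto simp: abs_mult s)
qed

lemma integrable_times_sgn_prod: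
  assumes "integrable R f"
  shows "integrable R (\<lambda>x. f x * sgn_prod x)"
proof -
  have [measurable]: "f \<in> borel_measurable R" using assms by auto
  show ?thesis by (rule Bochner_Integration.integrable_bound[OF assms]) (auto simp: abs_mult abs_sgn_prod)
qed

lemma integral_prod_sgn_prod:
  assumes "\<And>i. i < d \<Longrightarrow> integrable (\<rho> i) (f i)"
  shows "(\<integral>x. (\<Prod>i<d. f i (x i)) * sgn_prod x \<partial>R) = (\<Prod>i<d. \<integral>x. f i x * s i x \<partial>\<rho> i)"
  unfolding sgn_prod_def prod.distrib[symmetric]
  by (rule product_integral_prod) (auto intro: integrable_times_s assms)

lemma integral_power_sum_s:
  assumes i: "i < d" and m: "m \<le> n i"
  shows "integrable (\<rho> i) (\<lambda>x. \<Sum>j<m. c j * x ^ j)" and "(\<integral>x. (\<Sum>j<m. c j * x ^ j) * s i x \<partial>\<rho> i) = 0"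
proof -
  have p: "integrable (\<rho> i) (\<lambda>x. x ^ j)" if "j < m" for j
    using that m by (intro moment_measure_power_integrable[OF moment[OF i]]) simp
  then show "integrable (\<rho> i) (\<lambda>x. \<Sum>j<m. c j * x ^ j)" by auto
  have "(\<integral>x. (\<Sum>j<m. c j * x ^ j) * s i x \<partial>\<rho> i) = (\<integral>x. (\<Sum>j<m. c j * (x ^ j * s i x)) \<partial>\<rho> i)"
    by (simp add: sum_distrib_right mult.assoc)
  also have "\<dots> = (\<Sum>j<m. \<integral>x. c j * (x ^ j * s i x) \<partial>\<rho> i)"
    using p by (intro Bochner_Integration.integral_sum integrable_mult_right integrable_times_s) simp
  also have "\<dots> = 0" using i m by (intro sum.neutral) (simp add: vanish)
  finally show "(\<integral>x. (\<Sum>j<m. c j * x ^ j) * s i x \<partial>\<rho> i) = 0" .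
qed

lemma integral_lagrange_s:
  assumes "i < d" "finite A" "card A \<le> n i" "a \<in> A"
  shows "integrable (\<rho> i) (lagrange A a)" and "(\<integral>x. lagrange A a x * s i x \<partial>\<rho> i) = 0"
proof -
  obtain c where c: "lagrange A a = (\<lambda>x. \<Sum>j<card A. c j * x ^ j)" using lagrange_polynomial[OF assms(2,4)] by blast
  show "integrable (\<rho> i) (lagrange A a)" and "(\<integral>x. lagrange A a x * s i x \<partial>\<rho> i) = 0"
    unfolding c using integral_power_sum_s[OF assms(1,3)] by blast+
qed

text \<open>The kernel differs from the truncated power by a polynomial in \<open>x\<close> of
  degree below \<open>n i\<close>, which the weighted measure annihilates. Hence the nodes leave no
  trace in the integral.\<close>

lemma integral_peano_kernel_s:
  assumes "i < d" "card A = n i"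
  shows "integrable (\<rho> i) (peano_kernel A (n i - 1) t)" and "(\<integral>x. peano_kernel A (n i - 1) t x * s i x \<partial>\<rho> i) = K i t"
proof -
  have finA: "finite A" using n[OF assms(1)] assms(2) card.infinite[of A] by fastforce
  note l = integral_lagrange_s[OF assms(1) finA eq_refl[OF assms(2)]]
  have t: "integrable (\<rho> i) (tpow (n i - 1) t)" by (rule moment_measure_tpow_integrable[OF moment[OF assms(1)] order_refl])
  have ls: "integrable (\<rho> i) (\<lambda>x. \<Sum>a\<in>A. lagrange A a x * tpow (n i - 1) t a)" using l(1) by auto
  show "integrable (\<rho> i) (peano_kernel A (n i - 1) t)"
    unfolding peano_kernel_def interp_rem_def using t ls by (rule Bochner_Integration.integrable_diff)
  have "(\<integral>x. peano_kernel A (n i - 1) t x * s i x \<partial>\<rho> i)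
     = (\<integral>x. tpow (n i - 1) t x * s i x - (\<Sum>a\<in>A. tpow (n i - 1) t a * (lagrange A a x * s i x)) \<partial>\<rho> i)"
    unfolding peano_kernel_def interp_rem_def by (simp add: left_diff_distrib right_diff_distrib sum_distrib_left sum_distrib_right mult_ac)
  also have "\<dots> = K i t - (\<integral>x. (\<Sum>a\<in>A. tpow (n i - 1) t a * (lagrange A a x * s i x)) \<partial>\<rho> i)"
    unfolding K_def by (intro Bochner_Integration.integral_diff integrable_times_s t Bochner_Integration.integrable_sum integrable_mult_right l(1))
  also have "(\<integral>x. (\<Sum>a\<in>A. tpow (n i - 1) t a * (lagrange A a x * s i x)) \<partial>\<rho> i) = (\<Sum>a\<in>A. \<integral>x. tpow (n i - 1) t a * (lagrange A a x * s i x) \<partial>\<rho> i)"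
    by (intro Bochner_Integration.integral_sum integrable_mult_right integrable_times_s l(1))
  also have "\<dots> = 0" by (intro sum.neutral) (simp add: l(2))
  finally show "(\<integral>x. peano_kernel A (n i - 1) t x * s i x \<partial>\<rho> i) = K i t" by simp
qed

text \<open>The test function is a product of truncated powers: its mixed divided differences factor
  into B-spline values, and it is continuous because the degrees \<open>n i - 1\<close> are at least
  \<open>1\<close>.\<close>

lemma kernel_prod_nonneg_of_box_convex:
  assumes all: "\<And>F. continuous_on UNIV F \<Longrightarrow> box_convex d n F \<Longrightarrow> integrable R F \<Longrightarrow> 0 \<le> (\<integral>x. F x * sgn_prod x \<partial>R)"
  shows "0 \<le> (\<Prod>i<d. K i (A i))"
proof -
  let ?F = "\<lambda>x. \<Prod>i<d. tpow (n i - 1) (A i) (x i)"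
  have t: "integrable (\<rho> i) (tpow (n i - 1) (A i))" if "i < d" for i
    by (rule moment_measure_tpow_integrable[OF moment[OF that] order_refl])
  have "continuous_on UNIV ?F"
  proof (intro continuous_on_prod)
    fix i assume "i \<in> {..<d}"
    then have "n i - 1 \<ge> 1" using n[of i] by simp
    then show "continuous_on UNIV (\<lambda>x. tpow (n i - 1) (A i) (x i))"
      unfolding tpow_eq_max[OF \<open>n i - 1 \<ge> 1\<close>] by (intro continuous_intros continuous_on_product_coordinates) simp
  qed
  moreover have "box_convex d n ?F"
    unfolding box_convex_def
  proof (intro allI impI)
    fix X :: "nat \<Rightarrow> nat \<Rightarrow> real" assume X: "\<forall>i<d. inj_on (X i) {..n i}"
    have "mdivdiff n X d ?F = (\<Prod>i<d. divdiff (tpow (n i - 1) (A i)) (X i) 0 (n i))"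
      unfolding mdivdiff_eq_tensor by (rule tensor_prod) (rule linear_functional_divdiff)
    also have "\<dots> \<ge> 0"
    proof (intro prod_nonneg ballI)
      fix i assume i: "i \<in> {..<d}"
      then have inj: "inj_on (X i) {0..0 + n i}" using X by (simp add: atMost_atLeast0)
      have "card (X i ` {0..0 + n i}) = (n i - 1) + 2" using card_image[OF inj] n[of i] i by simp
      then show "0 \<le> divdiff (tpow (n i - 1) (A i)) (X i) 0 (n i)"
        unfolding divdiff_eq_ddiff[OF inj] by (rule ddiff_tpow_nonneg_pos(1))
    qed
    finally show "0 \<le> mdivdiff n X d ?F" .
  qed
  moreover have "integrable R ?F" by (intro product_integrable_prod t) simp_all
  ultimately have "0 \<le> (\<integral>x. ?F x * sgn_prod x \<partial>R)" by (rule all)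
  moreover have "(\<integral>x. ?F x * sgn_prod x \<partial>R) = (\<Prod>i<d. K i (A i))"
    unfolding K_def by (rule integral_prod_sgn_prod[OF t])
  ultimately show ?thesis by (simp only:)
qed

text \<open>The slice does not depend on coordinate \<open>i\<close>, so by Fubini the integral
  contains the vanishing integral of \<open>l\<close> as a factor. Integrability of the slice is a
  hypothesis, as it can fail for individual \<open>a\<close>; this is what restricts the choice of
  nodes.\<close>

lemma slice_integral_eq_0:
  assumes i: "i < d" and I: "I = {..<d} - {i}" and l: "integrable (\<rho> i) l" "(\<integral>y. l y * s i y \<partial>\<rho> i) = 0"
    and f: "integrable (PiM I \<rho>) (\<lambda>x. f (x(i := a)))"
  shows "integrable R (\<lambda>x. l (x i) * f (x(i := a)))" and "(\<integral>x. l (x i) * f (x(i := a)) * sgn_prod x \<partial>R) = 0"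
proof -
  have ins: "{..<d} = insert i I" "finite I" "i \<notin> I" using i I by auto
  interpret I: finite_product_sigma_finite \<rho> I by standard fact
  interpret fi: finite_measure "\<rho> i" by (rule fin)
  interpret P: pair_sigma_finite "PiM I \<rho>" "\<rho> i" ..
  let ?h = "\<lambda>x. f (x(i := a))"
  have [measurable]: "l \<in> borel_measurable borel" using l(1) measurable_cong_sets[OF sets_\<rho> refl] by auto
  have h_meas [measurable]: "?h \<in> borel_measurable (PiM I \<rho>)" using f by auto
  \<comment> \<open>Measurability is known on the product without coordinate \<open>i\<close>.
    Restriction to \<open>I\<close> transfers it to \<open>R\<close>, and the update overwrites the
    coordinate lost by restricting.\<close>
  have "(\<lambda>x. ?h (restrict x I)) \<in> borel_measurable R"
    using measurable_comp[OF measurable_restrict_subset[of I "{..<d}" \<rho>] h_meas] I by (auto simp: o_def)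
  moreover have "?h (restrict x I) = ?h x" if "x \<in> space R" for x
  proof -
    have "(restrict x I)(i := a) = x(i := a)"
      using that I by (auto simp: space_PiM PiE_iff extensional_def restrict_def)
    then show ?thesis by simp
  qed
  ultimately have hR [measurable]: "?h \<in> borel_measurable R"
    by (subst (asm) measurable_cong) auto
  have g_meas: "(\<lambda>x. l (x i) * ?h x) \<in> borel_measurable R"
  proof (intro borel_measurable_times hR)
    have "(\<lambda>x. x i) \<in> measurable R (\<rho> i)" using i by (intro measurable_component_singleton) simp
    moreover have "l \<in> borel_measurable (\<rho> i)" using l(1) by auto
    ultimately show "(\<lambda>x. l (x i)) \<in> borel_measurable R" by (rule measurable_compose)
  qed
  have "integrable (PiM I \<rho> \<Otimes>\<^sub>M \<rho> i) (\<lambda>(x, y). ?h x * l y)"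
    by (rule P.integrable_times[OF f l(1)])
  then show 1: "integrable R (\<lambda>x. l (x i) * ?h x)"
    unfolding ins(1) using g_meas
    by (subst integrable_fun_upd_pair[OF ins(2,3)]) (simp_all add: ins(1) mult.commute)
  have s1: "integrable (PiM I \<rho>) (\<lambda>x. ?h x * (\<Prod>j\<in>I. s j (x j)))"
  proof (rule Bochner_Integration.integrable_bound[OF f])
    note [measurable] = s_meas
    show "(\<lambda>x. ?h x * (\<Prod>j\<in>I. s j (x j))) \<in> borel_measurable (PiM I \<rho>)" by measurable
  qed (auto simp: abs_mult abs_prod s)
  have sgi: "sgn_prod (x(i := y)) = (\<Prod>j\<in>I. s j (x j)) * s i y" for x y
  proof -
    have "(\<Prod>j\<in>I. s j ((x(i := y)) j)) = (\<Prod>j\<in>I. s j (x j))" using ins by (intro prod.cong) auto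
    then show ?thesis unfolding sgn_prod_def ins(1) using ins by simp
  qed
  have m2: "(\<lambda>x. l (x i) * ?h x * sgn_prod x) \<in> borel_measurable R" using g_meas by measurable
  have "(\<integral>x. l (x i) * ?h x * sgn_prod x \<partial>R) = (\<integral>(x, y). (?h x * (\<Prod>j\<in>I. s j (x j))) * (l y * s i y) \<partial>(PiM I \<rho> \<Otimes>\<^sub>M \<rho> i))"
    using integrable_fun_upd_pair(2)[OF ins(2,3) m2[unfolded ins(1)]]
    unfolding ins(1)[symmetric] by (simp add: sgi mult_ac)
  also have "\<dots> = (\<integral>y. \<integral>x. (?h x * (\<Prod>j\<in>I. s j (x j))) * (l y * s i y) \<partial>PiM I \<rho> \<partial>\<rho> i)"
    by (rule P.integral_snd[symmetric]) (rule P.integrable_times[OF s1 integrable_times_s[OF l(1)]])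
  also have "\<dots> = 0" by (simp add: l(2))
  finally show "(\<integral>x. l (x i) * ?h x * sgn_prod x \<partial>R) = 0" .
qed

text \<open>
  The nodes are taken from the set of points at which the slice of \<open>f\<close> is integrable, which has full
  measure.  If it has fewer than \<open>n i\<close> elements, all of them serve as nodes; then \<open>f'\<close> vanishes almost
  everywhere and the integral is \<open>0\<close>.
\<close>

lemma normalize_coordinate:
  assumes i: "i < d" and f: "continuous_on UNIV f" "box_convex d n f" "integrable R f"
  shows "\<exists>A f'. continuous_on UNIV f' \<and> box_convex d n f' \<and> integrable R f'
    \<and> (\<integral>x. f' x * sgn_prod x \<partial>R) = (\<integral>x. f x * sgn_prod x \<partial>R)
    \<and> (\<forall>x. x i \<in> A \<longrightarrow> f' x = 0)
    \<and> (\<forall>j b. j \<noteq> i \<longrightarrow> (\<forall>x. x j = b \<longrightarrow> f x = 0) \<longrightarrow> (\<forall>x. x j = b \<longrightarrow> f' x = 0))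
    \<and> (card A = n i \<or> (\<integral>x. f x * sgn_prod x \<partial>R) = 0)"
proof -
  define I where "I = {..<d} - {i}"
  have ins: "{..<d} = insert i I" "finite I" "i \<notin> I" using i I_def by auto
  interpret I: finite_product_sigma_finite \<rho> I by standard fact
  interpret fi: finite_measure "\<rho> i" by (rule fin)
  interpret P: pair_sigma_finite "PiM I \<rho>" "\<rho> i" ..
  have [measurable]: "f \<in> borel_measurable R" using f(3) by auto
  define G where "G = {a. integrable (PiM I \<rho>) (\<lambda>x. f (x(i := a)))}"
  have "integrable (PiM I \<rho> \<Otimes>\<^sub>M \<rho> i) (\<lambda>(x, y). f (x(i := y)))"
    using f(3)[unfolded ins(1)] integrable_fun_upd_pair(1)[OF ins(2,3) borel_measurable_integrable[OF f(3)[unfolded ins(1)]]]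
    by (rule iffD1[rotated])
  from P.AE_integrable_snd[OF this] have AE_G: "AE y in \<rho> i. y \<in> G" by (simp add: G_def)
  have "\<exists>A. A \<subseteq> G \<and> finite A \<and> card A \<le> n i \<and> (card A = n i \<or> A = G)"
  proof (cases "finite G \<and> card G < n i")
    case True
    then show ?thesis by (intro exI[of _ G]) simp
  next
    case False
    have "\<exists>T. T \<subseteq> G \<and> finite T \<and> card T = n i"
    proof (cases "finite G")
      case True
      then have "n i \<le> card G" using False by simp
      from obtain_subset_with_card_n[OF this] show ?thesis by metis
    next
      case False
      from infinite_arbitrarily_large[OF this, of "n i"] show ?thesis by metis
    qed
    then obtain T where "T \<subseteq> G" "finite T" "card T = n i" by metis
    then show ?thesis by (intro exI[of _ T]) simp
  qed
  then obtain A where A: "A \<subseteq> G" "finite A" "card A \<le> n i" "card A = n i \<or> A = G" by metis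
  define f' where "f' x = f x - (\<Sum>a\<in>A. lagrange A a (x i) * f (x(i := a)))" for x
  have f'_eq: "f' = (\<lambda>x. f x - (\<Sum>a\<in>A. lagrange A a (x i) * f (x(i := a))))"
    by (rule ext) (rule f'_def)
  note l = integral_lagrange_s[OF i A(2,3)]
  have fa: "integrable (PiM I \<rho>) (\<lambda>x. f (x(i := a)))" if "a \<in> A" for a
    using A(1) that unfolding G_def by blast
  have g: "integrable R (\<lambda>x. lagrange A a (x i) * f (x(i := a)))" "(\<integral>x. lagrange A a (x i) * f (x(i := a)) * sgn_prod x \<partial>R) = 0" if "a \<in> A" for a
    by (rule slice_integral_eq_0[OF i I_def l(1)[OF that] l(2)[OF that] fa[OF that]])+
  have cont: "continuous_on UNIV f'"
  proof -
    have u: "continuous_on UNIV (\<lambda>x. f (x(i := a)))" for a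
    proof (rule continuous_on_compose2[OF f(1)])
      show "continuous_on UNIV (\<lambda>x. x(i := a) :: nat \<Rightarrow> real)"
      proof (rule continuous_on_coordinatewise_then_product)
        fix j show "continuous_on UNIV (\<lambda>x. (x(i := a)) j :: real)"
          by (cases "j = i") simp_all
      qed
    qed simp
    have v: "continuous_on UNIV (\<lambda>x. lagrange A a (x i))" for a
    proof -
      have "(\<lambda>x. lagrange A a (x i)) = (\<lambda>x. \<Prod>b\<in>A - {a}. (1 / (a - b)) * (x i - b))"
        by (simp add: lagrange_def)
      then show ?thesis
        by (simp only:) (intro continuous_on_prod continuous_on_mult continuous_on_diff continuous_on_const continuous_on_product_coordinates)
    qed
    show ?thesis unfolding f'_eq by (intro continuous_on_diff continuous_on_sum continuous_on_mult f(1) u v)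
  qed
  have int: "integrable R f'" unfolding f'_eq
    by (intro Bochner_Integration.integrable_diff f(3) Bochner_Integration.integrable_sum g(1))
  have box: "box_convex d n f'"
    unfolding box_convex_def
  proof (intro allI impI)
    fix X :: "nat \<Rightarrow> nat \<Rightarrow> real" assume X: "\<forall>i<d. inj_on (X i) {..n i}"
    let ?L = "\<lambda>i g. divdiff g (X i) 0 (n i)"
    have L: "linear_functional (?L j)" for j by (rule linear_functional_divdiff)
    \<comment> \<open>The polynomial has degree below \<open>n i\<close>, while the divided
      difference uses \<open>n i + 1\<close> points.\<close>
    have Ll: "?L i (lagrange A a) = 0" if a: "a \<in> A" for a
    proof -
      obtain c where c: "lagrange A a = (\<lambda>x. \<Sum>j<card A. c j * x ^ j)" using lagrange_polynomial[OF A(2) a] by blast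
      have inj: "inj_on (X i) {0..0 + n i}" using X i by (simp add: atMost_atLeast0)
      have "card (X i ` {0..0 + n i}) = Suc (n i)" using card_image[OF inj] by simp
      then show ?thesis
        unfolding divdiff_eq_ddiff[OF inj] c ddiff_sum ddiff_cmult using A(3)
        by (intro sum.neutral) (simp add: ddiff_power_eq_0)
    qed
    have "tensor ?L d (\<lambda>x. lagrange A a (x i) * f (x(i := a))) = 0" if "a \<in> A" for a
      by (rule tensor_coordinate_eq_0[where L = ?L, OF L i]) (rule Ll[OF that])
    then have "(\<Sum>a\<in>A. tensor ?L d (\<lambda>x. lagrange A a (x i) * f (x(i := a)))) = 0" by (intro sum.neutral ballI)
    then have "tensor ?L d f' = tensor ?L d f"
      unfolding f'_eq tensor_linear(3)[of d ?L, OF L] tensor_sum_arg[of d ?L, OF L] by simp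
    then have "mdivdiff n X d f' = mdivdiff n X d f" unfolding mdivdiff_eq_tensor .
    then show "0 \<le> mdivdiff n X d f'" using f(2) X by (simp add: box_convex_def)
  qed
  have eq: "(\<integral>x. f' x * sgn_prod x \<partial>R) = (\<integral>x. f x * sgn_prod x \<partial>R)"
  proof -
    have "(\<integral>x. f' x * sgn_prod x \<partial>R) = (\<integral>x. f x * sgn_prod x - (\<Sum>a\<in>A. lagrange A a (x i) * f (x(i := a)) * sgn_prod x) \<partial>R)"
      unfolding f'_def by (simp add: left_diff_distrib sum_distrib_right)
    also have "\<dots> = (\<integral>x. f x * sgn_prod x \<partial>R) - (\<integral>x. (\<Sum>a\<in>A. lagrange A a (x i) * f (x(i := a)) * sgn_prod x) \<partial>R)"
      by (intro Bochner_Integration.integral_diff integrable_times_sgn_prod f(3) Bochner_Integration.integrable_sum g(1))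
    also have "(\<integral>x. (\<Sum>a\<in>A. lagrange A a (x i) * f (x(i := a)) * sgn_prod x) \<partial>R) = (\<Sum>a\<in>A. \<integral>x. lagrange A a (x i) * f (x(i := a)) * sgn_prod x \<partial>R)"
      by (intro Bochner_Integration.integral_sum integrable_times_sgn_prod g(1))
    also have "\<dots> = 0" by (intro sum.neutral) (simp add: g(2))
    finally show ?thesis by simp
  qed
  have node: "f' x = 0" if "x i \<in> A" for x
  proof -
    have "(\<Sum>a\<in>A. lagrange A a (x i) * f (x(i := a))) = (\<Sum>a\<in>A. if a = x i then f x else 0)"
      using A(2) that by (intro sum.cong) (auto simp: lagrange_eq)
    then show ?thesis using A(2) that by (simp add: f'_def)
  qed
  \<comment> \<open>An update in coordinate \<open>i\<close> leaves \<open>x j = b\<close> intact,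
    so every term of \<open>f'\<close> vanishes. This preserves the nodes already found in other
    coordinates.\<close>
  have keep: "f' x = 0" if "j \<noteq> i" "\<forall>x. x j = b \<longrightarrow> f x = 0" "x j = b" for j b x
    unfolding f'_def using that by simp
  have zero: "(\<integral>x. f x * sgn_prod x \<partial>R) = 0" if "card A \<noteq> n i"
  proof -
    have AG: "A = G" using A(4) that by simp
    have [measurable]: "f' \<in> borel_measurable R" using int by auto
    have i': "integrable R (\<lambda>x. f' x * sgn_prod x)" by (rule integrable_times_sgn_prod[OF int])
    have m: "(\<lambda>x. f' x * sgn_prod x) \<in> borel_measurable (PiM (insert i I) \<rho>)" unfolding ins(1)[symmetric] by measurable
    have i2: "integrable (PiM I \<rho> \<Otimes>\<^sub>M \<rho> i) (\<lambda>(x, y). f' (x(i := y)) * sgn_prod (x(i := y)))"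
      using i' integrable_fun_upd_pair(1)[OF ins(2,3) m] unfolding ins(1)[symmetric] by simp
    have "(\<integral>x. f' x * sgn_prod x \<partial>R) = (\<integral>(x, y). f' (x(i := y)) * sgn_prod (x(i := y)) \<partial>(PiM I \<rho> \<Otimes>\<^sub>M \<rho> i))"
      using integrable_fun_upd_pair(2)[OF ins(2,3) m] unfolding ins(1)[symmetric] .
    also have "\<dots> = (\<integral>y. \<integral>x. f' (x(i := y)) * sgn_prod (x(i := y)) \<partial>PiM I \<rho> \<partial>\<rho> i)"
      by (rule P.integral_snd[OF i2, symmetric])
    also have "\<dots> = (\<integral>y. 0 \<partial>\<rho> i)"
    proof (rule integral_cong_AE)
      show "(\<lambda>y. \<integral>x. f' (x(i := y)) * sgn_prod (x(i := y)) \<partial>PiM I \<rho>) \<in> borel_measurable (\<rho> i)"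
        using P.integrable_snd[OF i2] by auto
      show "AE y in \<rho> i. (\<integral>x. f' (x(i := y)) * sgn_prod (x(i := y)) \<partial>PiM I \<rho>) = 0"
        using AE_G by eventually_elim (simp add: node AG)
    qed simp
    finally show ?thesis using eq by simp
  qed
  show ?thesis
    by (rule exI[of _ A], rule exI[of _ f'], intro conjI cont box int eq) (use node keep zero in blast)+
qed

text \<open>Coordinates are treated one after another, and the zeros produced earlier survive each
  step. A nonzero integral excludes the degenerate alternative with too few nodes.\<close>

lemma normalize:
  assumes f: "continuous_on UNIV f" "box_convex d n f" "integrable R f" and nz: "(\<integral>x. f x * sgn_prod x \<partial>R) \<noteq> 0" and k: "k \<le> d"
  shows "\<exists>A f'. continuous_on UNIV f' \<and> box_convex d n f' \<and> integrable R f'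
    \<and> (\<integral>x. f' x * sgn_prod x \<partial>R) = (\<integral>x. f x * sgn_prod x \<partial>R)
    \<and> (\<forall>i<k. card (A i) = n i \<and> (\<forall>x. x i \<in> A i \<longrightarrow> f' x = 0))"
  using k
proof (induction k)
  case 0
  then show ?case using f by (intro exI[of _ "\<lambda>_. {}"] exI[of _ f]) simp
next
  case (Suc k)
  then obtain A f' where f': "continuous_on UNIV f'" "box_convex d n f'" "integrable R f'"
    "(\<integral>x. f' x * sgn_prod x \<partial>R) = (\<integral>x. f x * sgn_prod x \<partial>R)"
    and A: "\<And>i. i < k \<Longrightarrow> card (A i) = n i" "\<And>i x. i < k \<Longrightarrow> x i \<in> A i \<Longrightarrow> f' x = 0"
    using Suc.IH[OF Suc_leD[OF Suc.prems]] by blast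
  have "k < d" using Suc.prems by simp
  from normalize_coordinate[OF this f'(1-3)] obtain B f'' where
    f'': "continuous_on UNIV f''" "box_convex d n f''" "integrable R f''"
      "(\<integral>x. f'' x * sgn_prod x \<partial>R) = (\<integral>x. f' x * sgn_prod x \<partial>R)"
    and B: "\<And>x. x k \<in> B \<Longrightarrow> f'' x = 0"
      "\<And>j b x. j \<noteq> k \<Longrightarrow> (\<forall>x. x j = b \<longrightarrow> f' x = 0) \<Longrightarrow> x j = b \<Longrightarrow> f'' x = 0"
      "card B = n k \<or> (\<integral>x. f' x * sgn_prod x \<partial>R) = 0"
    by blast
  have cB: "card B = n k" using B(3) f'(4) nz by simp
  have P: "card ((A(k := B)) i) = n i \<and> (\<forall>x. x i \<in> (A(k := B)) i \<longrightarrow> f'' x = 0)" if "i < Suc k" for i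
  proof (cases "i = k")
    case True
    then show ?thesis using cB B(1) by simp
  next
    case False
    then have "i < k" using that by simp
    then have "f'' x = 0" if "x i \<in> A i" for x
      using B(2)[of i "x i" x] False A(2)[of i] that by auto
    then show ?thesis using False A(1)[OF \<open>i < k\<close>] by simp
  qed
  show ?case
    by (rule exI[of _ "A(k := B)"], rule exI[of _ f''], intro conjI f''(1-3) trans[OF f''(4) f'(4)] allI impI)
      (use P in blast)+
qed

text \<open>The argument is by contradiction because normalization presupposes a nonzero integral.
  Each approximant integrates to a sum of nonnegative grid differences times products of the values
  \<open>K i\<close>.\<close>

lemma box_convex_integral_nonneg:
  assumes K: "\<And>A. 0 \<le> (\<Prod>i<d. K i (A i))"
    and f: "continuous_on UNIV f" "box_convex d n f" "integrable R f"
  shows "0 \<le> (\<integral>x. f x * sgn_prod x \<partial>R)"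
proof (rule ccontr)
  assume neg: "\<not> 0 \<le> (\<integral>x. f x * sgn_prod x \<partial>R)"
  then have "(\<integral>x. f x * sgn_prod x \<partial>R) \<noteq> 0" by simp
  from normalize[OF f this order_refl] obtain A F where F: "continuous_on UNIV F" "box_convex d n F" "integrable R F"
      "(\<integral>x. F x * sgn_prod x \<partial>R) = (\<integral>x. f x * sgn_prod x \<partial>R)"
    and A: "\<And>i. i < d \<Longrightarrow> card (A i) = n i" "\<And>i x. i < d \<Longrightarrow> x i \<in> A i \<Longrightarrow> F x = 0" by blast
  interpret normalized_box_convex d n A F
    by (rule normalized_box_convex.intro[OF n A(1) F(1,2) A(2)])
  have "0 \<le> (\<integral>x. F x * sgn_prod x \<partial>R)"
  proof (rule integral_nonneg_of_approx[OF sets_R F(3) _ sgn_prod_measurable abs_sgn_prod])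
    show "integrable R (\<lambda>x. \<Prod>i<d. (1 + \<bar>x i\<bar>) ^ (n i - 1))"
    proof (rule product_integrable_prod)
      fix i assume "i \<in> {..<d}"
      then show "integrable (\<rho> i) (\<lambda>x. (1 + \<bar>x\<bar>) ^ (n i - 1))"
        by (intro moment_measure_integrable[OF moment, where C = 1]) auto
    qed simp
    fix N B :: nat assume "N > 0"
    let ?k = "\<lambda>\<tau> x. \<Prod>i<d. peano_kernel (A i) (n i - 1) (real_of_int (\<tau> i) / N) (x i)"
    have ik: "integrable R (?k \<tau>)" for \<tau> :: "nat \<Rightarrow> int"
      by (intro product_integrable_prod integral_peano_kernel_s(1) A(1)) simp_all
    have vk: "(\<integral>x. ?k \<tau> x * sgn_prod x \<partial>R) = (\<Prod>i<d. K i (real_of_int (\<tau> i) / N))" for \<tau> :: "nat \<Rightarrow> int"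
    proof -
      have "(\<integral>x. ?k \<tau> x * sgn_prod x \<partial>R) = (\<Prod>i<d. \<integral>x. peano_kernel (A i) (n i - 1) (real_of_int (\<tau> i) / N) x * s i x \<partial>\<rho> i)"
        by (intro integral_prod_sgn_prod integral_peano_kernel_s(1) A(1))
      also have "\<dots> = (\<Prod>i<d. K i (real_of_int (\<tau> i) / N))"
        by (intro prod.cong refl integral_peano_kernel_s(2) A(1)) simp_all
      finally show ?thesis .
    qed
    have "(\<integral>x. approx N B x * sgn_prod x \<partial>R) = (\<integral>x. (\<Sum>\<tau>\<in>grid_box N B. grid_diff N \<tau> * (?k \<tau> x * sgn_prod x)) \<partial>R)"
      unfolding approx_def by (simp add: sum_distrib_left sum_distrib_right mult_ac)
    also have "\<dots> = (\<Sum>\<tau>\<in>grid_box N B. \<integral>x. grid_diff N \<tau> * (?k \<tau> x * sgn_prod x) \<partial>R)"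
      by (intro Bochner_Integration.integral_sum integrable_mult_right integrable_times_sgn_prod ik)
    also have "\<dots> = (\<Sum>\<tau>\<in>grid_box N B. grid_diff N \<tau> * (\<Prod>i<d. K i (real_of_int (\<tau> i) / N)))"
      by (simp only: integral_mult_right_zero vk)
    also have "\<dots> \<ge> 0"
      by (intro sum_nonneg mult_nonneg_nonneg grid_diff_nonneg \<open>N > 0\<close> K)
    finally show "0 \<le> (\<integral>x. approx N B x * sgn_prod x \<partial>R)" .
  qed
  then show False using F(4) neg by simp
qed

end

section \<open>Polar form of the product signed measure\<close>

lemma emeasure_density_indicator:
  assumes "Q \<in> sets M" "A \<in> sets M"
  shows "emeasure (density M (indicator Q)) A = emeasure M (Q \<inter> A)"
proof -
  note [measurable] = assms
  have "emeasure (density M (indicator Q)) A = (\<integral>\<^sup>+x. indicator Q x * indicator A x \<partial>M)"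
    by (rule emeasure_density) measurable
  also have "\<dots> = (\<integral>\<^sup>+x. indicator (Q \<inter> A) x \<partial>M)"
    by (simp only: indicator_inter_arith)
  also have "\<dots> = emeasure M (Q \<inter> A)" by (rule nn_integral_indicator) measurable
  finally show ?thesis .
qed

lemma finite_measure_density_indicator:
  assumes "finite_measure M" "Q \<in> sets M"
  shows "finite_measure (density M (indicator Q))"
proof (rule finite_measureI)
  have "emeasure (density M (indicator Q)) (space M) = emeasure M (Q \<inter> space M)"
    using assms(2) by (intro emeasure_density_indicator) simp_all
  then show "emeasure (density M (indicator Q)) (space (density M (indicator Q))) \<noteq> \<infinity>"
    using finite_measure.emeasure_finite[OF assms(1), of "Q \<inter> space M"] by simp
qed

text \<open>Products of Jordan parts become restrictions of the single measure \<open>R\<close> to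
  boxes. Values on boxes determine a product measure, so comparing them suffices.\<close>

lemma PiM_density_indicator:
  assumes fin: "\<And>i. finite_measure (M i)" and I: "finite I" and Q: "\<And>i. Q i \<in> sets (M i)"
  shows "PiM I (\<lambda>i. density (M i) (indicator (Q i))) = density (PiM I M) (indicator (PiE I Q))"
proof -
  interpret M: product_sigma_finite M
    using fin by (simp add: product_sigma_finite_def finite_measure_def)
  interpret D: product_sigma_finite "\<lambda>i. density (M i) (indicator (Q i))"
    using finite_measure_density_indicator[OF fin Q] by (simp add: product_sigma_finite_def finite_measure_def)
  have "density (PiM I M) (indicator (PiE I Q)) = PiM I (\<lambda>i. density (M i) (indicator (Q i)))"
  proof (rule D.PiM_eqI[OF I])
    show "sets (density (PiM I M) (indicator (PiE I Q))) = sets (PiM I (\<lambda>i. density (M i) (indicator (Q i))))"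
      by (simp cong: sets_PiM_cong)
    fix A assume A: "\<And>i. i \<in> I \<Longrightarrow> A i \<in> sets (density (M i) (indicator (Q i)))"
    then have A': "A i \<in> sets (M i)" if "i \<in> I" for i using that by simp
    have "emeasure (density (PiM I M) (indicator (PiE I Q))) (PiE I A) = emeasure (PiM I M) (PiE I Q \<inter> PiE I A)"
      by (intro emeasure_density_indicator sets_PiM_I_finite I Q A')
    also have "PiE I Q \<inter> PiE I A = PiE I (\<lambda>i. Q i \<inter> A i)" by (rule PiE_Int)
    also have "emeasure (PiM I M) \<dots> = (\<Prod>i\<in>I. emeasure (M i) (Q i \<inter> A i))"
      by (intro M.emeasure_PiM I sets.Int Q A')
    also have "\<dots> = (\<Prod>i\<in>I. emeasure (density (M i) (indicator (Q i))) (A i))"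
      by (intro prod.cong refl emeasure_density_indicator[symmetric] Q A')
    finally show "emeasure (density (PiM I M) (indicator (PiE I Q))) (PiE I A)
       = (\<Prod>i\<in>I. emeasure (density (M i) (indicator (Q i))) (A i))" .
  qed
  then show ?thesis by (rule sym)
qed

text \<open>Each sign is the indicator of \<open>s = 1\<close> minus that of \<open>s = - 1\<close>;
  multiplying out gives one term for each set \<open>S\<close> of coordinates that take the negative
  indicator. This is the pointwise counterpart of \<open>sprod\<close>.\<close>

lemma sum_sign_indicator:
  fixes s :: "nat \<Rightarrow> real \<Rightarrow> real"
  assumes s: "\<And>i x. s i x = 1 \<or> s i x = - 1" and x: "x \<in> extensional {..<d}"
  shows "(\<Sum>S\<in>Pow {..<d}. (- 1) ^ card S * indicator (PiE {..<d} (\<lambda>i. {u. s i u = (if i \<in> S then - 1 else 1)})) x)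
    = (\<Prod>i<d. s i (x i))"
proof -
  let ?m = "\<lambda>i. - (if s i (x i) = - 1 then 1 else 0 :: real)" and ?p = "\<lambda>i. if s i (x i) = 1 then 1 else 0 :: real"
  have "s i (x i) = ?m i + ?p i" for i using s[of i "x i"] by auto
  then have "(\<Prod>i<d. s i (x i)) = (\<Prod>i<d. ?m i + ?p i)" by (intro prod.cong refl)
  also have "\<dots> = (\<Sum>S\<in>Pow {..<d}. (\<Prod>i\<in>S. ?m i) * (\<Prod>i\<in>{..<d} - S. ?p i))"
    by (rule prod_add) simp
  also have "\<dots> = (\<Sum>S\<in>Pow {..<d}. (- 1) ^ card S * indicator (PiE {..<d} (\<lambda>i. {u. s i u = (if i \<in> S then - 1 else 1)})) x)"
  proof (rule sum.cong[OF refl])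
    fix S assume "S \<in> Pow {..<d}"
    then have S: "S \<subseteq> {..<d}" "finite S" using finite_subset by auto
    let ?g = "\<lambda>i. indicator {u. s i u = (if i \<in> S then - 1 else 1)} (x i) :: real"
    have "(\<Prod>i\<in>S. ?m i) * (\<Prod>i\<in>{..<d} - S. ?p i) = (\<Prod>i\<in>S. - 1 * ?g i) * (\<Prod>i\<in>{..<d} - S. ?g i)"
      by (intro arg_cong2[where f = "(*)"] prod.cong refl) (auto simp: indicator_def)
    also have "\<dots> = (- 1) ^ card S * ((\<Prod>i\<in>S. ?g i) * (\<Prod>i\<in>{..<d} - S. ?g i))"
      unfolding prod.distrib by (simp add: mult.assoc)
    also have "(\<Prod>i\<in>S. ?g i) * (\<Prod>i\<in>{..<d} - S. ?g i) = (\<Prod>i<d. ?g i)"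
      using prod.subset_diff[OF S(1), of ?g] by (simp add: mult.commute)
    also have "\<dots> = indicator (PiE {..<d} (\<lambda>i. {u. s i u = (if i \<in> S then - 1 else 1)})) x"
    proof (cases "\<forall>i<d. s i (x i) = (if i \<in> S then - 1 else 1)")
      case True
      then have "x \<in> PiE {..<d} (\<lambda>i. {u. s i u = (if i \<in> S then - 1 else 1)})" using x by (auto simp: PiE_iff)
      moreover have "(\<Prod>i<d. ?g i) = 1" using True by (intro prod.neutral) (auto simp: indicator_def)
      ultimately show ?thesis by simp
    next
      case False
      then obtain i where i: "i < d" "s i (x i) \<noteq> (if i \<in> S then - 1 else 1)" by blast
      have "x \<notin> PiE {..<d} (\<lambda>i. {u. s i u = (if i \<in> S then - 1 else 1)})"
      proof
        assume "x \<in> PiE {..<d} (\<lambda>i. {u. s i u = (if i \<in> S then - 1 else 1)})"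
        from PiE_mem[OF this, of i] i show False by simp
      qed
      moreover have "?g i = 0" using i(2) by (simp add: indicator_def)
      have "(\<Prod>i<d. ?g i) = 0"
      proof (rule prod_zero)
        show "\<exists>i\<in>{..<d}. ?g i = 0" using \<open>?g i = 0\<close> i(1) by blast
      qed simp
      ultimately show ?thesis by simp
    qed
    finally show "(\<Prod>i\<in>S. ?m i) * (\<Prod>i\<in>{..<d} - S. ?p i)
      = (- 1) ^ card S * indicator (PiE {..<d} (\<lambda>i. {u. s i u = (if i \<in> S then - 1 else 1)})) x" .
  qed
  finally show ?thesis by (rule sym)
qed

text \<open>Each summand of \<open>sprod\<close> is \<open>R\<close> restricted to the box with sign
  pattern \<open>S\<close>, and the signed indicators of these boxes add up to
  \<open>sgn_prod\<close>. The Jordan parts of the product are thereby known as well.\<close>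

lemma (in product_density) signed_density_sprod:
  assumes \<tau>: "\<And>i. i < d \<Longrightarrow> signed_density borel (\<rho> i) (s i) (\<tau> i)"
  shows "signed_density (Rd d) R sgn_prod (sprod d \<tau>)"
proof (rule signed_density.intro)
  note [measurable] = s_meas
  have "emeasure R (space R) = (\<Prod>i<d. emeasure (\<rho> i) (space (\<rho> i)))"
    unfolding space_PiM by (rule emeasure_PiM) simp_all
  also have "\<dots> \<noteq> \<infinity>"
    using finite_measure.emeasure_finite[OF fin] by (simp add: ennreal_prod_eq_top)
  finally show finR: "finite_measure R" by (rule finite_measureI)
  show "sets R = sets (Rd d)" by (rule sets_R)
  show "sgn_prod \<in> borel_measurable (Rd d)" by (rule sgn_prod_measurable)
  show "\<bar>sgn_prod x\<bar> = 1" for x by (rule abs_sgn_prod)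
  have sc: "s i x = 1 \<or> s i x = - 1" for i x using s[of i x] by (auto simp: abs_if split: if_splits)
  fix E assume "E \<in> sets (Rd d)"
  then have E: "E \<in> sets R" by (simp add: sets_R)
  let ?Q = "\<lambda>S i. {u. s i u = (if i \<in> S then - 1 else 1)}"
  have Q: "?Q S i \<in> sets (\<rho> i)" for S i
  proof -
    have "{u \<in> space borel. s i u = (if i \<in> S then - 1 else 1)} \<in> sets borel" by measurable
    then show ?thesis by (simp add: sets_\<rho>)
  qed
  have PQ: "PiE {..<d} (?Q S) \<in> sets R" for S by (intro sets_PiM_I_finite Q) simp
  have part: "measure (PiM {..<d} (\<lambda>i. if i \<in> S then neg_part borel (\<tau> i) else pos_part borel (\<tau> i))) E
      = (\<integral>x. indicator E x * indicator (PiE {..<d} (?Q S)) x \<partial>R)" for S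
  proof -
    have "PiM {..<d} (\<lambda>i. if i \<in> S then neg_part borel (\<tau> i) else pos_part borel (\<tau> i))
      = PiM {..<d} (\<lambda>i. density (\<rho> i) (indicator (?Q S i)))"
    proof (rule PiM_cong[OF refl])
      fix i assume "i \<in> {..<d}"
      then interpret signed_density borel "\<rho> i" "s i" "\<tau> i" by (intro \<tau>) simp
      show "(if i \<in> S then neg_part borel (\<tau> i) else pos_part borel (\<tau> i)) = density (\<rho> i) (indicator (?Q S i))"
        by (simp add: neg_part_eq pos_part_eq)
    qed
    also have "\<dots> = density R (indicator (PiE {..<d} (?Q S)))"
      by (rule PiM_density_indicator[OF fin _ Q]) simp
    finally have eq: "PiM {..<d} (\<lambda>i. if i \<in> S then neg_part borel (\<tau> i) else pos_part borel (\<tau> i))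
      = density R (indicator (PiE {..<d} (?Q S)))" .
    have "(\<integral>x. indicator E x * indicator (PiE {..<d} (?Q S)) x \<partial>R) = (\<integral>x. indicator (PiE {..<d} (?Q S) \<inter> E) x \<partial>R :: real)"
      by (simp only: indicator_inter_arith mult.commute)
    also have "\<dots> = measure R (PiE {..<d} (?Q S) \<inter> E)"
      using sets.sets_into_space[OF E] by (simp add: Int_absorb2 le_infI2)
    also have "\<dots> = measure (density R (indicator (PiE {..<d} (?Q S)))) E"
      unfolding measure_def by (simp only: emeasure_density_indicator[OF PQ E])
    finally show ?thesis unfolding eq by (rule sym)
  qed
  have int: "integrable R (\<lambda>x. indicator E x * indicator (PiE {..<d} (?Q S)) x :: real)" for S
  proof -
    have "integrable R (indicator (E \<inter> PiE {..<d} (?Q S)) :: _ \<Rightarrow> real)"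
      using E PQ[of S] finite_measure.emeasure_finite[OF finR, of "E \<inter> PiE {..<d} (?Q S)"]
      by (intro integrable_real_indicator sets.Int) (simp_all add: less_top[symmetric])
    moreover have "indicator (E \<inter> PiE {..<d} (?Q S)) = (\<lambda>x. indicator E x * indicator (PiE {..<d} (?Q S)) x :: real)"
      by (rule ext) (rule indicator_inter_arith)
    ultimately show ?thesis by (simp only:)
  qed
  have "sprod d \<tau> E = (\<Sum>S\<in>Pow {..<d}. (- 1) ^ card S * (\<integral>x. indicator E x * indicator (PiE {..<d} (?Q S)) x \<partial>R))"
    unfolding sprod_def part ..
  also have "\<dots> = (\<integral>x. (\<Sum>S\<in>Pow {..<d}. (- 1) ^ card S * (indicator E x * indicator (PiE {..<d} (?Q S)) x)) \<partial>R)"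
    by (subst Bochner_Integration.integral_sum) (simp_all add: int)
  also have "\<dots> = (\<integral>x. indicator E x * sgn_prod x \<partial>R)"
  proof (intro Bochner_Integration.integral_cong refl)
    fix x assume "x \<in> space R"
    then have x: "x \<in> extensional {..<d}" by (simp add: space_PiM PiE_def)
    have "(\<Sum>S\<in>Pow {..<d}. (- 1) ^ card S * (indicator E x * indicator (PiE {..<d} (?Q S)) x))
       = (indicator E x :: real) * (\<Sum>S\<in>Pow {..<d}. (- 1) ^ card S * indicator (PiE {..<d} (?Q S)) x)"
      unfolding sum_distrib_left by (intro sum.cong refl) (simp only: mult.left_commute)
    then show "(\<Sum>S\<in>Pow {..<d}. (- 1) ^ card S * (indicator E x * indicator (PiE {..<d} (?Q S)) x)) = indicator E x * sgn_prod x"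
      unfolding sum_sign_indicator[OF sc x] sgn_prod_def .
  qed
  finally show "sprod d \<tau> E = (\<integral>x. indicator E x * sgn_prod x \<partial>R)" .
qed

lemma (in product_density) box_cx_nonneg_iff:
  assumes \<tau>: "\<And>i. i < d \<Longrightarrow> signed_density borel (\<rho> i) (s i) (\<tau> i)"
  shows "box_cx_nonneg d n (sprod d \<tau>) \<longleftrightarrow> (\<forall>A. 0 \<le> (\<Prod>i<d. K i (A i)))"
proof -
  interpret sd: signed_density "Rd d" R sgn_prod "sprod d \<tau>" by (rule signed_density_sprod[OF \<tau>])
  show ?thesis
  proof
    assume cx: "box_cx_nonneg d n (sprod d \<tau>)"
    show "\<forall>A. 0 \<le> (\<Prod>i<d. K i (A i))"
    proof (rule allI, rule kernel_prod_nonneg_of_box_convex)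
      fix F assume F: "continuous_on UNIV F" "box_convex d n F" "integrable R F"
      have "continuous_on (space (Rd d)) F" using F(1) by (rule continuous_on_subset) simp
      then have "0 \<le> sintegral (Rd d) (sprod d \<tau>) F"
        using cx F(2,3) unfolding box_cx_nonneg_def sd.sintegrable_iff by blast
      then show "0 \<le> (\<integral>x. F x * sgn_prod x \<partial>R)" by (simp only: sd.sintegral_eq[OF F(3)])
    qed
  next
    assume K: "\<forall>A. 0 \<le> (\<Prod>i<d. K i (A i))"
    show "box_cx_nonneg d n (sprod d \<tau>)"
      unfolding box_cx_nonneg_def sd.sintegrable_iff
    proof (intro allI impI, elim conjE)
      fix f assume f: "continuous_on (space (Rd d)) f" "box_convex d n f" "integrable R f"
      \<comment> \<open>Continuity of \<open>f\<close> is given only on extensional functions.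
        Composing with restriction extends \<open>f\<close> to all functions and changes neither its
        values on \<open>space R\<close> nor its mixed divided differences.\<close>
      let ?f = "\<lambda>x. f (restrict x {..<d})"
      have sp: "restrict x {..<d} = x" if "x \<in> space R" for x
        using that by (auto simp: space_PiM PiE_def extensional_restrict)
      have "continuous_on UNIV ?f"
      proof (rule continuous_on_compose2[OF f(1)])
        show "continuous_on UNIV (\<lambda>x. restrict x {..<d} :: nat \<Rightarrow> real)"
        proof (rule continuous_on_coordinatewise_then_product)
          fix i show "continuous_on UNIV (\<lambda>x. restrict x {..<d} i :: real)"
            by (cases "i < d") (simp_all add: restrict_def)
        qed
        show "range (\<lambda>x. restrict x {..<d}) \<subseteq> space (Rd d)" by (auto simp: space_PiM intro!: restrict_PiE_iff[THEN iffD2])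
      qed
      moreover have "box_convex d n ?f"
      proof -
        have "mdivdiff n X d ?f = mdivdiff n X d f" for X
          unfolding mdivdiff_eq_tensor by (rule tensor_cong) (simp_all add: extensional_restrict)
        then show ?thesis using f(2) by (simp add: box_convex_def)
      qed
      moreover have "integrable R ?f"
        using f(3) by (subst Bochner_Integration.integrable_cong[OF refl, of _ _ f]) (simp_all add: sp)
      ultimately have "0 \<le> (\<integral>x. ?f x * sgn_prod x \<partial>R)" using K by (intro box_convex_integral_nonneg) blast+
      also have "\<dots> = (\<integral>x. f x * sgn_prod x \<partial>R)"
        by (intro Bochner_Integration.integral_cong refl) (simp add: sp)
      finally show "0 \<le> sintegral (Rd d) (sprod d \<tau>) f" by (simp only: sd.sintegral_eq[OF f(3)])
    qed
  qed
qed

theorem theorem58: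
  fixes d :: nat and n :: "nat \<Rightarrow> nat" and \<mu> \<nu> :: "nat \<Rightarrow> real measure"
  assumes "d \<ge> 1"
    and "\<And>i. i < d \<Longrightarrow> n i \<ge> 2"
    and "\<And>i. i < d \<Longrightarrow> real_distribution (\<mu> i)"
    and "\<And>i. i < d \<Longrightarrow> real_distribution (\<nu> i)"
    and "\<And>i. i < d \<Longrightarrow> integrable (\<mu> i) (\<lambda>x. \<bar>x\<bar> ^ (n i - 1))"
    and "\<And>i. i < d \<Longrightarrow> integrable (\<nu> i) (\<lambda>x. \<bar>x\<bar> ^ (n i - 1))"
  shows "box_cx_nonneg d n
           (sprod d (\<lambda>i. sconv_power (\<lambda>A. measure (\<nu> i) A - measure (\<mu> i) A) (n i)))
     \<longleftrightarrow> (\<forall>A :: nat \<Rightarrow> real.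
           0 \<le> (\<Prod>i<d. fconv_power
                 (\<lambda>x. tail (measure (\<nu> i)) x - tail (measure (\<mu> i)) x) (n i) (A i)))"
proof -
  let ?\<tau> = "\<lambda>i. sconv_power (\<lambda>A. measure (\<nu> i) A - measure (\<mu> i) A) (n i)"
  let ?g = "\<lambda>i. fconv_power (\<lambda>x. tail (measure (\<nu> i)) x - tail (measure (\<mu> i)) x) (n i)"
  define P where "P i r t \<longleftrightarrow> signed_density borel r t (?\<tau> i) \<and> moment_measure (n i - 1) r
    \<and> (\<forall>j<n i. (\<integral>x. x ^ j * t x \<partial>r) = 0) \<and> (\<forall>A. ?g i A = (\<integral>x. tpow (n i - 1) A x * t x \<partial>r))" for i r t
  \<comment> \<open>The implication under the quantifiers makes the statement hold for every
    \<open>i\<close>, so that \<open>\<rho>\<close> and \<open>s\<close> can be chosen as total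
    functions.\<close>
  have "\<exists>r t. i < d \<longrightarrow> P i r t" for i
  proof (cases "i < d")
    case True
    have "n i \<ge> 1" using assms(2)[OF True] by simp
    from coordinate_density[OF assms(3)[OF True] assms(5)[OF True] assms(4)[OF True] assms(6)[OF True] this]
    have "\<exists>r t. P i r t" unfolding P_def .
    then show ?thesis by blast
  qed simp
  then obtain \<rho> s where "\<And>i. i < d \<Longrightarrow> P i (\<rho> i) (s i)" by metis
  then have \<rho>: "signed_density borel (\<rho> i) (s i) (?\<tau> i)" "moment_measure (n i - 1) (\<rho> i)"
    "j < n i \<Longrightarrow> (\<integral>x. x ^ j * s i x \<partial>\<rho> i) = 0" "?g i A = (\<integral>x. tpow (n i - 1) A x * s i x \<partial>\<rho> i)"
    if "i < d" for i j A
    using that unfolding P_def by blast+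
  \<comment> \<open>Coordinates beyond \<open>d\<close> get a dummy measure: products are only taken over families that are finite throughout.\<close>
  define \<rho>' where "\<rho>' i = (if i < d then \<rho> i else return borel 0)" for i
  define s' where "s' i = (if i < d then s i else (\<lambda>_. 1))" for i
  have e: "\<rho>' i = \<rho> i" "s' i = s i" if "i < d" for i using that by (simp_all add: \<rho>'_def s'_def)
  interpret product_density d n \<rho>' s'
  proof (rule product_density.intro)
    show "finite_measure (\<rho>' i)" for i
      using \<rho>(2)[of i] prob_space.finite_measure[OF prob_space_return[of 0 borel]]
      by (cases "i < d") (simp_all add: \<rho>'_def moment_measure_def)
    show "sets (\<rho>' i) = sets borel" for i
      using \<rho>(2)[of i] by (cases "i < d") (simp_all add: \<rho>'_def moment_measure_def)
    show "s' i \<in> borel_measurable borel" for i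
      using signed_density.s_meas[OF \<rho>(1)] by (cases "i < d") (simp_all add: s'_def)
    show "\<bar>s' i x\<bar> = 1" for i x
      using signed_density.s[OF \<rho>(1)] by (cases "i < d") (simp_all add: s'_def)
    show "moment_measure (n i - 1) (\<rho>' i)" if "i < d" for i
      unfolding e[OF that] by (rule \<rho>(2)[OF that])
    show "(\<integral>x. x ^ j * s' i x \<partial>\<rho>' i) = 0" if "i < d" "j < n i" for i j
      unfolding e[OF that(1)] by (rule \<rho>(3)[OF that])
  qed (rule assms(2))
  have "signed_density borel (\<rho>' i) (s' i) (?\<tau> i)" if "i < d" for i
    unfolding e[OF that] by (rule \<rho>(1)[OF that])
  then have "box_cx_nonneg d n (sprod d ?\<tau>) \<longleftrightarrow> (\<forall>A. 0 \<le> (\<Prod>i<d. K i (A i)))"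
    by (rule box_cx_nonneg_iff)
  moreover have "(\<Prod>i<d. K i (A i)) = (\<Prod>i<d. ?g i (A i))" for A
  proof (intro prod.cong refl)
    fix i assume "i \<in> {..<d}"
    then have i: "i < d" by simp
    show "K i (A i) = ?g i (A i)" unfolding K_def e[OF i] by (rule \<rho>(4)[OF i, symmetric])
  qed
  ultimately show ?thesis by (simp only:)
qed

end
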